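(* Let $P$ be an $r\times r$ refinement mask with solution space $R(P)\subset W_2^s(\mathbb{R}^d)$, and assume that $P$ provides coherent approximation order $k$ in $W_2^s(\mathbb{R}^d)$. Then: (a) Let $S_P\subset W_2^s(\mathbb{R}^d)$ be the shift-invariant space generated by $R(P)$, i.e., the smallest closed shift-invariant subspace of $W_2^s(\mathbb{R}^d)$ that contains each entry of each vector in $R(P)$. Then $S_P$ is an FSI space and provides approximation order $k$. (b) Let $v$ be a regular universal supervector of order $k$ that is bounded in a neighborhood of the origin, and let $\Phi\in R(P)$ be a solution of the refinement equation. Then: (i) $v^*G^0_{\Phi,s}v=O(|\cdot|^{2k})$ around the origin. In particular, the function $\psi$ defined by $\widehat\psi=v^*\widehat\Phi$ satisfies the Strang-Fix conditions of order $k$. (ii) If, for some positive $c$, $|v^*\widehat\Phi|\ge c$ a.e. in some neighborhood of the origin, then $S_\Phi(W_2^s)$ provides approximation order $k$. Moreover, with $\psi\in S_\Phi(W_2^s)$ defined by $\widehat\psi=v^*\widehat\Phi$, the PSI space $S_\psi(W_2^s)$ already provides that approximation order.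
   Context: Sobolev and shift-invariant spaces: $\widehat f(\omega)=\int f(x)e^{-i\omega\cdot x}dx$; $W_2^s=W_2^s(\mathbb{R}^d)$ is the space of tempered distributions $f$ with $\widehat f$ locally in $L_2$ and $\|f\|_{W_2^s}^2=\int(1+|\omega|)^{2s}|\widehat f(\omega)|^2d\omega<\infty$. A closed subspace is shift-invariant if it is invariant under integer translations; $S_\Phi(W_2^s)$ is the smallest closed shift-invariant subspace containing (the entries of) $\Phi$; it is FSI if $\Phi$ is finite and PSI if $\Phi$ is a singleton. For $k>s$, a shift-invariant $S\subset W_2^s$ provides approximation order $k$ if, with $S^h=\{g(\cdot/h):g\in S\}$, there is a constant $C$ with $\inf_{g\in S^h}\|f-g\|_{W_2^s}\le Ch^{k-s}\|f\|_{W_2^k}$ for all $f\in W_2^k$, $h>0$. Refinement: a refinement mask $P$ is an $r\times r$ matrix of $2\pi$-periodic measurable functions on $\mathbb{R}^d$; $R(P)$ is the linear space of all vectors $\Phi$ with $r$ compactly supported distributional entries satisfying $\widehat\Phi(2\cdot)=P\widehat\Phi$; it is taken to be finite dimensional (as is the case when the entries of $P$ are trigonometric polynomials). $R(P)\subset W_2^s$ means that every entry of every $\Phi\in R(P)$ lies in $W_2^s$. Gramians: for $\Phi\in R(P)$, $G_{\Phi,s}=\sum_{\alpha\in2\pi\mathbb{Z}^d}\widehat\Phi(\cdot+\alpha)\widehat\Phi^*(\cdot+\alpha)|\cdot+\alpha|^{2s}$, and $G^0_{\Phi,s}$ is the same sum over $\alpha\in2\pi\mathbb{Z}^d\setminus\{0\}$.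 With $(\Phi_1,\dots,\Phi_n)$ a basis of $R(P)$, the combined Gramian is $G_{R(P),s}=\sum_jG_{\Phi_j,s}$ and the truncated combined Gramian is $G^0_{R(P),s}=\sum_jG^0_{\Phi_j,s}$ (the notions below do not depend on the basis). $P$ provides coherent approximation order $k$ in $W_2^s$ if for some neighborhood $\Omega$ of $0$ the function $\omega\mapsto|\omega|^{-(2k-2s)}\inf_v\frac{v^*G^0_{R(P),s}(\omega)v}{v^*G_{R(P),s}(\omega)v}$ is in $L_\infty(\Omega)$. A measurable $v:\Omega\to\mathbb{C}^r$ on a neighborhood $\Omega$ of the origin is a regular universal supervector of order $k$ if, near the origin, $\frac{v^*G_{R(P),s}v}{v^*v}\sim|\cdot|^{2s}$ (two-sided bounds by positive constants) and $\frac{v^*G^0_{R(P),s}v}{v^*v}=O(|\cdot|^{2k})$. When $\widehat\psi=v^*\widehat\Phi$ is written, $v$ (bounded near the origin) is understood to be extended to a bounded measurable $2\pi$-periodic vector-valued function on $\mathbb{R}^d$. $\psi$ satisfies the Strang-Fix conditions of order $k$ if, near the origin, $|\widehat\psi(\cdot+\alpha)|=O(|\cdot|^k)$ for all $\alpha\in2\pi\mathbb{Z}^d\setminus\{0\}$.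
   Formalization: The order k is assumed nonnegative in addition to k > s; for s < k < 0 part (a) fails as written, e.g. d = r = 1, P = 2, R(P) spanned by the derivative of the delta distribution, s = -2, k = -1. *)

theory Defs
  imports "HOL-Analysis.Analysis" "HOL-Library.Function_Algebras"
begin

definition partial_derivative ::
  "'d::finite \<Rightarrow> (real^'d \<Rightarrow> complex) \<Rightarrow> real^'d \<Rightarrow> complex" where
  "partial_derivative i f x = frechet_derivative f (at x) (axis i 1)"

primrec iterated_partial ::
  "'d::finite list \<Rightarrow> (real^'d \<Rightarrow> complex) \<Rightarrow> real^'d \<Rightarrow> complex" where
  "iterated_partial [] f = f"
| "iterated_partial (i # is) f = partial_derivative i (iterated_partial is f)"

definition schwartz :: "(real^'d::finite \<Rightarrow> complex) \<Rightarrow> bool" where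
  "schwartz f \<longleftrightarrow>
     (\<forall>is. (\<forall>x. iterated_partial is f differentiable (at x)) \<and>
           (\<forall>N. bounded (range (\<lambda>x. (1 + norm x) ^ N *\<^sub>R iterated_partial is f x))))"

definition schwartz_norm :: "nat \<Rightarrow> (real^'d::finite \<Rightarrow> complex) \<Rightarrow> real" where
  "schwartz_norm N f =
     (\<Sum>is | length is \<le> N. SUP x. (1 + norm x) ^ N * norm (iterated_partial is f x))"

type_synonym 'd distr = "(real^'d \<Rightarrow> complex) \<Rightarrow> complex"

text \<open>
  A tempered distribution is a total function on \<^typ>\<open>real^'d \<Rightarrow> complex\<close>. The last clause fixes
  its values outside the Schwartz space, so that two distributions are equal as soon as they agree
  on Schwartz functions. The bound by one of the norms above is continuity.
\<close>

definition tempered :: "('d::finite) distr \<Rightarrow> bool" where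
  "tempered T \<longleftrightarrow>
     (\<forall>f g. schwartz f \<longrightarrow> schwartz g \<longrightarrow> T (\<lambda>x. f x + g x) = T f + T g) \<and>
     (\<forall>c f. schwartz f \<longrightarrow> T (\<lambda>x. c * f x) = c * T f) \<and>
     (\<exists>C N. \<forall>f. schwartz f \<longrightarrow> norm (T f) \<le> C * schwartz_norm N f) \<and>
     (\<forall>f. \<not> schwartz f \<longrightarrow> T f = 0)"

definition distr_scale :: "complex \<Rightarrow> ('d::finite) distr \<Rightarrow> 'd distr" where
  "distr_scale c T = (\<lambda>f. c * T f)"

definition distr_vec_scale :: "complex \<Rightarrow> ('d::finite) distr ^ 'r \<Rightarrow> 'd distr ^ 'r::finite" where
  "distr_vec_scale c \<Phi> = (\<chi> i. distr_scale c (\<Phi> $ i))"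

interpretation distr: vector_space distr_scale
  by unfold_locales (auto simp: distr_scale_def fun_eq_iff algebra_simps)

interpretation distr_vec: vector_space distr_vec_scale
  by unfold_locales
    (auto simp: distr_vec_scale_def distr_scale_def vec_eq_iff fun_eq_iff algebra_simps)

text \<open>
  The distribution vanishes on the complement of some compact set. Compactly supported
  distributions are automatically tempered, so nothing is lost by working with
  \<^const>\<open>tempered\<close> ones only.
\<close>

definition compactly_supported :: "('d::finite) distr \<Rightarrow> bool" where
  "compactly_supported T \<longleftrightarrow>
     (\<exists>K. compact K \<and>
        (\<forall>f. schwartz f \<longrightarrow> compact (closure {x. f x \<noteq> 0}) \<longrightarrow>
             closure {x. f x \<noteq> 0} \<inter> K = {} \<longrightarrow> T f = 0))"

definition translate :: "real^'d::finite \<Rightarrow> 'd distr \<Rightarrow> 'd distr" where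
  \<comment> \<open>\<open>T(\<cdot> - a)\<close>\<close>
  "translate a T = (\<lambda>f. T (\<lambda>x. f (x + a)))"

definition dilate :: "real \<Rightarrow> ('d::finite) distr \<Rightarrow> 'd distr" where
  \<comment> \<open>\<open>T(\<cdot> / h)\<close>\<close>
  "dilate h T = (\<lambda>f. of_real (h ^ CARD('d)) * T (\<lambda>x. f (h *\<^sub>R x)))"

definition fourier :: "(real^'d::finite \<Rightarrow> complex) \<Rightarrow> real^'d \<Rightarrow> complex" where
  "fourier f \<omega> = (\<integral>x. f x * exp (- (\<i> * of_real (\<omega> \<bullet> x))) \<partial>lebesgue)"

text \<open>
  The Fourier transform of \<open>T\<close>, i.e. the functional \<open>f \<mapsto> T (fourier f)\<close>, is given by the function
  \<open>F\<close>. This determines \<open>F\<close> almost everywhere; \<open>fhat T\<close> is a representative, and everything below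
  depends on it only up to null sets.
\<close>

definition has_fourier :: "('d::finite) distr \<Rightarrow> (real^'d \<Rightarrow> complex) \<Rightarrow> bool" where
  "has_fourier T F \<longleftrightarrow>
     F \<in> borel_measurable lebesgue \<and>
     (\<forall>f. schwartz f \<longrightarrow>
        integrable lebesgue (\<lambda>\<omega>. F \<omega> * f \<omega>) \<and>
        T (fourier f) = (\<integral>\<omega>. F \<omega> * f \<omega> \<partial>lebesgue))"

definition fhat :: "('d::finite) distr \<Rightarrow> real^'d \<Rightarrow> complex" where
  "fhat T = (SOME F. has_fourier T F)"

definition fhat_vec :: "('d::finite) distr ^ 'r::finite \<Rightarrow> real^'d \<Rightarrow> complex^'r" where
  "fhat_vec \<Phi> \<omega> = (\<chi> i. fhat (\<Phi> $ i) \<omega>)"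

definition sobolev :: "real \<Rightarrow> ('d::finite) distr set" where
  "sobolev s = {T. tempered T \<and>
     (\<exists>F. has_fourier T F \<and>
        (\<forall>K. compact K \<longrightarrow> set_integrable lebesgue K (\<lambda>\<omega>. (norm (F \<omega>))\<^sup>2)) \<and>
        integrable lebesgue (\<lambda>\<omega>. (1 + norm \<omega>) powr (2 * s) * (norm (F \<omega>))\<^sup>2))}"

definition sobolev_norm :: "real \<Rightarrow> ('d::finite) distr \<Rightarrow> real" where
  "sobolev_norm s T =
     sqrt (\<integral>\<omega>. (1 + norm \<omega>) powr (2 * s) * (norm (fhat T \<omega>))\<^sup>2 \<partial>lebesgue)"

definition closed_shift_invariant :: "real \<Rightarrow> ('d::finite) distr set \<Rightarrow> bool" where
  "closed_shift_invariant s S \<longleftrightarrow>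
     S \<subseteq> sobolev s \<and> distr.subspace S \<and>
     (\<forall>T\<in>sobolev s. (\<forall>e>0. \<exists>g\<in>S. sobolev_norm s (T - g) < e) \<longrightarrow> T \<in> S) \<and>
     (\<forall>a. (\<forall>i. a $ i \<in> \<int>) \<longrightarrow> (\<forall>T\<in>S. translate a T \<in> S))"

definition si_space :: "real \<Rightarrow> ('d::finite) distr set \<Rightarrow> 'd distr set" where
  "si_space s A = \<Inter> {S. closed_shift_invariant s S \<and> A \<subseteq> S}"

definition FSI :: "real \<Rightarrow> ('d::finite) distr set \<Rightarrow> bool" where
  "FSI s S \<longleftrightarrow> (\<exists>A. finite A \<and> A \<subseteq> sobolev s \<and> S = si_space s A)"

definition entries :: "'a ^ 'r::finite \<Rightarrow> 'a set" where
  "entries \<Phi> = range (\<lambda>i. \<Phi> $ i)"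

definition provides_approximation_order ::
  "real \<Rightarrow> real \<Rightarrow> ('d::finite) distr set \<Rightarrow> bool" where
  "provides_approximation_order s k S \<longleftrightarrow>
     (\<exists>C. \<forall>f\<in>sobolev k. \<forall>h>0.
        (INF g\<in>dilate h ` S. sobolev_norm s (f - g)) \<le> C * h powr (k - s) * sobolev_norm k f)"

definition dual_lattice :: "(real^'d::finite) set" where
  "dual_lattice = {\<alpha>. \<forall>i. \<exists>n::int. \<alpha> $ i = 2 * pi * of_int n}"

definition periodic :: "(real^'d::finite \<Rightarrow> 'b) \<Rightarrow> bool" where
  "periodic f \<longleftrightarrow> (\<forall>\<omega>. \<forall>\<alpha>\<in>dual_lattice. f (\<omega> + \<alpha>) = f \<omega>)"

definition refinement_mask :: "(real^'d::finite \<Rightarrow> complex^'r^'r::finite) \<Rightarrow> bool" where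
  "refinement_mask P \<longleftrightarrow> P \<in> borel_measurable lebesgue \<and> periodic P"

definition refinement_solutions ::
  "(real^'d::finite \<Rightarrow> complex^'r^'r::finite) \<Rightarrow> ('d distr ^ 'r) set" where
  "refinement_solutions P = {\<Phi>.
     (\<forall>i. tempered (\<Phi> $ i) \<and> compactly_supported (\<Phi> $ i)) \<and>
     (AE \<omega> in lebesgue. fhat_vec \<Phi> (2 *\<^sub>R \<omega>) = P \<omega> *v fhat_vec \<Phi> \<omega>)}"

text \<open>
  The Gramian sums converge almost everywhere if the entries of \<open>\<Phi>\<close> are in \<open>sobolev s\<close>; the set
  \<open>L\<close> is \<^const>\<open>dual_lattice\<close>, with or without the origin.
\<close>

definition gramian_over ::
  "(real^'d::finite) set \<Rightarrow> real \<Rightarrow> 'd distr ^ 'r::finite \<Rightarrow> real^'d \<Rightarrow> complex^'r^'r" where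
  "gramian_over L s \<Phi> \<omega> =
     (\<Sum>\<^sub>\<infinity>\<alpha>\<in>L. \<chi> i j. fhat_vec \<Phi> (\<omega> + \<alpha>) $ i * cnj (fhat_vec \<Phi> (\<omega> + \<alpha>) $ j)
                         * of_real (norm (\<omega> + \<alpha>) powr (2 * s)))"

definition gramian ::
  "real \<Rightarrow> ('d::finite) distr ^ 'r::finite \<Rightarrow> real^'d \<Rightarrow> complex^'r^'r" where
  "gramian = gramian_over dual_lattice"

definition truncated_gramian ::
  "real \<Rightarrow> ('d::finite) distr ^ 'r::finite \<Rightarrow> real^'d \<Rightarrow> complex^'r^'r" where
  "truncated_gramian = gramian_over (dual_lattice - {0})"

definition combined_gramian ::
  "real \<Rightarrow> (('d::finite) distr ^ 'r::finite) set \<Rightarrow> real^'d \<Rightarrow> complex^'r^'r" where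
  "combined_gramian s B \<omega> = (\<Sum>\<Phi>\<in>B. gramian s \<Phi> \<omega>)"

definition truncated_combined_gramian ::
  "real \<Rightarrow> (('d::finite) distr ^ 'r::finite) set \<Rightarrow> real^'d \<Rightarrow> complex^'r^'r" where
  "truncated_combined_gramian s B \<omega> = (\<Sum>\<Phi>\<in>B. truncated_gramian s \<Phi> \<omega>)"

definition is_basis :: "(('d::finite) distr ^ 'r::finite) set \<Rightarrow> ('d distr ^ 'r) set \<Rightarrow> bool" where
  "is_basis B V \<longleftrightarrow> distr_vec.independent B \<and> distr_vec.span B = V"

text \<open>\<open>star_prod v u\<close> is \<open>v\<^sup>*u\<close>. The form \<open>v\<^sup>*Gv\<close> is real for the Hermitian matrices used here.\<close>

definition star_prod :: "complex^'r::finite \<Rightarrow> complex^'r \<Rightarrow> complex" where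
  "star_prod v u = (\<Sum>i\<in>UNIV. cnj (v $ i) * u $ i)"

definition qform :: "complex^'r^'r \<Rightarrow> complex^'r::finite \<Rightarrow> real" where
  "qform G v = Re (star_prod v (G *v v))"

definition ae_near_origin :: "(real^'d::finite \<Rightarrow> bool) \<Rightarrow> bool" where
  "ae_near_origin Q \<longleftrightarrow> (\<exists>\<Omega>. open \<Omega> \<and> 0 \<in> \<Omega> \<and> (AE \<omega> in lebesgue. \<omega> \<in> \<Omega> \<longrightarrow> Q \<omega>))"

text \<open>
  The infimum runs over the vectors for which the quotient is defined. It is taken in
  \<^typ>\<open>ereal\<close>, so that it is \<open>\<infinity>\<close> where the combined Gramian is zero. It is a measurable function of
  \<open>\<omega>\<close> (a countable dense set of vectors suffices), so that membership in \<open>L\<^sub>\<infinity>\<close> is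
  essential boundedness.
\<close>

definition coherent_approximation_order ::
  "real \<Rightarrow> real \<Rightarrow> (('d::finite) distr ^ 'r::finite) set \<Rightarrow> bool" where
  "coherent_approximation_order s k B \<longleftrightarrow>
     (\<exists>C. ae_near_origin (\<lambda>\<omega>.
        ereal (norm \<omega> powr (- (2 * k - 2 * s))) *
        (INF v\<in>{v. qform (combined_gramian s B \<omega>) v \<noteq> 0}.
           ereal (qform (truncated_combined_gramian s B \<omega>) v / qform (combined_gramian s B \<omega>) v))
        \<le> ereal C))"

definition regular_universal_supervector ::
  "real \<Rightarrow> real \<Rightarrow> (('d::finite) distr ^ 'r::finite) set \<Rightarrow> (real^'d \<Rightarrow> complex^'r) \<Rightarrow> bool" where
  "regular_universal_supervector s k B v \<longleftrightarrow>
     (\<exists>\<Omega>. open \<Omega> \<and> 0 \<in> \<Omega> \<and> v \<in> borel_measurable (lebesgue_on \<Omega>)) \<and>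
     (\<exists>c>0. \<exists>C. ae_near_origin (\<lambda>\<omega>.
        c * norm \<omega> powr (2 * s) \<le> qform (combined_gramian s B \<omega>) (v \<omega>) / (norm (v \<omega>))\<^sup>2 \<and>
        qform (combined_gramian s B \<omega>) (v \<omega>) / (norm (v \<omega>))\<^sup>2 \<le> C * norm \<omega> powr (2 * s))) \<and>
     (\<exists>C. ae_near_origin (\<lambda>\<omega>.
        \<bar>qform (truncated_combined_gramian s B \<omega>) (v \<omega>) / (norm (v \<omega>))\<^sup>2\<bar>
          \<le> C * norm \<omega> powr (2 * k)))"

definition bounded_near_origin :: "(real^'d::finite \<Rightarrow> complex^'r::finite) \<Rightarrow> bool" where
  "bounded_near_origin v \<longleftrightarrow> (\<exists>C. ae_near_origin (\<lambda>\<omega>. norm (v \<omega>) \<le> C))"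

definition periodic_extension ::
  "(real^'d::finite \<Rightarrow> complex^'r::finite) \<Rightarrow> (real^'d \<Rightarrow> complex^'r) \<Rightarrow> bool" where
  "periodic_extension v V \<longleftrightarrow>
     V \<in> borel_measurable lebesgue \<and> periodic V \<and> bounded (range V) \<and>
     ae_near_origin (\<lambda>\<omega>. V \<omega> = v \<omega>)"

text \<open>\<open>\<psi>\<close> is a distribution whose Fourier transform is \<open>V\<^sup>*\<close> times that of \<open>\<Phi>\<close>.\<close>

definition supervector_product ::
  "(real^'d::finite \<Rightarrow> complex^'r::finite) \<Rightarrow> 'd distr ^ 'r \<Rightarrow> 'd distr \<Rightarrow> bool" where
  "supervector_product V \<Phi> \<psi> \<longleftrightarrow>
     tempered \<psi> \<and> has_fourier \<psi> (\<lambda>\<omega>. star_prod (V \<omega>) (fhat_vec \<Phi> \<omega>))"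

definition strang_fix :: "real \<Rightarrow> ('d::finite) distr \<Rightarrow> bool" where
  "strang_fix k \<psi> \<longleftrightarrow>
     (\<forall>\<alpha>\<in>dual_lattice - {0}. \<exists>C. ae_near_origin (\<lambda>\<omega>.
        norm (fhat \<psi> (\<omega> + \<alpha>)) \<le> C * norm \<omega> powr k))"

end

theory Submission
  imports Defs
begin

text \<open>
  Everything rests on one sufficient condition for approximation order: a superfunction. Let
  \<open>\<psi>\<close> belong to a shift-invariant space \<open>S\<close>, and suppose that near the origin its Fourier
  transform \<open>\<Psi>\<close> does not vanish and that the sum of \<open>|\<Psi>(\<omega> + \<alpha>)|\<^sup>2 |\<omega> + \<alpha>| powr (2 s)\<close> over the
  nonzero \<open>\<alpha>\<close> of the dual lattice is at most \<open>C |\<omega>| powr (2 k) |\<Psi>(\<omega>)|\<^sup>2\<close>. To approximate \<open>f\<close> at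
  scale \<open>h\<close>, one multiplies \<open>\<Psi>\<close> by the periodic function that makes the product equal to the
  rescaled Fourier transform of \<open>f\<close> in a small ball around the origin, and zero between the
  translates of this ball. The error is the high frequency part of \<open>f\<close> together with the
  copies of \<open>f\<close> in the translated balls, and both have the right size in \<open>h\<close>; see
  \<open>superfunction_error\<close> and \<open>approximation_order_if_superfunction\<close>.

  The approximant lies in \<open>S\<close> because a closed shift-invariant space is stable under periodic
  measurable multipliers on the Fourier side (\<open>multiplier_in_closed_si\<close>). Integer translations
  give the exponentials; linear combinations and bounded limits give all bounded periodic
  functions (\<open>periodic_in_closed\<close>, by Stone-Weierstrass on the torus); truncation gives the
  rest.

  For part (a), the coherence condition says that almost every \<open>\<omega>\<close> near the origin admits a
  vector \<open>v\<close> for which the truncated combined form is small against the full one. A countable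
  dense set of directions makes the choice of \<open>v\<close> measurable (\<open>coherent_supervector\<close>). The
  difference of the two forms is the term at the origin, \<open>|\<omega>| powr (2 s)\<close> times the sum over the
  basis of the \<open>|v\<^sup>*\<Phi>|\<^sup>2\<close>, with \<open>\<Phi>\<close> standing for its Fourier transform, and so this term
  dominates. Averaging the \<open>v\<^sup>*\<Phi>\<close> with the conjugates of their own values as periodic weights
  gives a superfunction for the space generated by the basis.

  For part (b), the Fourier transform of a solution \<open>\<Phi>\<close> is a linear combination of those of the
  basis. By Cauchy-Schwarz its truncated form is at most a multiple of the combined one, hence
  of order \<open>|\<omega>| powr (2 k)\<close> along \<open>v\<close>. The Strang-Fix conditions are the individual terms of this
  bound, and if \<open>v\<^sup>*\<Phi>\<close> is bounded away from zero, then \<open>\<psi>\<close> itself is a superfunction.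

  The distributional side requires Fourier inversion on the Schwartz space. It shows that each
  weighted square-integrable function is the Fourier transform of exactly one tempered
  distribution; conversely, a distribution determines its transform almost everywhere, because
  an integrable function whose Fourier transform vanishes is zero almost everywhere.
\<close>

section \<open>Lebesgue measure under affine maps, and decaying functions\<close>

lemma
  fixes a :: "'a::euclidean_space" and c :: real
  assumes c: "c \<noteq> 0"
  shows measurable_lebesgue_affine: "(\<lambda>x. a + c *\<^sub>R x) \<in> lebesgue \<rightarrow>\<^sub>M lebesgue"
    and lebesgue_eq_density_affine:
      "lebesgue = density (distr lebesgue lebesgue (\<lambda>x. a + c *\<^sub>R x)) (\<lambda>_. ennreal (\<bar>c\<bar> ^ DIM('a)))"
proof -
  have eq: "(\<lambda>x. a + (\<Sum>j\<in>Basis. (c * (x \<bullet> j)) *\<^sub>R j)) = (\<lambda>x. a + c *\<^sub>R x)"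
    unfolding scaleR_scaleR[symmetric] scaleR_sum_right[symmetric] by (simp add: euclidean_representation)
  show "(\<lambda>x. a + c *\<^sub>R x) \<in> lebesgue \<rightarrow>\<^sub>M lebesgue"
    using lebesgue_affine_measurable[of "\<lambda>_. c" a] c unfolding eq by simp
  show "lebesgue = density (distr lebesgue lebesgue (\<lambda>x. a + c *\<^sub>R x)) (\<lambda>_. ennreal (\<bar>c\<bar> ^ DIM('a)))"
    using lebesgue_affine_euclidean[of "\<lambda>_. c" a] c unfolding eq by simp
qed

lemma nn_integral_lebesgue_affine:
  fixes a :: "'a::euclidean_space"
  assumes [measurable]: "f \<in> borel_measurable lebesgue" and c: "c \<noteq> 0"
  shows "(\<integral>\<^sup>+x. f x \<partial>lebesgue) = ennreal (\<bar>c\<bar> ^ DIM('a)) * (\<integral>\<^sup>+x. f (a + c *\<^sub>R x) \<partial>lebesgue)"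
proof -
  note [measurable] = measurable_lebesgue_affine[OF c]
  show ?thesis
    by (subst lebesgue_eq_density_affine[OF c, of a])
      (simp add: nn_integral_density nn_integral_distr nn_integral_cmult)
qed

lemma borel_measurable_lebesgue_affine:
  fixes a :: "'a::euclidean_space"
  assumes "f \<in> borel_measurable lebesgue" and "c \<noteq> 0"
  shows "(\<lambda>x. f (a + c *\<^sub>R x)) \<in> borel_measurable lebesgue"
  using measurable_compose[OF measurable_lebesgue_affine[OF assms(2)] assms(1)] .

lemma integrable_lebesgue_affine:
  fixes a :: "'a::euclidean_space" and f :: "'a \<Rightarrow> 'b::{banach, second_countable_topology}"
  assumes f: "integrable lebesgue f" and c: "c \<noteq> 0"
  shows "integrable lebesgue (\<lambda>x. f (a + c *\<^sub>R x))"
proof -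
  have m: "f \<in> borel_measurable lebesgue" using f by simp
  have "(\<integral>\<^sup>+x. ennreal (norm (f x)) \<partial>lebesgue) < \<infinity>"
    using f unfolding integrable_iff_bounded by simp
  then have "(\<integral>\<^sup>+x. ennreal (norm (f (a + c *\<^sub>R x))) \<partial>lebesgue) < \<infinity>"
    using m c by (subst (asm) nn_integral_lebesgue_affine[where c=c and a=a])
      (auto simp: ennreal_mult_less_top)
  with borel_measurable_lebesgue_affine[OF m c] show ?thesis
    unfolding integrable_iff_bounded by simp
qed

lemma integral_lebesgue_affine:
  fixes a :: "'a::euclidean_space" and f :: "'a \<Rightarrow> 'b::{banach, second_countable_topology}"
  assumes [measurable]: "f \<in> borel_measurable lebesgue" and c: "c \<noteq> 0"
  shows "(\<integral>x. f x \<partial>lebesgue) = (\<bar>c\<bar> ^ DIM('a)) *\<^sub>R (\<integral>x. f (a + c *\<^sub>R x) \<partial>lebesgue)"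
proof -
  note [measurable] = measurable_lebesgue_affine[OF c]
  show ?thesis
    by (subst lebesgue_eq_density_affine[OF c, of a])
      (simp add: integral_density integral_distr)
qed

lemma AE_lebesgue_affine:
  fixes a :: "'a::euclidean_space"
  assumes P: "AE x in lebesgue. P x" and c: "c \<noteq> 0"
  shows "AE x in lebesgue. P (a + c *\<^sub>R x)"
proof -
  note [measurable] = measurable_lebesgue_affine[OF c]
  from P have "AE x in density (distr lebesgue lebesgue (\<lambda>x. a + c *\<^sub>R x)) (\<lambda>_. ennreal (\<bar>c\<bar> ^ DIM('a))). P x"
    by (subst (asm) lebesgue_eq_density_affine[OF c, of a])
  then have "AE x in distr lebesgue lebesgue (\<lambda>x. a + c *\<^sub>R x). P x"
    using c by (subst (asm) AE_density) auto
  then show ?thesis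
    by (rule AE_distrD[rotated]) simp
qed

lemma AE_lebesgue_translate:
  fixes a :: "'a::euclidean_space"
  assumes "AE x in lebesgue. P x"
  shows "AE x in lebesgue. P (x + a)"
  using AE_lebesgue_affine[OF assms, of 1 a] by (simp add: add.commute)

lemma borel_measurable_lebesgue_translate:
  fixes a :: "'a::euclidean_space"
  assumes "f \<in> borel_measurable lebesgue"
  shows "(\<lambda>x. f (x + a)) \<in> borel_measurable lebesgue"
  using borel_measurable_lebesgue_affine[OF assms, of 1 a] by (simp add: add.commute)

lemma borel_measurable_lebesgue_continuous:
  assumes "continuous_on UNIV f"
  shows "f \<in> borel_measurable lebesgue"
  using borel_measurable_continuous_onI[OF assms] by (simp add: measurable_completion)

text \<open>
  Summing over the shells \<open>n \<le> |x| < n + 1\<close>, each contained in a ball of volume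
  proportional to \<open>(n + 1)\<^sup>d\<close>.
\<close>
lemma integrable_inverse_power_norm:
  "integrable lebesgue (\<lambda>x::'a::euclidean_space. inverse ((1 + norm x) ^ (DIM('a) + 2)))"
proof -
  let ?N = "DIM('a) + 2" and ?m = "emeasure lebesgue (ball (0::'a) 1)"
  let ?b = "\<lambda>(n::nat) (x::'a). ennreal (inverse (real (Suc n) ^ ?N)) * indicator (ball 0 (2 * real (Suc n))) x"
  have meas: "(\<lambda>x::'a. inverse ((1 + norm x) ^ ?N)) \<in> borel_measurable lebesgue"
    by (intro borel_measurable_lebesgue_continuous continuous_intros) (auto simp: add_nonneg_eq_0_iff)
  have le: "ennreal (inverse ((1 + norm x) ^ ?N)) \<le> (\<Sum>n. ?b n x)" for x :: 'a
  proof -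
    define n where "n = nat \<lfloor>norm x\<rfloor>"
    have n: "real n \<le> norm x" "norm x < real n + 1"
      unfolding n_def using floor_correct[of "norm x"] norm_ge_zero[of x] by linarith+
    have "inverse ((1 + norm x) ^ ?N) \<le> inverse (real (Suc n) ^ ?N)"
      using n by (intro le_imp_inverse_le power_mono) auto
    then have "ennreal (inverse ((1 + norm x) ^ ?N)) \<le> ?b n x"
      using n by (auto simp: ennreal_leI)
    also have "\<dots> = sum (\<lambda>n. ?b n x) {n}"
      by (simp only: sum.insert finite.emptyI sum.empty add_0_right empty_iff not_False_eq_True)
    also have "\<dots> \<le> (\<Sum>n. ?b n x)"
      by (rule sum_le_suminf[OF summableI]) simp_all
    finally show ?thesis .
  qed
  have ball: "emeasure lebesgue (ball (0::'a) r) = ennreal (r ^ DIM('a)) * ?m" if "r > 0" for r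
  proof -
    have "ball (0::'a) r = (\<lambda>x. r *\<^sub>R x + 0) ` ball 0 1"
    proof (intro equalityI subsetI)
      fix x :: 'a assume "x \<in> ball 0 r"
      then show "x \<in> (\<lambda>x. r *\<^sub>R x + 0) ` ball 0 1"
        using that by (intro image_eqI[of _ _ "(1/r) *\<^sub>R x"]) (auto simp: field_simps)
    qed (use that in \<open>auto simp: mult_less_cancel_left1\<close>)
    then show ?thesis using emeasure_lebesgue_affine[of r 0 "ball (0::'a) 1"] that by simp
  qed
  have tm: "ennreal (inverse (real (Suc n) ^ ?N)) * (ennreal ((2 * real (Suc n)) ^ DIM('a)) * ?m)
      = ennreal (2 ^ DIM('a) * inverse (real (Suc n) ^ 2)) * ?m" for n
  proof -
    define k where "k = real (Suc n)"
    have "k > 0" unfolding k_def by simp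
    then have eq: "inverse (k ^ ?N) * (2 * k) ^ DIM('a) = 2 ^ DIM('a) * inverse (k ^ 2)"
      by (simp add: power_add power_mult_distrib power2_eq_square field_simps)
    have "ennreal (inverse (k ^ ?N)) * ennreal ((2 * k) ^ DIM('a)) = ennreal (inverse (k ^ ?N) * (2 * k) ^ DIM('a))"
      using \<open>k > 0\<close> by (intro ennreal_mult[symmetric]) auto
    then show ?thesis
      unfolding k_def[symmetric] eq by (simp only: mult.assoc[symmetric])
  qed
  have fin: "?m < \<infinity>" using lmeasurable_ball[of "0::'a" 1] by (auto simp: fmeasurable_def)
  have "(\<integral>\<^sup>+x. ennreal (inverse ((1 + norm (x::'a)) ^ ?N)) \<partial>lebesgue) \<le> (\<integral>\<^sup>+x. (\<Sum>n. ?b n x) \<partial>lebesgue)"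
    by (intro nn_integral_mono le)
  also have "\<dots> = (\<Sum>n. \<integral>\<^sup>+x. ?b n x \<partial>lebesgue)"
    by (intro nn_integral_suminf borel_measurable_times_ennreal borel_measurable_const
        borel_measurable_indicator fmeasurableD lmeasurable_ball)
  also have "\<dots> = (\<Sum>n. ennreal (inverse (real (Suc n) ^ ?N)) * emeasure lebesgue (ball (0::'a) (2 * real (Suc n))))"
    by (intro suminf_cong nn_integral_cmult_indicator) auto
  also have "\<dots> = (\<Sum>n. ennreal (2 ^ DIM('a) * inverse (real (Suc n) ^ 2)) * ?m)"
    by (intro suminf_cong) (subst ball, auto simp only: tm, simp)
  also have "\<dots> = (\<Sum>n. ennreal (2 ^ DIM('a) * inverse (real (Suc n) ^ 2))) * ?m"
    by simp
  also have "(\<Sum>n. ennreal (2 ^ DIM('a) * inverse (real (Suc n) ^ 2))) < \<infinity>"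
  proof -
    have "summable (\<lambda>n. 2 ^ DIM('a) * inverse (real (Suc n) ^ 2))"
      using inverse_power_summable[of 2, where 'a=real]
      by (intro summable_mult) (subst summable_Suc_iff, simp)
    then show ?thesis by (subst suminf_ennreal2) auto
  qed
  then have "(\<Sum>n. ennreal (2 ^ DIM('a) * inverse (real (Suc n) ^ 2))) * ?m < \<infinity>"
    using fin by (auto simp: ennreal_mult_less_top)
  finally show ?thesis using meas
    unfolding integrable_iff_bounded by simp
qed

definition rapid :: "('a::real_normed_vector \<Rightarrow> 'b::real_normed_vector) \<Rightarrow> bool" where
  "rapid f \<longleftrightarrow> (\<forall>N. \<exists>C. \<forall>x. (1 + norm x) ^ N * norm (f x) \<le> C)"

lemma rapid_iff_bounded:
  "rapid f \<longleftrightarrow> (\<forall>N. bounded (range (\<lambda>x. (1 + norm x) ^ N *\<^sub>R f x)))"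
  by (force simp: rapid_def bounded_iff)

lemma rapid_add: "rapid f \<Longrightarrow> rapid g \<Longrightarrow> rapid (\<lambda>x. f x + g x)"
  unfolding rapid_def
proof safe
  fix N assume f: "\<forall>N. \<exists>C. \<forall>x. (1 + norm x) ^ N * norm (f x) \<le> C"
    and g: "\<forall>N. \<exists>C. \<forall>x. (1 + norm x) ^ N * norm (g x) \<le> C"
  from f obtain C where C: "\<And>x. (1 + norm x) ^ N * norm (f x) \<le> C" by blast
  from g obtain D where D: "\<And>x. (1 + norm x) ^ N * norm (g x) \<le> D" by blast
  have "(1 + norm x) ^ N * norm (f x + g x) \<le> C + D" for x
  proof -
    have "(1 + norm x) ^ N * norm (f x + g x) \<le> (1 + norm x) ^ N * (norm (f x) + norm (g x))"
      by (intro mult_left_mono norm_triangle_ineq) auto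
    with C[of x] D[of x] show ?thesis by (simp add: distrib_left)
  qed
  then show "\<exists>C. \<forall>x. (1 + norm x) ^ N * norm (f x + g x) \<le> C" by blast
qed

lemma rapid_le:
  assumes f: "rapid f" and le: "\<And>x. norm (g x) \<le> K * (1 + norm x) ^ m * norm (f x)"
  shows "rapid g"
  unfolding rapid_def
proof
  fix N
  obtain C where C: "\<And>x. (1 + norm x) ^ (N + m) * norm (f x) \<le> C" using f unfolding rapid_def by blast
  have "(1 + norm x) ^ N * norm (g x) \<le> \<bar>K\<bar> * C" for x
  proof -
    have "(1 + norm x) ^ N * norm (g x) \<le> (1 + norm x) ^ N * (\<bar>K\<bar> * (1 + norm x) ^ m * norm (f x))"
      by (intro mult_left_mono order_trans[OF le] mult_right_mono) auto
    also have "\<dots> = \<bar>K\<bar> * ((1 + norm x) ^ (N + m) * norm (f x))" by (simp add: power_add)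
    also have "\<dots> \<le> \<bar>K\<bar> * C" by (intro mult_left_mono C) auto
    finally show ?thesis .
  qed
  then show "\<exists>C. \<forall>x. (1 + norm x) ^ N * norm (g x) \<le> C" by blast
qed

lemma rapid_affine:
  assumes f: "rapid f" and c: "c \<noteq> 0"
  shows "rapid (\<lambda>x. f (a + c *\<^sub>R x))"
  unfolding rapid_def
proof
  fix N
  obtain C where C: "\<And>x. (1 + norm x) ^ N * norm (f x) \<le> C" using f unfolding rapid_def by blast
  define K where "K = (1 + norm a / \<bar>c\<bar>) + 1 / \<bar>c\<bar>"
  have le: "1 + norm x \<le> K * (1 + norm (a + c *\<^sub>R x))" for x
  proof -
    have "\<bar>c\<bar> * norm x \<le> norm (a + c *\<^sub>R x) + norm a"
      using norm_triangle_ineq4[of "a + c *\<^sub>R x" a] by simp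
    then have "norm x \<le> norm (a + c *\<^sub>R x) / \<bar>c\<bar> + norm a / \<bar>c\<bar>"
      using c by (simp add: field_simps)
    moreover have "K * (1 + norm (a + c *\<^sub>R x)) = 1 + norm a / \<bar>c\<bar> + 1 / \<bar>c\<bar> + norm (a + c *\<^sub>R x)
        + norm a / \<bar>c\<bar> * norm (a + c *\<^sub>R x) + norm (a + c *\<^sub>R x) / \<bar>c\<bar>"
      unfolding K_def by (simp add: algebra_simps add_divide_distrib)
    moreover have "0 \<le> norm a / \<bar>c\<bar> * norm (a + c *\<^sub>R x)" "0 \<le> 1 / \<bar>c\<bar>" "0 \<le> norm (a + c *\<^sub>R x)" by auto
    ultimately show ?thesis by linarith
  qed
  have "K \<ge> 0" unfolding K_def by auto
  have "(1 + norm x) ^ N * norm (f (a + c *\<^sub>R x)) \<le> K ^ N * C" for x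
  proof -
    have "(1 + norm x) ^ N * norm (f (a + c *\<^sub>R x)) \<le> (K * (1 + norm (a + c *\<^sub>R x))) ^ N * norm (f (a + c *\<^sub>R x))"
      by (intro mult_right_mono power_mono le) auto
    also have "\<dots> = K ^ N * ((1 + norm (a + c *\<^sub>R x)) ^ N * norm (f (a + c *\<^sub>R x)))"
      by (simp add: power_mult_distrib)
    also have "\<dots> \<le> K ^ N * C" using \<open>K \<ge> 0\<close> by (intro mult_left_mono C) auto
    finally show ?thesis .
  qed
  then show "\<exists>C. \<forall>x. (1 + norm x) ^ N * norm (f (a + c *\<^sub>R x)) \<le> C" by blast
qed

lemma norm_le_decay:
  fixes f :: "'a::euclidean_space \<Rightarrow> 'b::real_normed_vector"
  assumes "(1 + norm x) ^ N * norm (f x) \<le> C"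
  shows "norm (f x) \<le> C * inverse ((1 + norm x) ^ N)"
  using assms zero_less_power[of "1 + norm x" N]
  by (simp add: field_simps add_pos_nonneg)

lemma rapid_integrable:
  fixes f :: "'a::euclidean_space \<Rightarrow> 'b::{banach, second_countable_topology}"
  assumes "rapid f" "f \<in> borel_measurable lebesgue"
  shows "integrable lebesgue f"
proof -
  obtain C where C: "\<And>x. (1 + norm x) ^ (DIM('a) + 2) * norm (f x) \<le> C"
    using assms(1) unfolding rapid_def by blast
  have le: "norm (f x) \<le> C * inverse ((1 + norm x) ^ (DIM('a) + 2))" for x
    using C by (rule norm_le_decay)
  show ?thesis
    by (rule Bochner_Integration.integrable_bound[OF
          integrable_mult_right[OF integrable_inverse_power_norm, where c="C"]])
      (use assms(2) le in \<open>auto intro!: AE_I2 order_trans[OF _ abs_ge_self]\<close>)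
qed

section \<open>Closure properties of the Schwartz space\<close>

lemma iterated_partial_append:
  "iterated_partial (is @ js) f = iterated_partial is (iterated_partial js f)"
  by (induction "is") auto

lemma schwartz_iff_rapid:
  "schwartz f \<longleftrightarrow> (\<forall>is. (\<forall>x. iterated_partial is f differentiable (at x)) \<and> rapid (iterated_partial is f))"
  unfolding schwartz_def rapid_iff_bounded ..

lemma schwartz_differentiable: "schwartz f \<Longrightarrow> f differentiable (at x)"
  unfolding schwartz_def by (metis iterated_partial.simps(1))

lemma schwartz_rapid: "schwartz f \<Longrightarrow> rapid f"
  unfolding schwartz_iff_rapid by (metis iterated_partial.simps(1))

lemma schwartz_partial: "schwartz f \<Longrightarrow> schwartz (partial_derivative i f)"
  using iterated_partial_append[of _ "[i]" f] unfolding schwartz_iff_rapid by simp metis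

text \<open>
  All iterated partial derivatives of a member stay in the family. The closure properties of
  the Schwartz space are instances, with the family of all functions of the shape in question.
\<close>
lemma schwartz_coinduct [consumes 1, case_names differentiable rapid partial]:
  assumes "X f"
    and "\<And>f x. X f \<Longrightarrow> f differentiable (at x)"
    and "\<And>f. X f \<Longrightarrow> rapid f"
    and "\<And>f i. X f \<Longrightarrow> X (partial_derivative i f)"
  shows "schwartz f"
proof -
  have "X (iterated_partial is f)" for "is"
    using assms(1,4) by (induction "is") auto
  then show ?thesis using assms(2,3) unfolding schwartz_iff_rapid by blast
qed

lemma partial_derivative_eqI:
  "(f has_derivative f') (at x) \<Longrightarrow> partial_derivative i f x = f' (axis i 1)"
  unfolding partial_derivative_def using frechet_derivative_at by metis

lemma has_derivative_frechet:
  fixes f :: "real^'d::finite \<Rightarrow> complex"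
  assumes "f differentiable (at x)"
  shows "(f has_derivative frechet_derivative f (at x)) (at x)"
  using assms by (simp add: frechet_derivative_works)

lemma schwartz_continuous_on: "schwartz f \<Longrightarrow> continuous_on A f"
  by (meson continuous_at_imp_continuous_on differentiable_imp_continuous_within schwartz_differentiable)

lemma schwartz_measurable: "schwartz f \<Longrightarrow> f \<in> borel_measurable lebesgue"
  by (simp add: borel_measurable_lebesgue_continuous schwartz_continuous_on)

lemma schwartz_integrable: "schwartz f \<Longrightarrow> integrable lebesgue f"
  by (simp add: rapid_integrable schwartz_rapid schwartz_measurable)

lemma schwartz_add:
  fixes f g :: "real^'d::finite \<Rightarrow> complex"
  assumes "schwartz f" "schwartz g" shows "schwartz (\<lambda>x. f x + g x)"
proof -
  define X where "X = (\<lambda>u :: real^'d \<Rightarrow> complex. \<exists>f g. schwartz f \<and> schwartz g \<and> u = (\<lambda>x. f x + g x :: complex))"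
  have "X (\<lambda>x. f x + g x)" unfolding X_def using assms by blast
  then show ?thesis
  proof (induction rule: schwartz_coinduct)
    case (differentiable u x)
    then obtain f g where fg: "schwartz f" "schwartz g" "u = (\<lambda>x. f x + g x)" unfolding X_def by blast
    show ?case unfolding fg(3) by (rule differentiable_add schwartz_differentiable fg)+
  next
    case (rapid u)
    then obtain f g where fg: "schwartz f" "schwartz g" "u = (\<lambda>x. f x + g x)" unfolding X_def by blast
    show ?case unfolding fg(3) by (intro rapid_add schwartz_rapid fg)
  next
    case (partial u i)
    then obtain f g where fg: "schwartz f" "schwartz g" "u = (\<lambda>x. f x + g x)" unfolding X_def by blast
    have "partial_derivative i u = (\<lambda>x. partial_derivative i f x + partial_derivative i g x)"
    proof
      fix x
      show "partial_derivative i u x = partial_derivative i f x + partial_derivative i g x"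
        unfolding partial_derivative_def[of i f] partial_derivative_def[of i g] fg(3)
        by (rule partial_derivative_eqI has_derivative_add
            has_derivative_frechet schwartz_differentiable fg)+
    qed
    with fg show ?case unfolding X_def using schwartz_partial by blast
  qed
qed

lemma schwartz_cmult:
  fixes f :: "real^'d::finite \<Rightarrow> complex"
  assumes "schwartz f" shows "schwartz (\<lambda>x. c * f x)"
proof -
  define X where "X = (\<lambda>u :: real^'d \<Rightarrow> complex. \<exists>f. schwartz f \<and> u = (\<lambda>x. c * f x :: complex))"
  have "X (\<lambda>x. c * f x)" unfolding X_def using assms by blast
  then show ?thesis
  proof (induction rule: schwartz_coinduct)
    case (differentiable u x)
    then obtain f where f: "schwartz f" "u = (\<lambda>x. c * f x)" unfolding X_def by blast
    show ?case unfolding f(2) by (rule differentiable_mult differentiable_const schwartz_differentiable f)+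
  next
    case (rapid u)
    then obtain f where f: "schwartz f" "u = (\<lambda>x. c * f x)" unfolding X_def by blast
    show ?case unfolding f(2)
      by (rule rapid_le[OF schwartz_rapid[OF f(1)], of _ "norm c" 0]) (simp add: norm_mult)
  next
    case (partial u i)
    then obtain f where f: "schwartz f" "u = (\<lambda>x. c * f x)" unfolding X_def by blast
    have "partial_derivative i u = (\<lambda>x. c * partial_derivative i f x)"
    proof
      fix x
      show "partial_derivative i u x = c * partial_derivative i f x"
        unfolding partial_derivative_def[of i f] f(2)
        by (rule partial_derivative_eqI has_derivative_mult_right
            has_derivative_frechet schwartz_differentiable f)+
    qed
    with f show ?case unfolding X_def using schwartz_partial by blast
  qed
qed

lemma schwartz_affine:
  fixes f :: "real^'d::finite \<Rightarrow> complex"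
  assumes "schwartz f" and c: "c \<noteq> 0" shows "schwartz (\<lambda>x. f (a + c *\<^sub>R x))"
proof -
  \<comment> \<open>the scalar \<open>b\<close> absorbs the factors \<open>c\<close> that the chain rule produces\<close>
  define X where "X = (\<lambda>u :: real^'d \<Rightarrow> complex. \<exists>b f. schwartz f \<and> u = (\<lambda>x. b * f (a + c *\<^sub>R x) :: complex))"
  have "X (\<lambda>x. f (a + c *\<^sub>R x))" unfolding X_def using assms by (intro exI[of _ 1] exI[of _ f]) simp
  then show ?thesis
  proof (induction rule: schwartz_coinduct)
    case (differentiable u x)
    then obtain f b where f: "schwartz f" "u = (\<lambda>x. b * f (a + c *\<^sub>R x))" unfolding X_def by blast
    have a: "((\<lambda>x. a + c *\<^sub>R x) has_derivative (\<lambda>h. c *\<^sub>R h)) (at x)"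
      by (auto intro!: derivative_eq_intros)
    show ?case unfolding f(2)
      by (rule differentiableI, rule has_derivative_mult_right, rule has_derivative_compose[OF a],
          rule has_derivative_frechet, rule schwartz_differentiable[OF f(1)])
  next
    case (rapid u)
    then obtain f b where f: "schwartz f" "u = (\<lambda>x. b * f (a + c *\<^sub>R x))" unfolding X_def by blast
    show ?case unfolding f(2)
      using rapid_affine[OF schwartz_rapid[OF schwartz_cmult[OF f(1)]] c] by blast
  next
    case (partial u i)
    then obtain f b where f: "schwartz f" "u = (\<lambda>x. b * f (a + c *\<^sub>R x))" unfolding X_def by blast
    have "partial_derivative i u = (\<lambda>x. (b * c) * partial_derivative i f (a + c *\<^sub>R x))"
    proof
      fix x
      note d = has_derivative_frechet[OF schwartz_differentiable[OF f(1)], of "a + c *\<^sub>R x"]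
      interpret bounded_linear "frechet_derivative f (at (a + c *\<^sub>R x))" by (rule has_derivative_bounded_linear[OF d])
      have a: "((\<lambda>x. a + c *\<^sub>R x) has_derivative (\<lambda>h. c *\<^sub>R h)) (at x)"
        by (auto intro!: derivative_eq_intros)
      have "partial_derivative i u x = b * frechet_derivative f (at (a + c *\<^sub>R x)) (c *\<^sub>R axis i 1)"
        unfolding f(2)
        by (rule partial_derivative_eqI, rule has_derivative_mult_right, rule has_derivative_compose[OF a d])
      then show "partial_derivative i u x = (b * c) * partial_derivative i f (a + c *\<^sub>R x)"
        by (simp only: scaleR partial_derivative_def scaleR_conv_of_real[where 'a=complex] mult.assoc)
    qed
    with f show ?case unfolding X_def using schwartz_partial by blast
  qed
qed

lemma schwartz_translate: "schwartz f \<Longrightarrow> schwartz (\<lambda>x. f (x + a))"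
  using schwartz_affine[of f 1 a] by (simp add: add.commute)

lemma schwartz_scale: "schwartz f \<Longrightarrow> c \<noteq> 0 \<Longrightarrow> schwartz (\<lambda>x. f (c *\<^sub>R x))"
  using schwartz_affine[of f c 0] by simp

abbreviation expi :: "real^'d::finite \<Rightarrow> real^'d \<Rightarrow> complex" where
  "expi a x \<equiv> exp (\<i> * of_real (a \<bullet> x))"

lemma has_derivative_expi:
  "((\<lambda>x. expi a x) has_derivative (\<lambda>h. \<i> * of_real (a \<bullet> h) * expi a x)) (at x)"
proof -
  have "((\<lambda>x. \<i> * complex_of_real (a \<bullet> x)) has_derivative (\<lambda>h. \<i> * of_real (a \<bullet> h))) (at x)"
    by (auto intro!: derivative_eq_intros)
  from has_derivative_compose[OF this DERIV_exp[unfolded has_field_derivative_def]]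
  show ?thesis by (simp add: mult.commute)
qed

lemma partial_derivative_mult_expi:
  fixes f :: "real^'d::finite \<Rightarrow> complex"
  assumes f: "schwartz f"
  shows "partial_derivative i (\<lambda>x. expi a x * f x) x
    = expi a x * (partial_derivative i f x + \<i> * of_real (a $ i) * f x)"
proof -
  have "partial_derivative i (\<lambda>x. expi a x * f x) x = expi a x * frechet_derivative f (at x) (axis i 1)
      + \<i> * of_real (a \<bullet> axis i 1) * expi a x * f x"
    by (rule partial_derivative_eqI has_derivative_mult has_derivative_expi
        has_derivative_frechet schwartz_differentiable f)+
  then show ?thesis
    by (simp add: partial_derivative_def algebra_simps inner_axis)
qed

lemma schwartz_mult_expi:
  fixes f :: "real^'d::finite \<Rightarrow> complex"
  assumes "schwartz f" shows "schwartz (\<lambda>x. expi a x * f x)"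
proof -
  define X where "X = (\<lambda>u :: real^'d \<Rightarrow> complex. \<exists>f. schwartz f \<and> u = (\<lambda>x. expi a x * f x :: complex))"
  have "X (\<lambda>x. expi a x * f x)" unfolding X_def using assms by blast
  then show ?thesis
  proof (induction rule: schwartz_coinduct)
    case (differentiable u x)
    then obtain f where f: "schwartz f" "u = (\<lambda>x. expi a x * f x)" unfolding X_def by blast
    show ?case unfolding f(2)
      by (rule differentiable_mult schwartz_differentiable f
          differentiableI[OF has_derivative_expi])+
  next
    case (rapid u)
    then obtain f where f: "schwartz f" "u = (\<lambda>x. expi a x * f x)" unfolding X_def by blast
    show ?case unfolding f(2)
      by (rule rapid_le[OF schwartz_rapid[OF f(1)], of _ 1 0]) (simp add: norm_mult)
  next
    case (partial u i)
    then obtain f where f: "schwartz f" "u = (\<lambda>x. expi a x * f x)" unfolding X_def by blast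
    have "partial_derivative i u = (\<lambda>x. expi a x * (partial_derivative i f x + \<i> * of_real (a $ i) * f x))"
      unfolding f(2) by (rule ext) (rule partial_derivative_mult_expi[OF f(1)])
    with f show ?case unfolding X_def
      by (intro exI[of _ "\<lambda>x. partial_derivative i f x + \<i> * of_real (a $ i) * f x"] conjI
          schwartz_add schwartz_partial schwartz_cmult) auto
  qed
qed

lemma schwartz_mult_coordinate:
  fixes f :: "real^'d::finite \<Rightarrow> complex"
  assumes "schwartz f" shows "schwartz (\<lambda>x. of_real (x $ j) * f x)"
proof -
  \<comment> \<open>the summand \<open>g\<close> takes up the term that arises when the coordinate is differentiated\<close>
  define X where "X = (\<lambda>u :: real^'d \<Rightarrow> complex. \<exists>f g. schwartz f \<and> schwartz g \<and> u = (\<lambda>x. of_real (x $ j) * f x + g x :: complex))"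
  have "X (\<lambda>x. of_real (x $ j) * f x)" unfolding X_def using assms schwartz_cmult[OF assms, of 0]
    by (intro exI[of _ f] exI[of _ "\<lambda>x. 0"]) simp
  have d: "((\<lambda>x. complex_of_real (x $ j)) has_derivative (\<lambda>h. of_real (h $ j))) (at x)" for x :: "real^'d"
    by (intro has_derivative_of_real bounded_linear_imp_has_derivative bounded_linear_vec_nth)
  from \<open>X (\<lambda>x. of_real (x $ j) * f x)\<close> show ?thesis
  proof (induction rule: schwartz_coinduct)
    case (differentiable u x)
    then obtain f g where f: "schwartz f" "schwartz g" "u = (\<lambda>x. of_real (x $ j) * f x + g x)" unfolding X_def by blast
    show ?case unfolding f(3)
      by (rule differentiable_add differentiable_mult schwartz_differentiable f
          differentiableI[OF d])+
  next
    case (rapid u)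
    then obtain f g where f: "schwartz f" "schwartz g" "u = (\<lambda>x. of_real (x $ j) * f x + g x)" unfolding X_def by blast
    have "rapid (\<lambda>x. of_real (x $ j) * f x)"
    proof (rule rapid_le[OF schwartz_rapid[OF f(1)], of _ 1 1])
      fix x show "norm (of_real (x $ j) * f x) \<le> 1 * (1 + norm x) ^ 1 * norm (f x)"
        unfolding norm_mult using component_le_norm_cart[of x j] by (intro mult_right_mono) auto
    qed
    then show ?case unfolding f(3) using rapid_add schwartz_rapid[OF f(2)] by blast
  next
    case (partial u i)
    then obtain f g where f: "schwartz f" "schwartz g" "u = (\<lambda>x. of_real (x $ j) * f x + g x)" unfolding X_def by blast
    have "partial_derivative i u = (\<lambda>x. of_real (x $ j) * partial_derivative i f x
        + (of_real (axis i 1 $ j) * f x + partial_derivative i g x))"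
    proof
      fix x
      have "partial_derivative i u x = (of_real (x $ j) * frechet_derivative f (at x) (axis i 1)
          + of_real (axis i 1 $ j) * f x) + frechet_derivative g (at x) (axis i 1)"
        unfolding f(3)
        by (rule partial_derivative_eqI has_derivative_mult has_derivative_add d
            has_derivative_frechet schwartz_differentiable f)+
      then show "partial_derivative i u x = of_real (x $ j) * partial_derivative i f x
        + (of_real (axis i 1 $ j) * f x + partial_derivative i g x)"
        by (simp add: partial_derivative_def)
    qed
    with f show ?case unfolding X_def
      by (intro exI[of _ "partial_derivative i f"]
          exI[of _ "\<lambda>x. of_real (axis i 1 $ j) * f x + partial_derivative i g x"] conjI
          schwartz_add schwartz_partial schwartz_cmult) auto
  qed
qed

definition gauss :: "real^'d::finite \<Rightarrow> complex" where
  "gauss x = of_real (exp (- (norm x)\<^sup>2 / 2))"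

lemma has_derivative_gauss:
  "(gauss has_derivative (\<lambda>h. of_real (- (x \<bullet> h)) * gauss x)) (at x)"
proof -
  have "((\<lambda>x. complex_of_real (exp (- (x \<bullet> x) / 2))) has_derivative
      (\<lambda>h. of_real (exp (- (x \<bullet> x) / 2) * (- (x \<bullet> h + h \<bullet> x) / 2)))) (at x)"
    by (auto intro!: derivative_eq_intros simp: algebra_simps)
  then show ?thesis
    unfolding gauss_def[abs_def] power2_norm_eq_inner by (simp add: inner_commute mult.commute)
qed

lemma rapid_gauss: "rapid gauss"
  unfolding rapid_def
proof
  fix N :: nat
  have "(1 + norm x) ^ N * norm (gauss x) \<le> exp (real N * real N / 2)" for x :: "real^'a"
  proof -
    have "(1 + norm x) ^ N \<le> exp (norm x) ^ N" by (intro power_mono exp_ge_add_one_self) auto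
    also have "\<dots> = exp (real N * norm x)" by (simp add: exp_of_nat_mult)
    finally have "(1 + norm x) ^ N * norm (gauss x) \<le> exp (real N * norm x) * exp (- (norm x)\<^sup>2 / 2)"
      unfolding gauss_def norm_of_real abs_exp_cancel by (intro mult_right_mono) auto
    also have "\<dots> = exp (real N * norm x - (norm x)\<^sup>2 / 2)" by (simp add: exp_add[symmetric])
    also have "\<dots> \<le> exp (real N * real N / 2)"
      using zero_le_power2[of "real N - norm x"] unfolding exp_le_cancel_iff
      by (simp add: power2_eq_square algebra_simps)
    finally show ?thesis .
  qed
  then show "\<exists>C. \<forall>x::real^'a. (1 + norm x) ^ N * norm (gauss x) \<le> C" by blast
qed

text \<open>
  The products of polynomials with the Gaussian; all iterated partial derivatives of the
  Gaussian are among them.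
\<close>
inductive poly_gauss :: "(real^'d::finite \<Rightarrow> complex) \<Rightarrow> bool" where
  gauss: "poly_gauss gauss"
| add: "poly_gauss f \<Longrightarrow> poly_gauss g \<Longrightarrow> poly_gauss (\<lambda>x. f x + g x)"
| cmult: "poly_gauss f \<Longrightarrow> poly_gauss (\<lambda>x. c * f x)"
| coord: "poly_gauss f \<Longrightarrow> poly_gauss (\<lambda>x. of_real (x $ j) * f x)"

lemma schwartz_gauss: "schwartz (gauss :: real^'d::finite \<Rightarrow> complex)"
proof -
  have d: "((\<lambda>x. complex_of_real (x $ j)) has_derivative (\<lambda>h. of_real (h $ j))) (at x)" for j and x :: "real^'d"
    by (intro has_derivative_of_real bounded_linear_imp_has_derivative bounded_linear_vec_nth)
  have diff: "f differentiable (at x)" if "poly_gauss f" for f :: "real^'d \<Rightarrow> complex" and x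
    using that
    by induction (auto intro!: differentiable_add differentiable_mult differentiableI[OF d]
      differentiableI[OF has_derivative_gauss])
  have "poly_gauss (gauss :: real^'d \<Rightarrow> complex)" by (rule poly_gauss.gauss)
  then show ?thesis
  proof (induction rule: schwartz_coinduct)
    case (differentiable f x) then show ?case by (rule diff)
  next
    case (rapid f) then show ?case
    proof induction
      case (cmult f c)
      show ?case by (rule rapid_le[OF cmult.IH, of _ "norm c" 0]) (simp add: norm_mult)
    next
      case (coord f j)
      show ?case
      proof (rule rapid_le[OF coord.IH, of _ 1 1])
        fix x show "norm (of_real (x $ j) * f x) \<le> 1 * (1 + norm x) ^ 1 * norm (f x)"
          unfolding norm_mult using component_le_norm_cart[of x j] by (intro mult_right_mono) auto
      qed
    qed (auto intro: rapid_gauss rapid_add)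
  next
    case (partial f i) then show ?case
    proof induction
      case gauss
      have "partial_derivative i gauss = (\<lambda>x::real^'d. (-1) * (of_real (x $ i) * gauss x))"
        by (rule ext, subst partial_derivative_eqI[OF has_derivative_gauss]) (simp add: inner_axis)
      then show ?case
        by (metis poly_gauss.gauss poly_gauss.coord poly_gauss.cmult)
    next
      case (add f g)
      have "partial_derivative i (\<lambda>x. f x + g x) = (\<lambda>x. partial_derivative i f x + partial_derivative i g x)"
      proof
        fix x
        show "partial_derivative i (\<lambda>x. f x + g x) x = partial_derivative i f x + partial_derivative i g x"
          unfolding partial_derivative_def[of i f] partial_derivative_def[of i g]
          by (rule partial_derivative_eqI has_derivative_add
              has_derivative_frechet diff add.hyps)+
      qed
      with add.IH show ?case by (simp add: poly_gauss.add)
    next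
      case (cmult f c)
      have "partial_derivative i (\<lambda>x. c * f x) = (\<lambda>x. c * partial_derivative i f x)"
      proof
        fix x
        show "partial_derivative i (\<lambda>x. c * f x) x = c * partial_derivative i f x"
          unfolding partial_derivative_def[of i f]
          by (rule partial_derivative_eqI has_derivative_mult_right
              has_derivative_frechet diff cmult.hyps)+
      qed
      with cmult.IH show ?case by (simp add: poly_gauss.cmult)
    next
      case (coord f j)
      have "partial_derivative i (\<lambda>x. of_real (x $ j) * f x)
        = (\<lambda>x. of_real (x $ j) * partial_derivative i f x + of_real (axis i 1 $ j) * f x)"
      proof
        fix x
        show "partial_derivative i (\<lambda>x. of_real (x $ j) * f x) x
          = of_real (x $ j) * partial_derivative i f x + of_real (axis i 1 $ j) * f x"
          unfolding partial_derivative_def[of i f]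
          by (rule partial_derivative_eqI has_derivative_mult d
              has_derivative_frechet diff coord.hyps)+
      qed
      with coord show ?case
        using poly_gauss.add[OF poly_gauss.coord[OF coord.IH, of j] poly_gauss.cmult[OF coord.hyps, of "of_real (axis i 1 $ j)"]]
        by simp
    qed
  qed
qed

section \<open>Fourier inversion on the Schwartz space\<close>

text \<open>
  The integral of a difference quotient of \<open>g\<close> is zero by translation invariance, and the
  difference quotients converge to the partial derivative, dominated by its supremum
  over a unit segment.
\<close>
lemma integral_partial_derivative_eq_0:
  fixes g :: "real^'d::finite \<Rightarrow> complex"
  assumes g: "schwartz g"
  shows "(\<integral>x. partial_derivative i g x \<partial>lebesgue) = 0"
proof -
  let ?e = "axis i 1 :: real^'d"
  define N where "N = DIM(real^'d) + 2"
  define t where "t n = inverse (real (Suc n))" for n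
  have t: "0 < t n" "t n \<le> 1" for n unfolding t_def by (auto simp: field_simps)
  define q where "q n x = (g (x + t n *\<^sub>R ?e) - g x) / of_real (t n)" for n x
  obtain C where C: "\<And>x. (1 + norm x) ^ N * norm (partial_derivative i g x) \<le> C"
    using schwartz_rapid[OF schwartz_partial[OF g]] unfolding rapid_def by blast
  have C': "norm (partial_derivative i g x) \<le> C * inverse ((1 + norm x) ^ N)" for x
    using C by (rule norm_le_decay)
  have "C \<ge> 0" using order_trans[OF _ C[of 0]] by simp
  have dline: "((\<lambda>s. g (x + s *\<^sub>R ?e)) has_derivative (\<lambda>h. h *\<^sub>R partial_derivative i g (x + s *\<^sub>R ?e))) (at s)" for x s
  proof -
    note d = has_derivative_frechet[OF schwartz_differentiable[OF g], of "x + s *\<^sub>R ?e"]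
    interpret bounded_linear "frechet_derivative g (at (x + s *\<^sub>R ?e))" by (rule has_derivative_bounded_linear[OF d])
    have a: "((\<lambda>s. x + s *\<^sub>R ?e) has_derivative (\<lambda>h. h *\<^sub>R ?e)) (at s)"
      by (auto intro!: derivative_eq_intros)
    show ?thesis
      using has_derivative_compose[OF a d] by (simp add: scaleR partial_derivative_def)
  qed
  have bound: "norm (q n x) \<le> 2 ^ N * C * inverse ((1 + norm x) ^ N)" for n x
  proof -
    have "norm (g (x + t n *\<^sub>R ?e) - g (x + 0 *\<^sub>R ?e)) \<le> 2 ^ N * C * inverse ((1 + norm x) ^ N) * norm (t n - 0)"
    proof (rule differentiable_bound[where S="{0..1}"])
      fix s :: real assume s: "s \<in> {0..1}"
      show "((\<lambda>s. g (x + s *\<^sub>R ?e)) has_derivative (\<lambda>h. h *\<^sub>R partial_derivative i g (x + s *\<^sub>R ?e))) (at s within {0..1})"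
        using dline by (rule has_derivative_at_withinI)
      have "norm x \<le> norm (x + s *\<^sub>R ?e) + norm (s *\<^sub>R ?e)"
        using norm_triangle_ineq4[of "x + s *\<^sub>R ?e" "s *\<^sub>R ?e"] by simp
      then have "(1 + norm x) ^ N \<le> (2 * (1 + norm (x + s *\<^sub>R ?e))) ^ N"
        using s norm_ge_zero[of "x + s *\<^sub>R ?e"] norm_ge_zero[of x] by (intro power_mono) (auto simp del: norm_ge_zero)
      then have "inverse ((1 + norm (x + s *\<^sub>R ?e)) ^ N) \<le> 2 ^ N * inverse ((1 + norm x) ^ N)"
        by (simp only: power_mult_distrib) (simp add: field_simps add_pos_nonneg)
      with \<open>C \<ge> 0\<close> have p: "norm (partial_derivative i g (x + s *\<^sub>R ?e)) \<le> C * (2 ^ N * inverse ((1 + norm x) ^ N))"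
        by (intro order_trans[OF C'] mult_left_mono)
      then have "norm (h *\<^sub>R partial_derivative i g (x + s *\<^sub>R ?e)) \<le> 2 ^ N * C * inverse ((1 + norm x) ^ N) * norm h" for h
        using mult_right_mono[OF p abs_ge_zero[of h]] by (simp add: mult_ac)
      then show "onorm (\<lambda>h. h *\<^sub>R partial_derivative i g (x + s *\<^sub>R ?e)) \<le> 2 ^ N * C * inverse ((1 + norm x) ^ N)"
        using \<open>C \<ge> 0\<close> by (intro onorm_bound) auto
    qed (use t[of n] in auto)
    then show ?thesis
      using t(1)[of n] unfolding q_def norm_divide norm_of_real by (simp add: field_simps)
  qed
  have lim: "(\<lambda>n. q n x) \<longlonglongrightarrow> partial_derivative i g x" for x
  proof -
    let ?p = "partial_derivative i g x"
    have "((\<lambda>s. norm (g (x + s *\<^sub>R ?e) - g x - s *\<^sub>R ?p) / norm s) \<longlongrightarrow> 0) (at 0)"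
      using dline[of x 0] unfolding has_derivative_at by simp
    moreover have "\<forall>\<^sub>F s in at 0. norm (g (x + s *\<^sub>R ?e) - g x - s *\<^sub>R ?p) / norm s
        = norm ((g (x + s *\<^sub>R ?e) - g x) /\<^sub>R s - ?p)"
    proof (rule eventually_mono[OF eventually_neq_at_within[of 0]])
      fix s :: real assume "s \<noteq> 0"
      then have "(g (x + s *\<^sub>R ?e) - g x) /\<^sub>R s - ?p = (g (x + s *\<^sub>R ?e) - g x - s *\<^sub>R ?p) /\<^sub>R s"
        by (simp add: scaleR_diff_right)
      then show "norm (g (x + s *\<^sub>R ?e) - g x - s *\<^sub>R ?p) / norm s
        = norm ((g (x + s *\<^sub>R ?e) - g x) /\<^sub>R s - ?p)"
        by (simp add: divide_inverse mult.commute)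
    qed
    ultimately have "((\<lambda>s. norm ((g (x + s *\<^sub>R ?e) - g x) /\<^sub>R s - ?p)) \<longlongrightarrow> 0) (at 0)"
      by (rule Lim_transform_eventually)
    then have "((\<lambda>s. (g (x + s *\<^sub>R ?e) - g x) /\<^sub>R s) \<longlongrightarrow> ?p) (at 0)"
      by (rule LIM_zero_cancel[OF tendsto_norm_zero_cancel])
    moreover have "t \<longlonglongrightarrow> 0"
      unfolding t_def[abs_def] by (rule LIMSEQ_inverse_real_of_nat)
    then have "filterlim t (at 0) sequentially"
      unfolding filterlim_at using t(1) by (auto simp: less_imp_neq[symmetric])
    ultimately have "(\<lambda>n. (g (x + t n *\<^sub>R ?e) - g x) /\<^sub>R t n) \<longlonglongrightarrow> partial_derivative i g x"
      by (rule filterlim_compose)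
    then show ?thesis unfolding q_def by (simp add: scaleR_conv_of_real divide_inverse mult.commute)
  qed
  have gi: "integrable lebesgue g" by (rule schwartz_integrable[OF g])
  have gti: "integrable lebesgue (\<lambda>x. g (x + t n *\<^sub>R ?e))" for n
    by (rule schwartz_integrable[OF schwartz_translate[OF g]])
  have "(\<integral>x. q n x \<partial>lebesgue) = 0" for n
  proof -
    have "(\<integral>x. g (x + t n *\<^sub>R ?e) \<partial>lebesgue) = (\<integral>x. g x \<partial>lebesgue)"
      using integral_lebesgue_affine[of g 1 "t n *\<^sub>R ?e"] gi by (simp add: add.commute)
    then show ?thesis unfolding q_def using gi gti by simp
  qed
  moreover have "(\<lambda>n. \<integral>x. q n x \<partial>lebesgue) \<longlonglongrightarrow> (\<integral>x. partial_derivative i g x \<partial>lebesgue)"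
  proof (rule integral_dominated_convergence)
    show "integrable lebesgue (\<lambda>x::real^'d. 2 ^ N * C * inverse ((1 + norm x) ^ N))"
      unfolding N_def by (rule integrable_mult_right[OF integrable_inverse_power_norm])
    show "partial_derivative i g \<in> borel_measurable lebesgue"
      by (rule schwartz_measurable[OF schwartz_partial[OF g]])
    show "q n \<in> borel_measurable lebesgue" for n
      unfolding q_def using gi gti[of n] by (intro borel_measurable_divide borel_measurable_diff) auto
  qed (use lim bound in auto)
  ultimately show ?thesis by (simp add: LIMSEQ_const_iff)
qed

lemma fourier_eq_expi: "fourier f \<omega> = (\<integral>x. expi (- \<omega>) x * f x \<partial>lebesgue)"
  unfolding fourier_def by (simp add: mult.commute)

lemma fourier_add: "schwartz f \<Longrightarrow> schwartz g \<Longrightarrow> fourier (\<lambda>x. f x + g x) \<omega> = fourier f \<omega> + fourier g \<omega>"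
  unfolding fourier_eq_expi
  by (simp add: distrib_left schwartz_integrable schwartz_mult_expi Bochner_Integration.integral_add
      del: inner_minus_left)

lemma fourier_cmult: "fourier (\<lambda>x. c * f x) \<omega> = c * fourier f \<omega>"
  unfolding fourier_eq_expi by (simp add: mult.left_commute)

lemma fourier_partial:
  fixes f :: "real^'d::finite \<Rightarrow> complex"
  assumes f: "schwartz f"
  shows "fourier (partial_derivative i f) \<omega> = \<i> * of_real (\<omega> $ i) * fourier f \<omega>"
proof -
  note i1 = schwartz_integrable[OF schwartz_mult_expi[OF f], of "- \<omega>"]
  note i2 = schwartz_integrable[OF schwartz_mult_expi[OF schwartz_partial[OF f]], of "- \<omega>" i]
  have "0 = (\<integral>x. partial_derivative i (\<lambda>x. expi (- \<omega>) x * f x) x \<partial>lebesgue)"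
    using integral_partial_derivative_eq_0[OF schwartz_mult_expi[OF f], of i "- \<omega>"] by simp
  also have "\<dots> = (\<integral>x. expi (- \<omega>) x * partial_derivative i f x
      + (- \<i> * of_real (\<omega> $ i)) * (expi (- \<omega>) x * f x) \<partial>lebesgue)"
    by (rule arg_cong[where f="integral\<^sup>L lebesgue"], rule ext, subst partial_derivative_mult_expi[OF f])
      (simp add: algebra_simps)
  also have "\<dots> = fourier (partial_derivative i f) \<omega> + (- \<i> * of_real (\<omega> $ i)) * fourier f \<omega>"
    unfolding fourier_eq_expi using i1 i2
    by (subst Bochner_Integration.integral_add) (auto simp del: inner_minus_left)
  finally show ?thesis by (simp add: algebra_simps)
qed

lemma finite_length_le: "finite {is :: 'd::finite list. length is \<le> N}"
  using finite_lists_length_le[of "UNIV :: 'd set" N] by simp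

lemma
  assumes f: "schwartz f"
  shows bdd_above_schwartz_norm: "bdd_above (range (\<lambda>x. (1 + norm x) ^ N * norm (iterated_partial is f x)))"
    and schwartz_norm_sup_nonneg: "0 \<le> (SUP x. (1 + norm x) ^ N * norm (iterated_partial is f x))"
proof -
  obtain C where "\<And>x. (1 + norm x) ^ N * norm (iterated_partial is f x) \<le> C"
    using f unfolding schwartz_iff_rapid rapid_def by blast
  then show bdd: "bdd_above (range (\<lambda>x. (1 + norm x) ^ N * norm (iterated_partial is f x)))"
    by (auto intro!: bdd_aboveI)
  have "0 \<le> (1 + norm (0::real^'a)) ^ N * norm (iterated_partial is f 0)" by simp
  also have "\<dots> \<le> (SUP x. (1 + norm x) ^ N * norm (iterated_partial is f x))"
    by (rule cSUP_upper[OF _ bdd]) simp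
  finally show "0 \<le> (SUP x. (1 + norm x) ^ N * norm (iterated_partial is f x))" .
qed

lemma schwartz_norm_ge:
  assumes f: "schwartz f"
  shows "(1 + norm x) ^ N * norm (f x) \<le> schwartz_norm N f"
proof -
  have "(1 + norm x) ^ N * norm (iterated_partial [] f x) \<le> (SUP x. (1 + norm x) ^ N * norm (iterated_partial [] f x))"
    by (rule cSUP_upper[OF _ bdd_above_schwartz_norm[OF f]]) simp
  also have "\<dots> \<le> schwartz_norm N f"
    unfolding schwartz_norm_def
    by (rule member_le_sum[where f="\<lambda>is. SUP x. (1 + norm x) ^ N * norm (iterated_partial is f x)"])
      (auto intro: schwartz_norm_sup_nonneg[OF f] finite_length_le)
  finally show ?thesis by simp
qed

lemma schwartz_norm_sup_mono:
  assumes f: "schwartz f" and "M \<le> N"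
  shows "(SUP x. (1 + norm x) ^ M * norm (iterated_partial is f x)) \<le> (SUP x. (1 + norm x) ^ N * norm (iterated_partial is f x))"
proof (rule cSUP_mono[OF _ bdd_above_schwartz_norm[OF f]])
  fix x
  have "(1 + norm x) ^ M * norm (iterated_partial is f x) \<le> (1 + norm x) ^ N * norm (iterated_partial is f x)"
    using assms by (intro mult_right_mono power_increasing) auto
  then show "\<exists>y\<in>UNIV. (1 + norm x) ^ M * norm (iterated_partial is f x) \<le> (1 + norm y) ^ N * norm (iterated_partial is f y)"
    by blast
qed simp

lemma schwartz_norm_mono:
  assumes f: "schwartz f" and "M \<le> N"
  shows "schwartz_norm M f \<le> schwartz_norm N f"
proof -
  have "schwartz_norm M f \<le> (\<Sum>is | length is \<le> M. SUP x. (1 + norm x) ^ N * norm (iterated_partial is f x))"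
    unfolding schwartz_norm_def by (intro sum_mono schwartz_norm_sup_mono assms)
  also have "\<dots> \<le> schwartz_norm N f"
    unfolding schwartz_norm_def using assms
    by (intro sum_mono2 finite_length_le) (auto intro: schwartz_norm_sup_nonneg)
  finally show ?thesis .
qed

lemma schwartz_norm_partial:
  assumes f: "schwartz f"
  shows "schwartz_norm N (partial_derivative i f) \<le> schwartz_norm (Suc N) f"
proof -
  have "schwartz_norm N (partial_derivative i f)
      = (\<Sum>is | length is \<le> N. SUP x. (1 + norm x) ^ N * norm (iterated_partial (is @ [i]) f x))"
    unfolding schwartz_norm_def iterated_partial_append by simp
  also have "\<dots> \<le> (\<Sum>is | length is \<le> N. SUP x. (1 + norm x) ^ Suc N * norm (iterated_partial (is @ [i]) f x))"
    by (intro sum_mono schwartz_norm_sup_mono[OF f]) simp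
  also have "\<dots> = (\<Sum>is \<in> (\<lambda>is. is @ [i]) ` {is. length is \<le> N}. SUP x. (1 + norm x) ^ Suc N * norm (iterated_partial is f x))"
    by (subst sum.reindex) (auto simp: inj_on_def)
  also have "\<dots> \<le> schwartz_norm (Suc N) f"
    unfolding schwartz_norm_def
    by (intro sum_mono2 finite_length_le) (auto intro: schwartz_norm_sup_nonneg[OF f] simp del: power_Suc)
  finally show ?thesis .
qed

text \<open>
  Each factor \<open>1 + |\<omega>|\<close> is paid for by one derivative, because
  \<open>|\<omega>\<^sub>j| |fourier f \<omega>|\<close> is the modulus of the Fourier transform of a partial derivative of \<open>f\<close>.
\<close>
lemma fourier_decay:
  "\<exists>C\<ge>0. \<forall>f :: real^'d::finite \<Rightarrow> complex. schwartz f \<longrightarrow>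
     (\<forall>\<omega>. (1 + norm \<omega>) ^ M * norm (fourier f \<omega>) \<le> C * schwartz_norm (DIM(real^'d) + 2 + M) f)"
proof (induction M)
  case 0
  define N where "N = DIM(real^'d) + 2"
  define K where "K = (\<integral>x. inverse ((1 + norm (x :: real^'d)) ^ N) \<partial>lebesgue)"
  have "K \<ge> 0" unfolding K_def by (intro integral_nonneg_AE) auto
  moreover have "norm (fourier f \<omega>) \<le> K * schwartz_norm N f" if f: "schwartz f" for f :: "real^'d \<Rightarrow> complex" and \<omega>
  proof -
    have le: "norm (expi (- \<omega>) x * f x) \<le> schwartz_norm N f * inverse ((1 + norm x) ^ N)" for x
      using norm_le_decay[where f=f and x=x, OF schwartz_norm_ge[OF f]] by (simp add: norm_mult)
    have int: "integrable lebesgue (\<lambda>x::real^'d. inverse ((1 + norm x) ^ N))"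
      unfolding N_def by (rule integrable_inverse_power_norm)
    have "norm (fourier f \<omega>) \<le> (\<integral>x. schwartz_norm N f * inverse ((1 + norm (x :: real^'d)) ^ N) \<partial>lebesgue)"
      unfolding fourier_eq_expi
      by (intro order_trans[OF integral_norm_bound] integral_mono integrable_norm
          schwartz_integrable schwartz_mult_expi f integrable_mult_right int le)
    then show ?thesis unfolding K_def by (simp add: mult.commute)
  qed
  ultimately show ?case unfolding N_def by (intro exI[of _ K]) simp
next
  case (Suc M)
  let ?N = "DIM(real^'d) + 2 + M"
  from Suc obtain C where "C \<ge> 0" and C: "\<And>f :: real^'d \<Rightarrow> complex. \<And>\<omega>. schwartz f \<Longrightarrow>
    (1 + norm \<omega>) ^ M * norm (fourier f \<omega>) \<le> C * schwartz_norm ?N f" by blast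
  have "(1 + norm \<omega>) ^ Suc M * norm (fourier f \<omega>) \<le> (C * (1 + real CARD('d))) * schwartz_norm (Suc ?N) f"
    if f: "schwartz f" for f :: "real^'d \<Rightarrow> complex" and \<omega>
  proof -
    let ?m = "(1 + norm \<omega>) ^ M"
    have "(1 + norm \<omega>) * norm (fourier f \<omega>) \<le> (1 + (\<Sum>i\<in>UNIV. \<bar>\<omega> $ i\<bar>)) * norm (fourier f \<omega>)"
      by (intro mult_right_mono add_left_mono norm_le_l1_cart) auto
    also have "\<dots> = norm (fourier f \<omega>) + (\<Sum>i\<in>UNIV. norm (fourier (partial_derivative i f) \<omega>))"
      by (simp add: fourier_partial[OF f] norm_mult distrib_right sum_distrib_right)
    finally have "?m * ((1 + norm \<omega>) * norm (fourier f \<omega>))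
      \<le> ?m * (norm (fourier f \<omega>) + (\<Sum>i\<in>UNIV. norm (fourier (partial_derivative i f) \<omega>)))"
      by (intro mult_left_mono) auto
    also have "\<dots> = ?m * norm (fourier f \<omega>) + (\<Sum>i\<in>UNIV. ?m * norm (fourier (partial_derivative i f) \<omega>))"
      by (simp add: distrib_left sum_distrib_left)
    also have "\<dots> \<le> C * schwartz_norm ?N f + (\<Sum>i\<in>(UNIV::'d set). C * schwartz_norm ?N (partial_derivative i f))"
      by (intro add_mono sum_mono C f schwartz_partial)
    also have "\<dots> \<le> C * schwartz_norm (Suc ?N) f + (\<Sum>i\<in>(UNIV::'d set). C * schwartz_norm (Suc ?N) f)"
      using \<open>C \<ge> 0\<close> by (intro add_mono sum_mono mult_left_mono schwartz_norm_mono f schwartz_norm_partial) auto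
    finally show ?thesis by (simp add: algebra_simps)
  qed
  with \<open>C \<ge> 0\<close> show ?case by (intro exI[of _ "C * (1 + real CARD('d))"]) auto
qed

text \<open>
  Differentiation under the integral sign; the Taylor remainder of the exponential is at
  most \<open>|h|\<^sup>2 |x|\<^sup>2\<close>, and \<open>|x|\<^sup>2 f\<close> is integrable.
\<close>
lemma fourier_has_derivative:
  fixes f :: "real^'d::finite \<Rightarrow> complex"
  assumes f: "schwartz f"
  shows "(fourier f has_derivative
    (\<lambda>h. \<Sum>j\<in>UNIV. h $ j *\<^sub>R fourier (\<lambda>x. - \<i> * (of_real (x $ j) * f x)) \<omega>)) (at \<omega>)"
proof -
  let ?L = "\<lambda>h. \<Sum>j\<in>UNIV. h $ j *\<^sub>R fourier (\<lambda>x. - \<i> * (of_real (x $ j) * f x)) \<omega>"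
  have r2: "rapid (\<lambda>x. of_real ((norm x)\<^sup>2) * f x)"
    by (rule rapid_le[OF schwartz_rapid[OF f], of _ 1 2])
      (auto simp: norm_mult norm_power intro!: mult_right_mono power_mono)
  have m2: "(\<lambda>x. of_real ((norm x)\<^sup>2) * f x) \<in> borel_measurable lebesgue"
    by (intro borel_measurable_lebesgue_continuous continuous_intros schwartz_continuous_on[OF f])
  have i2: "integrable lebesgue (\<lambda>x. norm (of_real ((norm x)\<^sup>2) * f x))"
    by (intro integrable_norm rapid_integrable r2 m2)
  define K where "K = (\<integral>x. norm (of_real ((norm x)\<^sup>2) * f x) \<partial>lebesgue)"
  have sj: "schwartz (\<lambda>x. - \<i> * (of_real (x $ j) * f x))" for j
    by (intro schwartz_cmult schwartz_mult_coordinate f)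
  have bound: "norm (fourier f (\<omega> + h) - fourier f \<omega> - ?L h) \<le> K * (norm h)\<^sup>2" for h
  proof -
    let ?r = "\<lambda>x. (expi (- (\<omega> + h)) x * f x - expi (- \<omega>) x * f x)
        - (\<Sum>j\<in>UNIV. h $ j *\<^sub>R (expi (- \<omega>) x * (- \<i> * (of_real (x $ j) * f x))))"
    have int: "integrable lebesgue (\<lambda>x. expi a x * f x)"
      "integrable lebesgue (\<lambda>x. expi a x * (- \<i> * (of_real (x $ j) * f x)))" for a j
      using schwartz_integrable[OF schwartz_mult_expi[OF f]] schwartz_integrable[OF schwartz_mult_expi[OF sj]]
      by blast+
    have eq: "fourier f (\<omega> + h) - fourier f \<omega> - ?L h = (\<integral>x. ?r x \<partial>lebesgue)"
      unfolding fourier_eq_expi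
      by (subst Bochner_Integration.integral_diff Bochner_Integration.integral_sum integral_scaleR_right
           Bochner_Integration.integral_diff
         | intro int integrable_scaleR_right Bochner_Integration.integrable_sum Bochner_Integration.integrable_diff refl)+
    have le: "norm (?r x) \<le> (norm h)\<^sup>2 * norm (of_real ((norm x)\<^sup>2) * f x)" for x
    proof -
      let ?z = "\<i> * complex_of_real (- h \<bullet> x)"
      have s: "(\<Sum>j\<in>UNIV. h $ j *\<^sub>R (expi (- \<omega>) x * (- \<i> * (of_real (x $ j) * f x)))) = expi (- \<omega>) x * (?z * f x)"
        by (simp add: inner_vec_def sum_distrib_left sum_distrib_right sum_negf scaleR_conv_of_real mult_ac)
      have "expi (- (\<omega> + h)) x = expi (- \<omega>) x * exp ?z"
        by (simp add: exp_add[symmetric] inner_add_left algebra_simps)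
      then have "?r x = expi (- \<omega>) x * ((exp ?z - (1 + ?z)) * f x)"
        unfolding s by (simp add: algebra_simps)
      then have "norm (?r x) = norm (exp ?z - (1 + ?z)) * norm (f x)"
        by (simp add: norm_mult)
      also have "norm (exp ?z - (1 + ?z)) \<le> (norm ?z)\<^sup>2"
        using Taylor_exp[of ?z 1] by (simp add: power2_eq_square)
      also have "\<dots> \<le> (norm h * norm x)\<^sup>2"
        using Cauchy_Schwarz_ineq2[of h x] by (intro power_mono) (auto simp: norm_mult)
      finally show ?thesis
        by (simp add: norm_mult norm_power power_mult_distrib mult_right_mono mult.assoc[symmetric])
    qed
    have "norm (\<integral>x. ?r x \<partial>lebesgue) \<le> (\<integral>x. (norm h)\<^sup>2 * norm (of_real ((norm x)\<^sup>2) * f x) \<partial>lebesgue)"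
      by (intro order_trans[OF integral_norm_bound] integral_mono integrable_norm le integrable_mult_right[OF i2[simplified norm_mult]]
          i2 int integrable_scaleR_right Bochner_Integration.integrable_sum Bochner_Integration.integrable_diff integrable_mult_right)
    then show ?thesis unfolding eq K_def by (simp add: mult.commute)
  qed
  show ?thesis
  proof (rule has_derivativeI_sandwich[of 1])
    show "bounded_linear ?L"
      by (intro bounded_linear_sum bounded_linear_scaleR_const bounded_linear_vec_nth)
    show "((\<lambda>y. K * norm (y - \<omega>)) \<longlongrightarrow> 0) (at \<omega>)"
      by (auto intro!: tendsto_eq_intros)
    show "norm (fourier f y - fourier f \<omega> - ?L (y - \<omega>)) / norm (y - \<omega>) \<le> K * norm (y - \<omega>)" if "y \<noteq> \<omega>" for y
      using bound[of "y - \<omega>"] that by (simp add: field_simps power2_eq_square)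
  qed simp
qed

text \<open>
  The transforms of Schwartz functions form a family as in the coinduction rule: a partial
  derivative of \<open>fourier f\<close> is the transform of \<open>- \<i> x\<^sub>j f\<close>, again the transform of a
  Schwartz function.
\<close>
lemma schwartz_fourier:
  fixes f :: "real^'d::finite \<Rightarrow> complex"
  assumes "schwartz f"
  shows "schwartz (fourier f)"
proof -
  define X where "X = (\<lambda>u :: real^'d \<Rightarrow> complex. \<exists>f. schwartz f \<and> u = fourier f)"
  have "X (fourier f)" unfolding X_def using assms by blast
  then show ?thesis
  proof (induction rule: schwartz_coinduct)
    case (differentiable u x)
    then show ?case unfolding X_def using fourier_has_derivative by (auto intro: differentiableI)
  next
    case (rapid u)
    then show ?case unfolding X_def rapid_def using fourier_decay by metis
  next
    case (partial u i)
    then obtain f where f: "schwartz f" "u = fourier f" unfolding X_def by blast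
    have "partial_derivative i u = fourier (\<lambda>x. - \<i> * (of_real (x $ i) * f x))"
      unfolding f(2)
      by (rule ext, subst partial_derivative_eqI[OF fourier_has_derivative[OF f(1)]])
        (simp add: axis_def if_distrib[of "\<lambda>x. x *\<^sub>R _"] cong: if_cong)
    then show ?case unfolding X_def
      using f schwartz_cmult[OF schwartz_mult_coordinate[OF f(1)]] by blast
  qed
qed

lemma integral_lebesgue_eq_lborel:
  fixes f :: "'a::euclidean_space \<Rightarrow> 'b::{banach, second_countable_topology}"
  shows "f \<in> borel_measurable borel \<Longrightarrow> (\<integral>x. f x \<partial>lebesgue) = (\<integral>x. f x \<partial>lborel)"
  by (simp add: integral_completion)

lemma fourier_translate:
  fixes f :: "real^'d::finite \<Rightarrow> complex"
  assumes f: "schwartz f"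
  shows "fourier (\<lambda>x. f (x + a)) \<omega> = expi a \<omega> * fourier f \<omega>"
proof -
  have "(\<lambda>x. expi (- \<omega>) (x - a) * f x) \<in> borel_measurable lebesgue"
    by (intro borel_measurable_lebesgue_continuous continuous_intros schwartz_continuous_on[OF f])
  from integral_lebesgue_affine[OF this, of 1 a]
  have "fourier (\<lambda>x. f (x + a)) \<omega> = (\<integral>x. expi (- \<omega>) (x - a) * f x \<partial>lebesgue)"
    unfolding fourier_eq_expi by (simp add: add.commute)
  also have "\<dots> = (\<integral>x. expi a \<omega> * (expi (- \<omega>) x * f x) \<partial>lebesgue)"
    by (intro Bochner_Integration.integral_cong refl, unfold mult.assoc[symmetric] exp_add[symmetric])
      (simp add: inner_diff_right algebra_simps inner_commute)
  finally show ?thesis unfolding fourier_eq_expi by (simp del: inner_minus_left)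
qed

lemma fourier_scale:
  fixes f :: "real^'d::finite \<Rightarrow> complex"
  assumes f: "schwartz f" and c: "c \<noteq> 0"
  shows "fourier (\<lambda>x. f (c *\<^sub>R x)) \<omega> = of_real (inverse (\<bar>c\<bar> ^ CARD('d))) * fourier f (inverse c *\<^sub>R \<omega>)"
proof -
  have "(\<lambda>x. expi (- (inverse c *\<^sub>R \<omega>)) x * f x) \<in> borel_measurable lebesgue"
    by (intro borel_measurable_lebesgue_continuous continuous_intros schwartz_continuous_on[OF f])
  moreover have "(- (inverse c *\<^sub>R \<omega>)) \<bullet> (0 + c *\<^sub>R x) = (- \<omega>) \<bullet> x" for x
    using c by simp
  ultimately have "fourier f (inverse c *\<^sub>R \<omega>) = of_real (\<bar>c\<bar> ^ CARD('d)) * fourier (\<lambda>x. f (c *\<^sub>R x)) \<omega>"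
    unfolding fourier_eq_expi using c by (subst integral_lebesgue_affine[OF _ c, of _ 0])
      (simp_all only: scaleR_conv_of_real[where 'a=complex] add_0_left DIM_cart DIM_real mult_1_right of_real_mult)
  then show ?thesis using c by simp
qed

text \<open>
  The constant is \<open>(2 \<pi>) powr (d / 2)\<close>; its square is the constant of the inversion formula.
\<close>
definition gauss_mass :: "'d::finite itself \<Rightarrow> complex" where
  "gauss_mass _ = (\<integral>x. gauss (x :: real^'d) \<partial>lebesgue)"

lemma gauss_mass_nonzero: "gauss_mass TYPE('d::finite) \<noteq> 0"
proof
  let ?g = "\<lambda>x :: real^'d. exp (- (norm x)\<^sup>2 / 2)"
  have g: "integrable lebesgue ?g"
    using integrable_norm[OF schwartz_integrable[OF schwartz_gauss]] by (simp add: gauss_def)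
  assume "gauss_mass TYPE('d) = 0"
  then have "(\<integral>x. ?g x \<partial>lebesgue) = 0"
    unfolding gauss_mass_def gauss_def by simp
  then have "AE x in lebesgue. ?g x = 0"
    using g by (subst (asm) integral_nonneg_eq_0_iff_AE) auto
  then have "AE x :: real^'d in lebesgue. False"
    by simp
  then have "emeasure lebesgue (UNIV :: (real^'d) set) = 0"
    by (simp add: AE_iff_measurable[OF _ refl])
  then show False by simp
qed

text \<open>
  Since \<open>\<partial>\<^sub>j gauss = - x\<^sub>j gauss\<close>, the transform satisfies the same differential
  equation, and its quotient by the Gaussian has derivative zero.
\<close>
lemma fourier_gauss:
  fixes \<omega> :: "real^'d::finite"
  shows "fourier gauss \<omega> = gauss_mass TYPE('d) * gauss \<omega>"
proof -
  let ?e = "\<lambda>x :: real^'d. complex_of_real (exp ((norm x)\<^sup>2 / 2))"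
  let ?G = "fourier (gauss :: real^'d \<Rightarrow> complex)"
  have pg: "partial_derivative j gauss = (\<lambda>x::real^'d. (-1) * (of_real (x $ j) * gauss x))" for j
    by (rule ext, subst partial_derivative_eqI[OF has_derivative_gauss]) (simp add: inner_axis)
  have "fourier (\<lambda>x. - \<i> * (of_real (x $ j) * gauss x)) \<omega> = - of_real (\<omega> $ j) * ?G \<omega>" for j and \<omega> :: "real^'d"
  proof -
    have "- fourier (\<lambda>x. of_real (x $ j) * gauss x) \<omega> = \<i> * (of_real (\<omega> $ j) * ?G \<omega>)"
      using fourier_partial[OF schwartz_gauss, of j \<omega>] unfolding pg fourier_cmult by (simp add: mult.assoc)
    then have "fourier (\<lambda>x. of_real (x $ j) * gauss x) \<omega> = - (\<i> * (of_real (\<omega> $ j) * ?G \<omega>))"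
      by (metis add.inverse_inverse)
    then show ?thesis unfolding fourier_cmult by simp
  qed
  then have dG: "(?G has_derivative (\<lambda>h. \<Sum>j\<in>UNIV. h $ j *\<^sub>R (- of_real (\<omega> $ j) * ?G \<omega>))) (at \<omega>)" for \<omega>
    using fourier_has_derivative[OF schwartz_gauss, of \<omega>] by simp
  have sum: "(\<Sum>j\<in>UNIV. h $ j *\<^sub>R (- of_real (\<omega> $ j) * ?G \<omega>)) = - of_real (\<omega> \<bullet> h) * ?G \<omega>" for h \<omega>
    by (simp add: inner_vec_def sum_distrib_right sum_distrib_left sum_negf scaleR_conv_of_real mult_ac)
  have de: "(?e has_derivative (\<lambda>h. of_real (\<omega> \<bullet> h) * ?e \<omega>)) (at \<omega>)" for \<omega>
  proof -
    have "((\<lambda>x. complex_of_real (exp ((x \<bullet> x) / 2))) has_derivative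
        (\<lambda>h. of_real (exp ((\<omega> \<bullet> \<omega>) / 2) * ((\<omega> \<bullet> h + h \<bullet> \<omega>) / 2)))) (at \<omega>)"
      by (auto intro!: derivative_eq_intros simp: algebra_simps)
    then show ?thesis unfolding power2_norm_eq_inner by (simp add: inner_commute mult.commute)
  qed
  have "\<exists>c. \<forall>\<omega>\<in>UNIV. ?G \<omega> * ?e \<omega> = c"
  proof (rule has_derivative_zero_constant)
    fix \<omega> :: "real^'d"
    have "((\<lambda>x. ?G x * ?e x) has_derivative
        (\<lambda>h. ?G \<omega> * (of_real (\<omega> \<bullet> h) * ?e \<omega>) + (- of_real (\<omega> \<bullet> h) * ?G \<omega>) * ?e \<omega>)) (at \<omega>)"
      by (rule has_derivative_mult[OF dG[unfolded sum] de])
    then show "((\<lambda>x. ?G x * ?e x) has_derivative (\<lambda>h. 0)) (at \<omega> within UNIV)"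
      by (simp add: algebra_simps)
  qed simp
  then have "?G \<omega> * ?e \<omega> = ?G 0 * ?e 0" by (metis UNIV_I)
  moreover have "?G 0 * ?e 0 = gauss_mass TYPE('d)"
    unfolding fourier_eq_expi gauss_mass_def by simp
  moreover have "?e \<omega> * gauss \<omega> = 1"
    unfolding gauss_def by (simp only: of_real_mult[symmetric] exp_add[symmetric]) simp
  ultimately show ?thesis by (metis mult.assoc mult.right_neutral)
qed

lemma integral_fourier_mult:
  fixes f g :: "real^'d::finite \<Rightarrow> complex"
  assumes f: "schwartz f" and g: "schwartz g"
  shows "(\<integral>\<omega>. fourier f \<omega> * g \<omega> \<partial>lebesgue) = (\<integral>x. f x * fourier g x \<partial>lebesgue)"
proof -
  let ?F = "\<lambda>x \<omega>. expi (- \<omega>) x * (f x * g \<omega>)"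
  have [measurable]: "f \<in> borel_measurable borel" "g \<in> borel_measurable borel"
    "fourier f \<in> borel_measurable borel" "fourier g \<in> borel_measurable borel"
    by (intro borel_measurable_continuous_onI schwartz_continuous_on schwartz_fourier f g)+
  have fi: "integrable lborel f" and gi: "integrable lborel g"
    using schwartz_integrable[OF f] schwartz_integrable[OF g] by (auto simp: integrable_completion)
  have int: "integrable (lborel \<Otimes>\<^sub>M lborel) (\<lambda>(x, \<omega>). ?F x \<omega>)"
  proof (rule lborel_pair.Fubini_integrable)
    show "(\<lambda>(x, \<omega>). ?F x \<omega>) \<in> borel_measurable (lborel \<Otimes>\<^sub>M lborel)"
      by measurable
    show "integrable lborel (\<lambda>x. \<integral>\<omega>. norm (case (x, \<omega>) of (x, \<omega>) \<Rightarrow> ?F x \<omega>) \<partial>lborel)"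
      using fi by (simp add: norm_mult)
    show "AE x in lborel. integrable lborel (\<lambda>\<omega>. case (x, \<omega>) of (x, \<omega>) \<Rightarrow> ?F x \<omega>)"
    proof (rule AE_I2)
      fix x
      show "integrable lborel (\<lambda>\<omega>. case (x, \<omega>) of (x, \<omega>) \<Rightarrow> ?F x \<omega>)"
        by (rule Bochner_Integration.integrable_bound[OF integrable_norm[OF integrable_mult_right[OF gi, of "f x"]]])
          (auto simp: norm_mult)
    qed
  qed
  have L: "fourier f \<omega> = (\<integral>x. expi (- \<omega>) x * f x \<partial>lborel)" for \<omega>
    unfolding fourier_eq_expi by (rule integral_lebesgue_eq_lborel) measurable
  have R: "fourier g x = (\<integral>\<omega>. expi (- x) \<omega> * g \<omega> \<partial>lborel)" for x
    unfolding fourier_eq_expi by (rule integral_lebesgue_eq_lborel) measurable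
  have "(\<integral>\<omega>. fourier f \<omega> * g \<omega> \<partial>lebesgue) = (\<integral>\<omega>. fourier f \<omega> * g \<omega> \<partial>lborel)"
    by (rule integral_lebesgue_eq_lborel) measurable
  also have "\<dots> = (\<integral>\<omega>. (\<integral>x. ?F x \<omega> \<partial>lborel) \<partial>lborel)"
    unfolding L integral_mult_left_zero[symmetric] by (simp add: mult.assoc)
  also have "\<dots> = (\<integral>x. (\<integral>\<omega>. ?F x \<omega> \<partial>lborel) \<partial>lborel)"
    by (rule lborel_pair.Fubini_integral[OF int])
  also have "\<dots> = (\<integral>x. f x * fourier g x \<partial>lborel)"
    unfolding R integral_mult_right_zero[symmetric] by (simp add: mult_ac inner_commute)
  also have "\<dots> = (\<integral>x. f x * fourier g x \<partial>lebesgue)"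
    by (rule integral_lebesgue_eq_lborel[symmetric]) measurable
  finally show ?thesis .
qed

text \<open>
  Damp \<open>fourier f\<close> by the dilated Gaussians \<open>gauss (\<epsilon> \<omega>)\<close>; the multiplication formula
  turns the damped integral into an average of \<open>f\<close> against a Gaussian of width \<open>\<epsilon>\<close>.
\<close>
lemma integral_fourier_schwartz:
  fixes f :: "real^'d::finite \<Rightarrow> complex"
  assumes f: "schwartz f"
  shows "(\<integral>\<omega>. fourier f \<omega> \<partial>lebesgue) = (gauss_mass TYPE('d))\<^sup>2 * f 0"
proof -
  let ?c = "gauss_mass TYPE('d)"
  define e where "e n = inverse (real (Suc n))" for n
  have e0: "e n > 0" for n unfolding e_def by simp
  have elim: "e \<longlonglongrightarrow> 0" unfolding e_def[abs_def] by (rule LIMSEQ_inverse_real_of_nat)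
  have gs: "schwartz (\<lambda>x::real^'d. gauss (c *\<^sub>R x))" if "c > 0" for c
    using that by (intro schwartz_scale schwartz_gauss) auto
  have eq: "(\<integral>\<omega>. fourier f \<omega> * gauss (e n *\<^sub>R \<omega>) \<partial>lebesgue) = ?c * (\<integral>y. f (e n *\<^sub>R y) * gauss y \<partial>lebesgue)" for n
  proof -
    have m: "(\<lambda>x. f x * gauss (inverse (e n) *\<^sub>R x)) \<in> borel_measurable lebesgue"
      using e0[of n] by (intro borel_measurable_times schwartz_measurable f gs) auto
    have "(\<integral>\<omega>. fourier f \<omega> * gauss (e n *\<^sub>R \<omega>) \<partial>lebesgue) = (\<integral>x. f x * fourier (\<lambda>\<omega>. gauss (e n *\<^sub>R \<omega>)) x \<partial>lebesgue)"
      by (rule integral_fourier_mult[OF f gs[OF e0]])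
    also have "\<dots> = (\<integral>x. (of_real (inverse (e n ^ CARD('d))) * ?c) * (f x * gauss (inverse (e n) *\<^sub>R x)) \<partial>lebesgue)"
      using e0[of n] by (simp add: fourier_scale[OF schwartz_gauss] fourier_gauss mult_ac)
    also have "\<dots> = (of_real (inverse (e n ^ CARD('d))) * ?c) * (\<integral>x. f x * gauss (inverse (e n) *\<^sub>R x) \<partial>lebesgue)"
      by simp
    also have "(\<integral>x. f x * gauss (inverse (e n) *\<^sub>R x) \<partial>lebesgue) = of_real (e n ^ CARD('d)) * (\<integral>y. f (e n *\<^sub>R y) * gauss y \<partial>lebesgue)"
      using integral_lebesgue_affine[OF m, of "e n" 0] e0[of n] by (simp add: scaleR_conv_of_real[where 'a=complex])
    finally show ?thesis using e0[of n] by simp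
  qed
  obtain K where K: "\<And>x. norm (f x) \<le> K"
    using schwartz_rapid[OF f] unfolding rapid_def by (metis power_0 mult_1)
  have cg: "continuous_on UNIV (gauss :: real^'d \<Rightarrow> complex)" by (rule schwartz_continuous_on[OF schwartz_gauss])
  have cf: "continuous_on UNIV f" by (rule schwartz_continuous_on[OF f])
  have "(\<lambda>n. \<integral>\<omega>. fourier f \<omega> * gauss (e n *\<^sub>R \<omega>) \<partial>lebesgue) \<longlonglongrightarrow> (\<integral>\<omega>. fourier f \<omega> * 1 \<partial>lebesgue)"
  proof (rule integral_dominated_convergence[where w="\<lambda>\<omega>. norm (fourier f \<omega>)"])
    show "integrable lebesgue (\<lambda>\<omega>. norm (fourier f \<omega>))"
      by (intro integrable_norm schwartz_integrable schwartz_fourier f)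
    show "AE \<omega> in lebesgue. (\<lambda>n. fourier f \<omega> * gauss (e n *\<^sub>R \<omega>)) \<longlonglongrightarrow> fourier f \<omega> * 1"
    proof (rule AE_I2)
      fix \<omega> :: "real^'d"
      have "(\<lambda>n. gauss (e n *\<^sub>R \<omega>)) \<longlonglongrightarrow> gauss (0 *\<^sub>R \<omega>)"
        by (rule continuous_on_tendsto_compose[OF cg tendsto_scaleR[OF elim tendsto_const]]) auto
      then show "(\<lambda>n. fourier f \<omega> * gauss (e n *\<^sub>R \<omega>)) \<longlonglongrightarrow> fourier f \<omega> * 1"
        by (intro tendsto_mult_left) (simp add: gauss_def)
    qed
    show "AE \<omega> in lebesgue. norm (fourier f \<omega> * gauss (e n *\<^sub>R \<omega>)) \<le> norm (fourier f \<omega>)" for n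
      by (auto simp: norm_mult gauss_def mult_left_le)
    show "(\<lambda>\<omega>. fourier f \<omega> * gauss (e n *\<^sub>R \<omega>)) \<in> borel_measurable lebesgue" for n
      by (rule borel_measurable_times[OF schwartz_measurable[OF schwartz_fourier[OF f]] schwartz_measurable[OF gs[OF e0]]])
  qed (simp add: schwartz_measurable schwartz_fourier f)
  moreover have "(\<lambda>n. ?c * (\<integral>y. f (e n *\<^sub>R y) * gauss y \<partial>lebesgue)) \<longlonglongrightarrow> ?c * (\<integral>y. f 0 * gauss (y :: real^'d) \<partial>lebesgue)"
  proof (intro tendsto_mult_left integral_dominated_convergence[where w="\<lambda>y. K * norm (gauss y)"])
    show "integrable lebesgue (\<lambda>y::real^'d. K * norm (gauss y))"
      by (intro integrable_mult_right integrable_norm schwartz_integrable schwartz_gauss)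
    show "AE y in lebesgue. (\<lambda>n. f (e n *\<^sub>R y) * gauss y) \<longlonglongrightarrow> f 0 * gauss y"
    proof (rule AE_I2)
      fix y :: "real^'d"
      have "(\<lambda>n. f (e n *\<^sub>R y)) \<longlonglongrightarrow> f (0 *\<^sub>R y)"
        by (rule continuous_on_tendsto_compose[OF cf tendsto_scaleR[OF elim tendsto_const]]) auto
      then show "(\<lambda>n. f (e n *\<^sub>R y) * gauss y) \<longlonglongrightarrow> f 0 * gauss y"
        by (intro tendsto_mult_right) simp
    qed
    show "AE y in lebesgue. norm (f (e n *\<^sub>R y) * gauss y) \<le> K * norm (gauss y)" for n
      using K by (auto simp: norm_mult intro!: mult_right_mono)
    show "(\<lambda>y. f (e n *\<^sub>R y) * gauss y) \<in> borel_measurable lebesgue" for n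
      by (rule borel_measurable_times[OF schwartz_measurable[OF schwartz_scale[OF f]] schwartz_measurable[OF schwartz_gauss]])
        (use e0[of n] in simp)
    show "(\<lambda>y::real^'d. f 0 * gauss y) \<in> borel_measurable lebesgue"
      by (rule borel_measurable_times[OF borel_measurable_const schwartz_measurable[OF schwartz_gauss]])
  qed
  ultimately have "(\<integral>\<omega>. fourier f \<omega> * 1 \<partial>lebesgue) = ?c * (\<integral>y. f 0 * gauss (y :: real^'d) \<partial>lebesgue)"
    unfolding eq by (rule LIMSEQ_unique)
  then show ?thesis unfolding gauss_mass_def by (simp add: power2_eq_square)
qed

lemma fourier_fourier:
  fixes f :: "real^'d::finite \<Rightarrow> complex"
  assumes f: "schwartz f"
  shows "fourier (fourier f) x = (gauss_mass TYPE('d))\<^sup>2 * f (- x)"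
proof -
  have "fourier (fourier f) x = (\<integral>\<omega>. fourier (\<lambda>y. f (y + (- x))) \<omega> \<partial>lebesgue)"
    unfolding fourier_translate[OF f] fourier_eq_expi[of "fourier f"] ..
  also have "\<dots> = (gauss_mass TYPE('d))\<^sup>2 * f (0 + (- x))"
    by (rule integral_fourier_schwartz[OF schwartz_translate[OF f]])
  finally show ?thesis by simp
qed

definition inverse_fourier :: "(real^'d::finite \<Rightarrow> complex) \<Rightarrow> real^'d \<Rightarrow> complex" where
  "inverse_fourier g x = inverse ((gauss_mass TYPE('d))\<^sup>2) * fourier g (- x)"

lemma schwartz_inverse_fourier: "schwartz g \<Longrightarrow> schwartz (inverse_fourier g)"
  unfolding inverse_fourier_def[abs_def]
  using schwartz_cmult[OF schwartz_scale[OF schwartz_fourier, of g "-1"]] by simp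

lemma inverse_fourier_fourier: "schwartz f \<Longrightarrow> inverse_fourier (fourier f) = f"
  unfolding inverse_fourier_def[abs_def]
  by (rule ext) (simp add: fourier_fourier gauss_mass_nonzero)

lemma fourier_inverse_fourier:
  fixes g :: "real^'d::finite \<Rightarrow> complex"
  assumes g: "schwartz g"
  shows "fourier (inverse_fourier g) = g"
proof
  fix x
  have "fourier (\<lambda>x. fourier g ((-1) *\<^sub>R x)) x = fourier (fourier g) (- x)"
    by (subst fourier_scale[OF schwartz_fourier[OF g]]) auto
  then show "fourier (inverse_fourier g) x = g x"
    unfolding inverse_fourier_def[abs_def] fourier_cmult
    by (simp add: fourier_fourier[OF g] gauss_mass_nonzero)
qed

section \<open>Periodic functions as bounded limits of trigonometric polynomials\<close>

text \<open>
  For \<open>r > 0\<close>, the functions of \<open>\<omega>\<close> with period \<open>2 \<pi> / r\<close> in each coordinate are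
  the functions of this point.
\<close>
definition torus_point :: "real \<Rightarrow> real^'d::finite \<Rightarrow> complex^'d" where
  "torus_point r \<omega> = (\<chi> j. cis (r * \<omega> $ j))"

definition integer_vec :: "real^'d::finite \<Rightarrow> bool" where
  "integer_vec a \<longleftrightarrow> (\<forall>i. a $ i \<in> \<int>)"

inductive trig_poly :: "real \<Rightarrow> (real^'d::finite \<Rightarrow> complex) \<Rightarrow> bool" for r where
  exp: "integer_vec a \<Longrightarrow> trig_poly r (\<lambda>\<omega>. expi a (r *\<^sub>R \<omega>))"
| add: "trig_poly r f \<Longrightarrow> trig_poly r g \<Longrightarrow> trig_poly r (\<lambda>\<omega>. f \<omega> + g \<omega>)"
| cmult: "trig_poly r f \<Longrightarrow> trig_poly r (\<lambda>\<omega>. c * f \<omega>)"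

lemma trig_poly_mult_exp:
  assumes "trig_poly r f" "integer_vec a"
  shows "trig_poly r (\<lambda>\<omega>. expi a (r *\<^sub>R \<omega>) * f \<omega>)"
  using assms
proof induction
  case (exp b)
  have "expi a (r *\<^sub>R \<omega>) * expi b (r *\<^sub>R \<omega>) = expi (a + b) (r *\<^sub>R \<omega>)" for \<omega>
    by (simp add: exp_add[symmetric] inner_add_left algebra_simps)
  then show ?case using exp by (auto simp: integer_vec_def simp del: inner_scaleR_right intro: trig_poly.exp)
next
  case (add f g)
  then show ?case using trig_poly.add by (simp only: distrib_left) blast
next
  case (cmult f c)
  then show ?case using trig_poly.cmult[of r "\<lambda>\<omega>. expi a (r *\<^sub>R \<omega>) * f \<omega>" c] by (simp add: mult.left_commute)
qed

lemma trig_poly_mult: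
  assumes "trig_poly r f" "trig_poly r g"
  shows "trig_poly r (\<lambda>\<omega>. f \<omega> * g \<omega>)"
  using assms
proof induction
  case (exp a)
  then show ?case by (intro trig_poly_mult_exp)
next
  case (add f f')
  then show ?case using trig_poly.add by (simp only: distrib_right) blast
next
  case (cmult f c)
  then show ?case using trig_poly.cmult[of r "\<lambda>\<omega>. f \<omega> * g \<omega>" c] by (simp add: mult.assoc)
qed

lemma trig_poly_const: "trig_poly r (\<lambda>_. c)"
  using trig_poly.cmult[OF trig_poly.exp[of 0 r], of c] by (simp add: integer_vec_def)

lemma trig_poly_sum:
  "finite I \<Longrightarrow> (\<And>i. i \<in> I \<Longrightarrow> trig_poly r (f i)) \<Longrightarrow> trig_poly r (\<lambda>\<omega>. \<Sum>i\<in>I. f i \<omega>)"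
  by (induction I rule: finite_induct) (auto intro: trig_poly_const trig_poly.add)

text \<open>
  A linear functional of the torus point is a combination of the sines and cosines of the
  coordinates, and trigonometric polynomials form an algebra.
\<close>
lemma trig_poly_real_polynomial:
  fixes p :: "complex^'d::finite \<Rightarrow> real"
  assumes "real_polynomial_function p"
  shows "trig_poly r (\<lambda>\<omega>. of_real (p (torus_point r \<omega>)))"
  using assms
proof induction
  case (linear f)
  then interpret bounded_linear f .
  have cs: "trig_poly r (\<lambda>\<omega>. of_real (cos (r * \<omega> $ j)))" "trig_poly r (\<lambda>\<omega>. of_real (sin (r * \<omega> $ j)))" for j :: 'd
  proof -
    have iv: "integer_vec (axis j 1 :: real^'d)" "integer_vec (axis j (-1) :: real^'d)"
      by (auto simp: integer_vec_def axis_def)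
    have e: "trig_poly r (\<lambda>\<omega>. exp (\<i> * of_real (r * \<omega> $ j)))" "trig_poly r (\<lambda>\<omega>. exp (- (\<i> * of_real (r * \<omega> $ j))))"
      using trig_poly.exp[OF iv(1), of r] trig_poly.exp[OF iv(2), of r]
      by (simp_all add: inner_axis' minus_equation_iff)
    from trig_poly.cmult[OF trig_poly.add[OF e], of "1/2"]
    show "trig_poly r (\<lambda>\<omega>. of_real (cos (r * \<omega> $ j)))"
      by (simp add: cos_of_real[symmetric] cos_exp_eq)
    from trig_poly.cmult[OF trig_poly.add[OF e(1) trig_poly.cmult[OF e(2), of "-1"]], of "1/(2 * \<i>)"]
    show "trig_poly r (\<lambda>\<omega>. of_real (sin (r * \<omega> $ j)))"
      by (simp add: sin_of_real[symmetric] sin_exp_eq)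
  qed
  have fz: "f z = (\<Sum>b\<in>Basis. (z \<bullet> b) * f b)" for z
  proof -
    have "f z = f (\<Sum>b\<in>Basis. (z \<bullet> b) *\<^sub>R b)" by (simp add: euclidean_representation)
    then show ?thesis by (simp only: sum scaleR real_scaleR_def)
  qed
  have eq: "complex_of_real (f (torus_point r \<omega>)) = (\<Sum>b\<in>Basis. of_real (f b) * of_real (torus_point r \<omega> \<bullet> b))" for \<omega>
    by (subst fz) (simp add: mult.commute)
  show ?case unfolding eq
  proof (rule trig_poly_sum[OF finite_Basis])
    fix b :: "complex^'d" assume "b \<in> Basis"
    then obtain j u where b: "b = axis j u" "u \<in> Basis" unfolding Basis_vec_def by blast
    then have "u = 1 \<or> u = \<i>" by (simp add: Basis_complex_def)
    then have "trig_poly r (\<lambda>\<omega>. of_real (torus_point r \<omega> \<bullet> b))"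
    proof
      assume "u = 1"
      then have "torus_point r \<omega> \<bullet> b = cos (r * \<omega> $ j)" for \<omega> :: "real^'d"
        unfolding b(1) by (simp add: torus_point_def inner_axis inner_complex_def)
      then show ?thesis using cs(1)[of j] by simp
    next
      assume "u = \<i>"
      then have "torus_point r \<omega> \<bullet> b = sin (r * \<omega> $ j)" for \<omega> :: "real^'d"
        unfolding b(1) by (simp add: torus_point_def inner_axis inner_complex_def)
      then show ?thesis using cs(2)[of j] by simp
    qed
    then show "trig_poly r (\<lambda>\<omega>. of_real (f b) * of_real (torus_point r \<omega> \<bullet> b))"
      by (rule trig_poly.cmult)
  qed
next
  case (const c) then show ?case by (rule trig_poly_const)
next
  case (add f g) then show ?case by (simp add: trig_poly.add)
next
  case (mult f g) then show ?case by (simp add: trig_poly_mult)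
qed

text \<open>
  The closure properties that linearity and dominated convergence give to a set of
  multipliers or of test functions.
\<close>
definition bounded_limit_closed :: "('a \<Rightarrow> complex) set \<Rightarrow> bool" where
  "bounded_limit_closed M \<longleftrightarrow>
     (\<forall>f\<in>M. \<forall>g\<in>M. (\<lambda>x. f x + g x) \<in> M) \<and>
     (\<forall>f\<in>M. \<forall>c. (\<lambda>x. c * f x) \<in> M) \<and>
     (\<forall>f g K. (\<forall>n. f n \<in> M) \<longrightarrow> (\<forall>n x. norm (f n x) \<le> K) \<longrightarrow> (\<forall>x. (\<lambda>n. f n x) \<longlonglongrightarrow> g x) \<longrightarrow> g \<in> M)"

lemma bounded_limit_closedD:
  assumes "bounded_limit_closed M"
  shows "f \<in> M \<Longrightarrow> g \<in> M \<Longrightarrow> (\<lambda>x. f x + g x) \<in> M"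
    and "f \<in> M \<Longrightarrow> (\<lambda>x. c * f x) \<in> M"
    and "(\<And>n. F n \<in> M) \<Longrightarrow> (\<And>n x. norm (F n x) \<le> K) \<Longrightarrow> (\<And>x. (\<lambda>n. F n x) \<longlonglongrightarrow> g x) \<Longrightarrow> g \<in> M"
  using assms unfolding bounded_limit_closed_def by blast+

context
  fixes M :: "(real^'d::finite \<Rightarrow> complex) set" and r :: real
  assumes closed: "bounded_limit_closed M"
    and exp: "\<And>a. integer_vec a \<Longrightarrow> (\<lambda>\<omega>. expi a (r *\<^sub>R \<omega>)) \<in> M"
begin

lemma trig_poly_in_closed: "trig_poly r f \<Longrightarrow> f \<in> M"
  by (induction rule: trig_poly.induct) (auto intro: exp bounded_limit_closedD[OF closed])

text \<open>
  The torus lies in a ball on which Stone-Weierstrass provides polynomials that converge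
  uniformly.
\<close>
lemma continuous_torus_in_closed:
  fixes \<phi> :: "complex^'d \<Rightarrow> real"
  assumes \<phi>: "continuous_on UNIV \<phi>"
  shows "(\<lambda>\<omega>. of_real (\<phi> (torus_point r \<omega>))) \<in> M"
proof -
  let ?S = "cball (0 :: complex^'d) (real CARD('d))"
  have S: "torus_point r \<omega> \<in> ?S" for \<omega>
    using norm_le_componentwise_cart[of "torus_point r \<omega>" "\<chi> j. 1"] 
      sum_bounded_above[of UNIV "\<lambda>j. norm (torus_point r \<omega> $ j)" 1]
      L2_set_le_sum[of UNIV "\<lambda>j. norm (torus_point r \<omega> $ j)"]
    by (simp add: norm_vec_def torus_point_def)
  have "\<exists>p. real_polynomial_function p \<and> (\<forall>z\<in>?S. \<bar>\<phi> z - p z\<bar> < inverse (real (Suc n)))" for n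
    using Stone_Weierstrass_real_polynomial_function[OF compact_cball continuous_on_subset[OF \<phi> subset_UNIV]]
    by (metis inverse_positive_iff_positive of_nat_0_less_iff zero_less_Suc)
  then obtain p where p: "\<And>n. real_polynomial_function (p n)"
    "\<And>n z. z \<in> ?S \<Longrightarrow> \<bar>\<phi> z - p n z\<bar> < inverse (real (Suc n))" by metis
  have "compact (\<phi> ` ?S)" by (intro compact_continuous_image continuous_on_subset[OF \<phi>]) auto
  then obtain K where K: "\<And>z. z \<in> ?S \<Longrightarrow> \<bar>\<phi> z\<bar> \<le> K"
    using compact_imp_bounded bounded_iff by (metis image_eqI real_norm_def)
  show ?thesis
  proof (rule bounded_limit_closedD(3)[OF closed, where F="\<lambda>n \<omega>. of_real (p n (torus_point r \<omega>))" and K="K + 1"])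
    show "(\<lambda>\<omega>. complex_of_real (p n (torus_point r \<omega>))) \<in> M" for n
      by (intro trig_poly_in_closed trig_poly_real_polynomial p)
    show "norm (complex_of_real (p n (torus_point r \<omega>))) \<le> K + 1" for n \<omega>
    proof -
      have "inverse (real (Suc n)) \<le> 1" by (simp add: field_simps)
      then show ?thesis using K[OF S[of \<omega>]] p(2)[OF S[of \<omega>], of n] by simp
    qed
    show "(\<lambda>n. complex_of_real (p n (torus_point r \<omega>))) \<longlonglongrightarrow> of_real (\<phi> (torus_point r \<omega>))" for \<omega>
    proof (rule tendsto_of_real, rule Lim_null_comparison[THEN LIM_zero_cancel])
      show "\<forall>\<^sub>F n in sequentially. norm (p n (torus_point r \<omega>) - \<phi> (torus_point r \<omega>)) \<le> inverse (real (Suc n))"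
        using p(2)[OF S[of \<omega>]] by (intro always_eventually allI) (simp add: abs_minus_commute less_imp_le)
      show "(\<lambda>n. inverse (real (Suc n))) \<longlonglongrightarrow> 0" by (rule LIMSEQ_inverse_real_of_nat)
    qed
  qed
qed

text \<open>
  The indicator of an open set is a limit of multiples of the distance to its complement, cut
  off at 1; the other Borel sets follow from the \<open>\<pi>\<close>-\<open>\<lambda>\<close> theorem.
\<close>
lemma indicator_torus_in_closed:
  fixes A :: "(complex^'d) set"
  assumes "A \<in> sets borel"
  shows "(\<lambda>\<omega>. of_real (indicator A (torus_point r \<omega>))) \<in> M"
proof -
  let ?P = "\<lambda>A. (\<lambda>\<omega>. complex_of_real (indicator A (torus_point r \<omega>))) \<in> M"
  have one: "(\<lambda>\<omega>. 1) \<in> M" using trig_poly_in_closed[OF trig_poly_const] .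
  have "Int_stable {S :: (complex^'d) set. open S}" "{S :: (complex^'d) set. open S} \<subseteq> Pow UNIV"
    "A \<in> sigma_sets UNIV {S. open S}"
    using assms by (auto simp: Int_stable_def sets_borel)
  then show "?P A"
  proof (induction rule: sigma_sets_induct_disjoint)
    case (basic U)
    then have U: "open U" by simp
    show ?case
    proof (cases "- U = {}")
      case True
      then have "U = UNIV" by blast
      then show ?thesis using one by simp
    next
      case False
      let ?f = "\<lambda>n z. min 1 (real n * infdist z (- U))"
      show ?thesis
      proof (rule bounded_limit_closedD(3)[OF closed, where F="\<lambda>n \<omega>. of_real (?f n (torus_point r \<omega>))" and K=1])
        show "(\<lambda>\<omega>. complex_of_real (?f n (torus_point r \<omega>))) \<in> M" for n
          by (intro continuous_torus_in_closed continuous_intros)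
        show "norm (complex_of_real (?f n (torus_point r \<omega>))) \<le> 1" for n \<omega>
          by (auto simp: min_def infdist_nonneg)
        show "(\<lambda>n. complex_of_real (?f n (torus_point r \<omega>))) \<longlonglongrightarrow> of_real (indicator U (torus_point r \<omega>))" for \<omega>
        proof (rule tendsto_of_real, cases "torus_point r \<omega> \<in> U")
          case True
          with False U have pos: "infdist (torus_point r \<omega>) (- U) > 0"
            by (intro infdist_pos_not_in_closed) auto
          then obtain N where N: "1 < real N * infdist (torus_point r \<omega>) (- U)"
            using ex_less_of_nat_mult by blast
          have "\<forall>\<^sub>F n in sequentially. ?f n (torus_point r \<omega>) = 1"
          proof (rule eventually_sequentiallyI[of N])
            fix n assume "N \<le> n"
            with pos have "real N * infdist (torus_point r \<omega>) (- U) \<le> real n * infdist (torus_point r \<omega>) (- U)"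
              by (intro mult_right_mono) auto
            with N show "?f n (torus_point r \<omega>) = 1" by simp
          qed
          with True show "(\<lambda>n. ?f n (torus_point r \<omega>)) \<longlonglongrightarrow> indicator U (torus_point r \<omega>)"
            by (simp add: tendsto_eventually)
        qed auto
      qed
    qed
  next
    case empty
    show ?case using bounded_limit_closedD(2)[OF closed one, of 0] by simp
  next
    case (compl A)
    have "(\<lambda>\<omega>. 1 + (-1) * complex_of_real (indicator A (torus_point r \<omega>))) \<in> M"
      using bounded_limit_closedD(1)[OF closed one bounded_limit_closedD(2)[OF closed compl(2), of "-1"]] .
    moreover have "1 + (-1) * complex_of_real (indicator A z) = of_real (indicator (UNIV - A) z)" for z
      by (auto simp: indicator_def)
    ultimately show ?case by simp
  next
    case (union A)
    let ?f = "\<lambda>n \<omega>. complex_of_real (indicator (\<Union>i<n. A i) (torus_point r \<omega>))"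
    have "?f n \<in> M" for n
    proof (induction n)
      case 0
      show ?case using bounded_limit_closedD(2)[OF closed one, of 0] by simp
    next
      case (Suc n)
      have "A i \<inter> A n = {}" if "i < n" for i
        using union(1) that unfolding disjoint_family_on_def by simp
      then have "(\<Union>i<n. A i) \<inter> A n = {}" by blast
      then have "?f (Suc n) \<omega> = ?f n \<omega> + of_real (indicator (A n) (torus_point r \<omega>))" for \<omega>
        by (auto simp: indicator_def lessThan_Suc)
      then show ?case using bounded_limit_closedD(1)[OF closed Suc union(3)[of n]] by presburger
    qed
    then show ?case
    proof (rule bounded_limit_closedD(3)[OF closed, where K=1])
      show "norm (?f n \<omega>) \<le> 1" for n \<omega> by (simp add: indicator_def)
      show "(\<lambda>n. ?f n \<omega>) \<longlonglongrightarrow> complex_of_real (indicator (\<Union>i. A i) (torus_point r \<omega>))" for \<omega>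
        by (intro tendsto_of_real LIMSEQ_indicator_UN)
    qed
  qed
qed

lemma nonneg_borel_torus_in_closed:
  fixes \<phi> :: "complex^'d \<Rightarrow> real"
  assumes "\<phi> \<in> borel_measurable borel" "\<And>z. 0 \<le> \<phi> z" "\<And>z. \<phi> z \<le> K"
  shows "(\<lambda>\<omega>. of_real (\<phi> (torus_point r \<omega>))) \<in> M"
proof -
  have "\<forall>K. (\<forall>z. \<phi> z \<le> K) \<longrightarrow> (\<lambda>\<omega>. complex_of_real (\<phi> (torus_point r \<omega>))) \<in> M"
    using assms(1,2)
  proof (induction rule: borel_measurable_induct_real)
    case (set A) then show ?case using indicator_torus_in_closed by blast
  next
    case (mult u c)
    show ?case
    proof (intro allI impI)
      fix K assume K: "\<forall>z. c * u z \<le> K"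
      show "(\<lambda>\<omega>. complex_of_real (c * u (torus_point r \<omega>))) \<in> M"
      proof (cases "c = 0")
        case True
        then show ?thesis using trig_poly_in_closed[OF trig_poly_const[of r 0]] by simp
      next
        case False
        with mult(1) K have "\<forall>z. u z \<le> K / c" by (simp add: field_simps)
        with mult(4) have "(\<lambda>\<omega>. complex_of_real (u (torus_point r \<omega>))) \<in> M" by blast
        from bounded_limit_closedD(2)[OF closed this, of "of_real c"] show ?thesis by simp
      qed
    qed
  next
    case (add u v)
    show ?case
    proof (intro allI impI)
      fix K assume K: "\<forall>z. v z + u z \<le> K"
      have "u z \<le> K" "v z \<le> K" for z using K[rule_format, of z] add(2)[of z] add(4)[of z] by linarith+
      with add have "(\<lambda>\<omega>. complex_of_real (u (torus_point r \<omega>))) \<in> M"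
        "(\<lambda>\<omega>. complex_of_real (v (torus_point r \<omega>))) \<in> M" by blast+
      from bounded_limit_closedD(1)[OF closed this(2,1)]
      show "(\<lambda>\<omega>. complex_of_real (v (torus_point r \<omega>) + u (torus_point r \<omega>))) \<in> M" by simp
    qed
  next
    case (seq U)
    show ?case
    proof (intro allI impI)
      fix K assume K: "\<forall>z. \<phi> z \<le> K"
      have lim: "(\<lambda>i. U i z) \<longlonglongrightarrow> \<phi> z" for z using seq(4) by simp
      have le: "U i z \<le> K" for i z
        using incseq_le[of "\<lambda>i. U i z", OF _ lim] seq(3) K order_trans by (fastforce simp: incseq_def le_fun_def)
      show "(\<lambda>\<omega>. complex_of_real (\<phi> (torus_point r \<omega>))) \<in> M"
      proof (rule bounded_limit_closedD(3)[OF closed, where F="\<lambda>i \<omega>. complex_of_real (U i (torus_point r \<omega>))"])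
        show "(\<lambda>\<omega>. complex_of_real (U i (torus_point r \<omega>))) \<in> M" for i using seq(5) le by blast
        show "norm (complex_of_real (U i (torus_point r \<omega>))) \<le> K" for i \<omega> using seq(2) le by simp
        show "(\<lambda>i. complex_of_real (U i (torus_point r \<omega>))) \<longlonglongrightarrow> complex_of_real (\<phi> (torus_point r \<omega>))" for \<omega>
          by (intro tendsto_of_real lim)
      qed
    qed
  qed
  with assms(3) show ?thesis by blast
qed

lemma borel_torus_in_closed:
  fixes \<phi> :: "complex^'d \<Rightarrow> complex"
  assumes [measurable]: "\<phi> \<in> borel_measurable borel" and K: "\<And>z. norm (\<phi> z) \<le> K"
  shows "(\<lambda>\<omega>. \<phi> (torus_point r \<omega>)) \<in> M"
proof -
  have R: "\<bar>Re (\<phi> z)\<bar> \<le> K" "\<bar>Im (\<phi> z)\<bar> \<le> K" for z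
    using K[of z] abs_Re_le_cmod[of "\<phi> z"] abs_Im_le_cmod[of "\<phi> z"] by linarith+
  have *: "(\<lambda>\<omega>. complex_of_real (f (\<phi> (torus_point r \<omega>)))) \<in> M"
    if [measurable]: "f \<in> borel_measurable borel" and f: "\<And>z. \<bar>f (\<phi> z)\<bar> \<le> K" for f :: "complex \<Rightarrow> real"
  proof -
    have "(\<lambda>\<omega>. complex_of_real (max 0 (f (\<phi> (torus_point r \<omega>)))) + (-1) * complex_of_real (max 0 (- f (\<phi> (torus_point r \<omega>))))) \<in> M"
    proof (intro bounded_limit_closedD(1)[OF closed] bounded_limit_closedD(2)[OF closed])
      have "K \<ge> 0" using f[of undefined] by linarith
      then show "(\<lambda>\<omega>. complex_of_real (max 0 (f (\<phi> (torus_point r \<omega>))))) \<in> M"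
        using f by (intro nonneg_borel_torus_in_closed[of "\<lambda>z. max 0 (f (\<phi> z))" K]) (auto simp: abs_le_iff)
      show "(\<lambda>\<omega>. complex_of_real (max 0 (- f (\<phi> (torus_point r \<omega>))))) \<in> M"
        using f \<open>K \<ge> 0\<close> by (intro nonneg_borel_torus_in_closed[of "\<lambda>z. max 0 (- f (\<phi> z))" K]) (auto simp: abs_le_iff)
    qed
    moreover have "complex_of_real (max 0 t) + (-1) * complex_of_real (max 0 (- t)) = of_real t" for t :: real
      by (auto simp: max_def)
    ultimately show ?thesis by simp
  qed
  have "(\<lambda>\<omega>. complex_of_real (Re (\<phi> (torus_point r \<omega>))) + \<i> * complex_of_real (Im (\<phi> (torus_point r \<omega>)))) \<in> M"
    by (intro bounded_limit_closedD(1)[OF closed] bounded_limit_closedD(2)[OF closed] * R) measurable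
  then show ?thesis by (simp add: complex_eq[symmetric])
qed

end

lemma borel_measurable_Arg [measurable]: "Arg \<in> borel_measurable borel"
proof -
  have "Arg = (\<lambda>z. if z \<in> \<real>\<^sub>\<le>\<^sub>0 then (if z = 0 then Arg 0 else pi) else Arg z)"
  proof
    fix z :: complex
    show "Arg z = (if z \<in> \<real>\<^sub>\<le>\<^sub>0 then (if z = 0 then Arg 0 else pi) else Arg z)"
    proof (cases "z = 0")
      case False
      then have "Arg z = pi" if "z \<in> \<real>\<^sub>\<le>\<^sub>0"
        using that by (auto simp: Arg_eq_pi complex_nonpos_Reals_iff complex_eq_iff)
      then show ?thesis using False by simp
    qed simp
  qed
  also have "\<dots> \<in> borel_measurable borel"
  proof (subst measurable_If_restrict_space_iff, safe)
    have "closed (\<real>\<^sub>\<le>\<^sub>0 :: complex set)" by simp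
    then show "{x \<in> space borel. x \<in> (\<real>\<^sub>\<le>\<^sub>0 :: complex set)} \<in> sets borel" by simp
    show "(\<lambda>z::complex. if z = 0 then Arg 0 else pi) \<in> borel_measurable (restrict_space borel {x. x \<in> \<real>\<^sub>\<le>\<^sub>0})"
      by (intro measurable_restrict_space1) measurable
    show "Arg \<in> borel_measurable (restrict_space borel {x. x \<notin> \<real>\<^sub>\<le>\<^sub>0})"
      using continuous_on_Arg by (intro borel_measurable_continuous_on_restrict) (simp add: Compl_eq)
  qed
  finally show ?thesis .
qed

definition arg_vec :: "complex^'d::finite \<Rightarrow> real^'d" where
  "arg_vec z = (\<chi> j. Arg (z $ j))"

lemma borel_measurable_vec_lambda:
  fixes f :: "'a \<Rightarrow> 'n::finite \<Rightarrow> 'b::euclidean_space"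
  assumes "\<And>i. (\<lambda>x. f x i) \<in> borel_measurable M"
  shows "(\<lambda>x. \<chi> i. f x i) \<in> borel_measurable M"
proof (subst borel_measurable_euclidean_space, safe)
  fix b :: "'b^'n" assume "b \<in> Basis"
  then obtain j u where "b = axis j u" unfolding Basis_vec_def by blast
  then show "(\<lambda>x. (\<chi> i. f x i) \<bullet> b) \<in> borel_measurable M"
    using assms[of j] by (simp add: inner_axis)
qed

lemma borel_measurable_arg_vec [measurable]: "arg_vec \<in> borel_measurable borel"
  unfolding arg_vec_def[abs_def]
  by (intro borel_measurable_vec_lambda measurable_compose[OF _ borel_measurable_Arg]
      borel_measurable_continuous_onI continuous_intros)

lemma arg_vec_torus_point:
  assumes "\<And>j. \<bar>r * \<omega> $ j\<bar> < pi"
  shows "arg_vec (torus_point r \<omega>) = r *\<^sub>R \<omega>"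
  using assms by (simp add: vec_eq_iff arg_vec_def torus_point_def Arg_cis abs_less_iff) 
    (metis Arg_cis abs_less_iff greaterThanAtMost_iff less_imp_le minus_less_iff)

text \<open>
  The arguments of the torus point recover \<open>\<omega>\<close> up to the dual lattice, which turns a
  periodic function of \<open>\<omega>\<close> into a function on the torus.
\<close>
lemma arg_vec_torus_point_mod_lattice:
  "\<exists>\<alpha>\<in>dual_lattice. arg_vec (torus_point 1 \<omega>) = \<omega> + \<alpha>"
proof
  define \<alpha> where "\<alpha> = arg_vec (torus_point 1 \<omega>) - \<omega>"
  have "\<exists>n::int. \<alpha> $ j = 2 * pi * of_int n" for j
  proof -
    have "cis (Arg (cis (\<omega> $ j))) = cis (\<omega> $ j)" by (simp add: cis_Arg)
    then have "exp (\<i> * of_real (Arg (cis (\<omega> $ j)))) = exp (\<i> * of_real (\<omega> $ j))" by (simp add: cis_conv_exp)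
    then obtain n where "\<i> * of_real (Arg (cis (\<omega> $ j))) = \<i> * of_real (\<omega> $ j) + of_int (2 * n) * of_real pi * \<i>"
      unfolding exp_eq by (auto simp: mult_ac)
    then have "Arg (cis (\<omega> $ j)) = \<omega> $ j + 2 * of_int n * pi"
      by (auto simp: complex_eq_iff)
    then show ?thesis unfolding \<alpha>_def arg_vec_def torus_point_def
      by (intro exI[of _ n]) simp
  qed
  then show "\<alpha> \<in> dual_lattice" unfolding dual_lattice_def by blast
  show "arg_vec (torus_point 1 \<omega>) = \<omega> + \<alpha>" unfolding \<alpha>_def by simp
qed

lemma countable_dual_lattice: "countable (dual_lattice :: (real^'d::finite) set)"
proof -
  have "(dual_lattice :: (real^'d) set) \<subseteq> range (\<lambda>n :: int^'d. \<chi> i. 2 * pi * of_int (n $ i))"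
  proof
    fix \<alpha> :: "real^'d" assume "\<alpha> \<in> dual_lattice"
    then obtain n where "\<And>i. \<alpha> $ i = 2 * pi * of_int (n i)" unfolding dual_lattice_def by (auto, metis)
    then have "\<alpha> = (\<chi> i. 2 * pi * of_int ((\<chi> i. n i) $ i))" by (simp add: vec_eq_iff)
    then show "\<alpha> \<in> range (\<lambda>n :: int^'d. \<chi> i. 2 * pi * of_int (n $ i))" by blast
  qed
  then show ?thesis by (rule countable_subset) simp
qed

lemma borel_version:
  fixes f :: "'a::euclidean_space \<Rightarrow> complex"
  assumes "f \<in> borel_measurable lebesgue"
  obtains g where "g \<in> borel_measurable borel" "AE x in lebesgue. f x = g x"
proof -
  have "(\<lambda>x. Re (f x)) \<in> borel_measurable lebesgue" "(\<lambda>x. Im (f x)) \<in> borel_measurable lebesgue"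
    using assms by (auto intro: measurable_compose)
  from this[THEN completion_ex_borel_measurable_real] obtain u v where
    [measurable]: "u \<in> borel_measurable lborel" "v \<in> borel_measurable lborel"
    and ae: "AE x in lborel. Re (f x) = u x" "AE x in lborel. Im (f x) = v x" by blast
  have "AE x in lebesgue. f x = Complex (u x) (v x)"
    using ae[THEN AE_completion] by eventually_elim (simp add: complex_eq_iff)
  moreover have "(\<lambda>x. Complex (u x) (v x)) = (\<lambda>x. of_real (u x) + \<i> * of_real (v x))"
    by (simp add: fun_eq_iff complex_eq_iff)
  moreover have "(\<lambda>x. of_real (u x) + \<i> * of_real (v x)) \<in> borel_measurable borel" by measurable
  ultimately show ?thesis using that by metis
qed

text \<open>
  A bounded periodic measurable function is obtained, up to a null set, from the exponentials
  with integer frequencies by linear combinations and bounded pointwise limits.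
\<close>
lemma periodic_in_closed:
  fixes M :: "(real^'d::finite \<Rightarrow> complex) set"
  assumes closed: "bounded_limit_closed M"
    and exp: "\<And>a. integer_vec a \<Longrightarrow> expi a \<in> M"
    and m: "m \<in> borel_measurable lebesgue" and per: "periodic m" and K: "\<And>\<omega>. norm (m \<omega>) \<le> K"
  shows "\<exists>g\<in>M. AE \<omega> in lebesgue. m \<omega> = g \<omega>"
proof -
  obtain g where [measurable]: "g \<in> borel_measurable borel" and g: "AE x in lebesgue. m x = g x"
    using borel_version[OF m] .
  \<comment> \<open>a Borel version of a bounded function need not be bounded on the exceptional null set\<close>
  define \<phi> where "\<phi> z = (if norm (g (arg_vec z)) \<le> K then g (arg_vec z) else 0)" for z
  have "K \<ge> 0" using order_trans[OF norm_ge_zero K] .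
  have "(\<lambda>\<omega>. \<phi> (torus_point 1 \<omega>)) \<in> M"
  proof (rule borel_torus_in_closed[OF closed])
    show "(\<lambda>\<omega>. expi a (1 *\<^sub>R \<omega>)) \<in> M" if "integer_vec a" for a using exp[OF that] by simp
    show "\<phi> \<in> borel_measurable borel" unfolding \<phi>_def[abs_def] by measurable
    show "norm (\<phi> z) \<le> K" for z using \<open>K \<ge> 0\<close> unfolding \<phi>_def by simp
  qed
  moreover have "AE \<omega> in lebesgue. m \<omega> = \<phi> (torus_point 1 \<omega>)"
  proof -
    have "AE \<omega> in lebesgue. \<forall>\<alpha>\<in>dual_lattice. m (\<omega> + \<alpha>) = g (\<omega> + \<alpha>)"
      by (subst AE_ball_countable[OF countable_dual_lattice]) (auto intro: AE_lebesgue_translate[OF g])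
    then show ?thesis
    proof eventually_elim
      case (elim \<omega>)
      obtain \<alpha> where \<alpha>: "\<alpha> \<in> dual_lattice" "arg_vec (torus_point 1 \<omega>) = \<omega> + \<alpha>" using arg_vec_torus_point_mod_lattice by blast
      then have "m \<omega> = g (\<omega> + \<alpha>)" using elim per unfolding periodic_def by metis
      then show ?case unfolding \<phi>_def \<alpha>(2) using K[of \<omega>] by simp
    qed
  qed
  ultimately show ?thesis by (intro bexI[of _ "\<lambda>\<omega>. \<phi> (torus_point 1 \<omega>)"])
qed

section \<open>Tempered distributions given by functions on the Fourier side\<close>

lemma bounded_limit_closed_annihilator:
  fixes h :: "real^'d::finite \<Rightarrow> complex"
  assumes h: "integrable lebesgue h"
  shows "bounded_limit_closed {m \<in> borel_measurable lebesgue. (\<exists>K. \<forall>x. norm (m x) \<le> K) \<and> (\<integral>x. h x * m x \<partial>lebesgue) = 0}"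
    (is "bounded_limit_closed ?M")
proof -
  have hm: "h \<in> borel_measurable lebesgue" using h by simp
  have int: "integrable lebesgue (\<lambda>x. h x * m x)"
    if m: "m \<in> borel_measurable lebesgue" "\<And>x. norm (m x) \<le> K" for m K
  proof (rule Bochner_Integration.integrable_bound[OF integrable_mult_right[OF integrable_norm[OF h], of K]])
    show "(\<lambda>x. h x * m x) \<in> borel_measurable lebesgue" using hm m(1) by (rule borel_measurable_times)
    have "norm (h x * m x) \<le> norm (K * norm (h x))" for x
    proof -
      have "norm (h x * m x) \<le> norm (h x) * K"
        unfolding norm_mult by (intro mult_left_mono m) auto
      then show ?thesis using abs_ge_self[of "K * norm (h x)"] by (simp only: mult.commute[of K] real_norm_def)
    qed
    then show "AE x in lebesgue. norm (h x * m x) \<le> norm (K * norm (h x))" by simp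
  qed
  show ?thesis unfolding bounded_limit_closed_def
  proof (intro conjI ballI allI impI)
    fix f g assume f: "f \<in> ?M" and g: "g \<in> ?M"
    then obtain K L where K: "\<And>x. norm (f x) \<le> K" and L: "\<And>x. norm (g x) \<le> L" by blast
    have "norm (f x + g x) \<le> K + L" for x using norm_triangle_ineq[of "f x" "g x"] K[of x] L[of x] by linarith
    moreover have "(\<integral>x. h x * (f x + g x) \<partial>lebesgue) = 0"
      using f g by (simp add: distrib_left int[OF _ K] int[OF _ L])
    ultimately show "(\<lambda>x. f x + g x) \<in> ?M" using f g by auto
  next
    fix f c assume f: "f \<in> ?M"
    then obtain K where K: "\<And>x. norm (f x) \<le> K" by blast
    have "norm (c * f x) \<le> norm c * K" for x unfolding norm_mult by (intro mult_left_mono K) auto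
    moreover have "(\<integral>x. h x * (c * f x) \<partial>lebesgue) = 0"
      using f by (simp add: mult.left_commute)
    ultimately show "(\<lambda>x. c * f x) \<in> ?M" using f by auto
  next
    fix f :: "nat \<Rightarrow> real^'d \<Rightarrow> complex" and g K
    assume f: "\<forall>n. f n \<in> ?M" and K: "\<forall>n x. norm (f n x) \<le> K" and lim: "\<forall>x. (\<lambda>n. f n x) \<longlonglongrightarrow> g x"
    have fm: "f n \<in> borel_measurable lebesgue" for n using f by blast
    have gm: "g \<in> borel_measurable lebesgue"
      using lim by (intro borel_measurable_LIMSEQ_metric[OF fm]) auto
    have gK: "norm (g x) \<le> K" for x
      using lim K by (intro Lim_bounded[OF tendsto_norm[of "\<lambda>n. f n x" "g x"], of 0 K]) auto
    have "(\<lambda>n. \<integral>x. h x * f n x \<partial>lebesgue) \<longlonglongrightarrow> (\<integral>x. h x * g x \<partial>lebesgue)"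
    proof (rule integral_dominated_convergence[where w="\<lambda>x. norm (h x) * K"])
      show "integrable lebesgue (\<lambda>x. norm (h x) * K)" using h by simp
      show "AE x in lebesgue. (\<lambda>n. h x * f n x) \<longlonglongrightarrow> h x * g x"
        using lim by (auto intro!: AE_I2 tendsto_mult_left)
      show "AE x in lebesgue. norm (h x * f n x) \<le> norm (h x) * K" for n
        using K by (auto intro!: AE_I2 mult_left_mono simp: norm_mult)
    qed (use hm gm fm in \<open>auto intro!: borel_measurable_times\<close>)
    moreover have "(\<integral>x. h x * f n x \<partial>lebesgue) = 0" for n using f by blast
    ultimately have "(\<integral>x. h x * g x \<partial>lebesgue) = 0" by (simp add: LIMSEQ_const_iff)
    then show "g \<in> ?M" using gm gK by blast
  qed
qed

text \<open>
  A bounded Borel function \<open>u\<close> is the pointwise limit, as the period tends to infinity,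
  of the periodic functions that agree with \<open>u\<close> on one period cell. Testing against the
  conjugate sign of \<open>h\<close> then gives \<open>\<integral> |h| = 0\<close>.
\<close>
lemma AE_eq_0_if_fourier_coefficients_0:
  fixes h :: "real^'d::finite \<Rightarrow> complex"
  assumes h: "integrable lebesgue h" and 0: "\<And>a. (\<integral>x. h x * expi a x \<partial>lebesgue) = 0"
  shows "AE x in lebesgue. h x = 0"
proof -
  let ?M = "{m \<in> borel_measurable lebesgue. (\<exists>K. \<forall>x. norm (m x) \<le> K) \<and> (\<integral>x. h x * m x \<partial>lebesgue) = 0}"
  have M: "bounded_limit_closed ?M" by (rule bounded_limit_closed_annihilator[OF h])
  obtain g where [measurable]: "g \<in> borel_measurable borel" and g: "AE x in lebesgue. h x = g x"
    using borel_version[OF borel_measurable_integrable[OF h]] .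
  define u where "u x = cnj (sgn (g x))" for x
  have [measurable]: "cnj \<in> borel_measurable borel"
    by (intro borel_measurable_continuous_onI continuous_intros)
  have [measurable]: "u \<in> borel_measurable borel"
    unfolding u_def[abs_def] sgn_div_norm by measurable
  have u1: "norm (u x) \<le> 1" for x unfolding u_def by (simp add: norm_sgn)
  have "u \<in> ?M"
  proof (rule bounded_limit_closedD(3)[OF M, where K=1])
    \<comment> \<open>agrees with \<open>u\<close> on the cube of side length \<open>2 \<pi> (n + 1)\<close> around the origin\<close>
    let ?F = "\<lambda>n \<omega>. u (real (Suc n) *\<^sub>R arg_vec (torus_point (inverse (real (Suc n))) \<omega>))"
    show "?F n \<in> ?M" for n
    proof (rule borel_torus_in_closed[OF M, where \<phi>="\<lambda>z. u (real (Suc n) *\<^sub>R arg_vec z)"])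
      fix a :: "real^'d"
      have "expi a (inverse (real (Suc n)) *\<^sub>R \<omega>) = expi (inverse (real (Suc n)) *\<^sub>R a) \<omega>" for \<omega> by simp
      moreover have "expi (inverse (real (Suc n)) *\<^sub>R a) \<in> ?M"
        using 0 by (auto intro!: borel_measurable_lebesgue_continuous continuous_intros exI[of _ 1] simp del: inner_scaleR_left)
      ultimately show "(\<lambda>\<omega>. expi a (inverse (real (Suc n)) *\<^sub>R \<omega>)) \<in> ?M" by presburger
    qed (use u1 in \<open>measurable\<close>)
    show "norm (?F n \<omega>) \<le> 1" for n \<omega> by (rule u1)
    show "(\<lambda>n. ?F n \<omega>) \<longlonglongrightarrow> u \<omega>" for \<omega>
    proof (rule tendsto_eventually)
      obtain N where N: "norm \<omega> < real N" using reals_Archimedean2 by blast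
      show "\<forall>\<^sub>F n in sequentially. ?F n \<omega> = u \<omega>"
      proof (rule eventually_sequentiallyI[of N])
        fix n assume "N \<le> n"
        have "\<bar>inverse (real (Suc n)) * \<omega> $ j\<bar> < pi" for j
        proof -
          have "\<bar>\<omega> $ j\<bar> < real (Suc n)" using component_le_norm_cart[of \<omega> j] N \<open>N \<le> n\<close> by linarith
          then have "\<bar>inverse (real (Suc n)) * \<omega> $ j\<bar> < 1" by (simp add: abs_mult field_simps)
          then show ?thesis using pi_ge_two by linarith
        qed
        from arg_vec_torus_point[OF this] show "?F n \<omega> = u \<omega>" by (simp del: of_nat_Suc)
      qed
    qed
  qed
  then have "(\<integral>x. h x * u x \<partial>lebesgue) = 0" by blast
  also have "(\<integral>x. h x * u x \<partial>lebesgue) = (\<integral>x. complex_of_real (norm (h x)) \<partial>lebesgue)"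
  proof (rule integral_cong_AE)
    show "AE x in lebesgue. h x * u x = complex_of_real (norm (h x))"
      using g
    proof eventually_elim
      case (elim x)
      then have "h x * u x = h x * cnj (h x) / of_real (norm (h x))"
        by (simp add: u_def sgn_eq)
      then show ?case by (simp add: complex_norm_square[symmetric] power2_eq_square)
    qed
    show "(\<lambda>x. h x * u x) \<in> borel_measurable lebesgue"
      using h by (intro borel_measurable_times) (auto intro: measurable_completion)
    show "(\<lambda>x. complex_of_real (norm (h x))) \<in> borel_measurable lebesgue"
      using h by (auto intro!: measurable_compose[of h])
  qed
  finally have "(\<integral>x. norm (h x) \<partial>lebesgue) = 0" by simp
  then have "AE x in lebesgue. norm (h x) = 0"
    using h by (subst (asm) integral_nonneg_eq_0_iff_AE) auto
  then show ?thesis by simp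
qed

lemma has_fourierD:
  assumes "has_fourier T F"
  shows "F \<in> borel_measurable lebesgue"
    and "schwartz f \<Longrightarrow> integrable lebesgue (\<lambda>\<omega>. F \<omega> * f \<omega>)"
    and "schwartz f \<Longrightarrow> T (fourier f) = (\<integral>\<omega>. F \<omega> * f \<omega> \<partial>lebesgue)"
  using assms unfolding has_fourier_def by auto

text \<open>
  Two representatives have the same integrals against a Gaussian times any exponential.
\<close>
lemma has_fourier_unique:
  fixes T :: "'d::finite distr"
  assumes F: "has_fourier T F" and G: "has_fourier T G"
  shows "AE \<omega> in lebesgue. F \<omega> = G \<omega>"
proof -
  let ?h = "\<lambda>x. (F x - G x) * gauss x"
  note i = has_fourierD(2)[OF F] has_fourierD(2)[OF G]
  have "integrable lebesgue ?h"
    using i[OF schwartz_gauss] by (simp add: left_diff_distrib)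
  moreover have "(\<integral>x. ?h x * expi a x \<partial>lebesgue) = 0" for a
  proof -
    have s: "schwartz (\<lambda>x. expi a x * gauss x)" by (intro schwartz_mult_expi schwartz_gauss)
    have "(\<integral>x. ?h x * expi a x \<partial>lebesgue) = (\<integral>x. F x * (expi a x * gauss x) - G x * (expi a x * gauss x) \<partial>lebesgue)"
      by (simp add: algebra_simps)
    also have "\<dots> = 0"
      using i[OF s] has_fourierD(3)[OF F s] has_fourierD(3)[OF G s] by simp
    finally show ?thesis .
  qed
  ultimately have "AE x in lebesgue. ?h x = 0" by (rule AE_eq_0_if_fourier_coefficients_0)
  then show ?thesis by eventually_elim (simp add: gauss_def)
qed

lemma has_fourier_cong:
  assumes F: "has_fourier T F" and ae: "AE \<omega> in lebesgue. F \<omega> = G \<omega>" and G: "G \<in> borel_measurable lebesgue"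
  shows "has_fourier T G"
  unfolding has_fourier_def
proof (intro conjI G allI impI)
  fix f :: "real^'a \<Rightarrow> complex" assume f: "schwartz f"
  have m: "(\<lambda>\<omega>. F \<omega> * f \<omega>) \<in> borel_measurable lebesgue" "(\<lambda>\<omega>. G \<omega> * f \<omega>) \<in> borel_measurable lebesgue"
    by (intro borel_measurable_times has_fourierD(1)[OF F] G schwartz_measurable[OF f])+
  have e: "AE \<omega> in lebesgue. F \<omega> * f \<omega> = G \<omega> * f \<omega>" using ae by eventually_elim simp
  show "integrable lebesgue (\<lambda>\<omega>. G \<omega> * f \<omega>)"
    using integrable_cong_AE[OF m e] has_fourierD(2)[OF F f] by blast
  show "T (fourier f) = (\<integral>\<omega>. G \<omega> * f \<omega> \<partial>lebesgue)"
    using integral_cong_AE[OF m e] has_fourierD(3)[OF F f] by simp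
qed

lemma has_fourier_fhat: "has_fourier T F \<Longrightarrow> has_fourier T (fhat T)"
  unfolding fhat_def using someI[of "has_fourier T" F] by simp

lemma fhat_AE: "has_fourier T F \<Longrightarrow> AE \<omega> in lebesgue. fhat T \<omega> = F \<omega>"
  using has_fourier_unique[OF has_fourier_fhat] by blast

text \<open>
  Every Schwartz function is a Fourier transform, so the values on transforms determine the
  distribution.
\<close>
lemma tempered_eqI:
  fixes T U :: "'d::finite distr"
  assumes T: "tempered T" "has_fourier T F" and U: "tempered U" "has_fourier U F"
  shows "T = U"
proof
  fix g :: "real^'d \<Rightarrow> complex"
  show "T g = U g"
  proof (cases "schwartz g")
    case True
    then have s: "schwartz (inverse_fourier g)" by (rule schwartz_inverse_fourier)
    show ?thesis
      using has_fourierD(3)[OF T(2) s] has_fourierD(3)[OF U(2) s] by (simp add: fourier_inverse_fourier[OF True])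
  next
    case False
    with T(1) U(1) show ?thesis unfolding tempered_def by simp
  qed
qed

lemma has_fourier_add:
  assumes "has_fourier T F" "has_fourier U G"
  shows "has_fourier (T + U) (\<lambda>\<omega>. F \<omega> + G \<omega>)"
  using assms unfolding has_fourier_def by (auto simp: distrib_right plus_fun_def)

lemma has_fourier_diff:
  assumes "has_fourier T F" "has_fourier U G"
  shows "has_fourier (T - U) (\<lambda>\<omega>. F \<omega> - G \<omega>)"
  using assms unfolding has_fourier_def by (auto simp: left_diff_distrib fun_diff_def)

lemma has_fourier_scale:
  assumes "has_fourier T F"
  shows "has_fourier (distr_scale c T) (\<lambda>\<omega>. c * F \<omega>)"
  using assms unfolding has_fourier_def by (auto simp: distr_scale_def mult.assoc)

lemma has_fourier_zero: "has_fourier 0 (\<lambda>\<omega>. 0)"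
  unfolding has_fourier_def by simp

lemma has_fourier_sum:
  assumes "finite I" "\<And>i. i \<in> I \<Longrightarrow> has_fourier (T i) (F i)"
  shows "has_fourier (\<Sum>i\<in>I. T i) (\<lambda>\<omega>. \<Sum>i\<in>I. F i \<omega>)"
  using assms by (induction I rule: finite_induct) (auto intro: has_fourier_zero has_fourier_add)

lemma has_fourier_translate:
  fixes T :: "'d::finite distr"
  assumes T: "has_fourier T F"
  shows "has_fourier (translate a T) (\<lambda>\<omega>. expi (- a) \<omega> * F \<omega>)"
  unfolding has_fourier_def
proof (intro conjI allI impI)
  show "(\<lambda>\<omega>. expi (- a) \<omega> * F \<omega>) \<in> borel_measurable lebesgue"
    by (intro borel_measurable_times has_fourierD(1)[OF T] borel_measurable_lebesgue_continuous continuous_intros)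
  fix f :: "real^'d \<Rightarrow> complex" assume f: "schwartz f"
  have s: "schwartz (\<lambda>x. expi (- a) x * f x)" by (rule schwartz_mult_expi[OF f])
  have "fourier f (x + a) = fourier (\<lambda>x. expi (- a) x * f x) x" for x
    unfolding fourier_eq_expi mult.assoc[symmetric] exp_add[symmetric]
    by (simp add: inner_add_left algebra_simps)
  then have "translate a T (fourier f) = T (fourier (\<lambda>x. expi (- a) x * f x))"
    unfolding translate_def by simp
  with has_fourierD(2,3)[OF T s] show "integrable lebesgue (\<lambda>\<omega>. expi (- a) \<omega> * F \<omega> * f \<omega>)"
    "translate a T (fourier f) = (\<integral>\<omega>. expi (- a) \<omega> * F \<omega> * f \<omega> \<partial>lebesgue)"
    by (simp_all add: mult_ac)
qed

text \<open>
  The factor \<open>h\<^sup>d\<close> in the definition of \<open>dilate\<close> cancels against the scaling of the Fourier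
  transform of the test function; the substitution in the integral produces it again.
\<close>
lemma has_fourier_dilate:
  fixes T :: "'d::finite distr"
  assumes T: "has_fourier T F" and h: "h > 0"
  shows "has_fourier (dilate h T) (\<lambda>\<omega>. of_real (h ^ CARD('d)) * F (h *\<^sub>R \<omega>))"
  unfolding has_fourier_def
proof (intro conjI allI impI)
  let ?c = "complex_of_real (h ^ CARD('d))"
  have Fm: "F \<in> borel_measurable lebesgue" by (rule has_fourierD(1)[OF T])
  show "(\<lambda>\<omega>. ?c * F (h *\<^sub>R \<omega>)) \<in> borel_measurable lebesgue"
    using borel_measurable_lebesgue_affine[OF Fm, of h 0] h by simp
  fix f :: "real^'d \<Rightarrow> complex" assume f: "schwartz f"
  let ?g = "\<lambda>x. inverse ?c * f (inverse h *\<^sub>R x)"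
  have s: "schwartz ?g" using h by (intro schwartz_cmult schwartz_scale f) simp
  have "fourier f (h *\<^sub>R x) = fourier ?g x" for x
    unfolding fourier_cmult using h by (subst fourier_scale[OF f]) (auto simp: power_inverse)
  then have eq: "dilate h T (fourier f) = ?c * T (fourier ?g)"
    unfolding dilate_def by simp
  note i = has_fourierD(2)[OF T s]
  have i': "integrable lebesgue (\<lambda>\<omega>. F (h *\<^sub>R \<omega>) * ?g (h *\<^sub>R \<omega>))"
    using integrable_lebesgue_affine[OF i, of h 0] h by simp
  have g: "?c * F (h *\<^sub>R \<omega>) * f \<omega> = ?c * (?c * (F (h *\<^sub>R \<omega>) * ?g (h *\<^sub>R \<omega>)))" for \<omega>
    using h by simp
  show "integrable lebesgue (\<lambda>\<omega>. ?c * F (h *\<^sub>R \<omega>) * f \<omega>)"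
    unfolding g by (intro integrable_mult_right i')
  have "(\<integral>\<omega>. F \<omega> * ?g \<omega> \<partial>lebesgue) = ?c * (\<integral>\<omega>. F (h *\<^sub>R \<omega>) * ?g (h *\<^sub>R \<omega>) \<partial>lebesgue)"
    using integral_lebesgue_affine[OF borel_measurable_integrable[OF i], of h 0] h
    by (simp add: scaleR_conv_of_real[where 'a=complex])
  then show "dilate h T (fourier f) = (\<integral>\<omega>. ?c * F (h *\<^sub>R \<omega>) * f \<omega> \<partial>lebesgue)"
    unfolding eq has_fourierD(3)[OF T s] g integral_mult_right_zero by simp
qed

section \<open>Weighted square-integrable functions and Sobolev spaces\<close>

abbreviation weight :: "real \<Rightarrow> 'a::real_normed_vector \<Rightarrow> real" where
  "weight s \<omega> \<equiv> (1 + norm \<omega>) powr (2 * s)"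

text \<open>
  Up to null sets, the range of the Fourier transform on \<open>sobolev s\<close>.
\<close>
definition weighted_L2 :: "real \<Rightarrow> (real^'d::finite \<Rightarrow> complex) \<Rightarrow> bool" where
  "weighted_L2 s F \<longleftrightarrow> F \<in> borel_measurable lebesgue \<and>
     integrable lebesgue (\<lambda>\<omega>. weight s \<omega> * (norm (F \<omega>))\<^sup>2)"

lemma measurable_weight [measurable]:
  "(\<lambda>\<omega>::real^'d::finite. (1 + norm \<omega>) powr t) \<in> borel_measurable lebesgue"
  by (intro borel_measurable_lebesgue_continuous continuous_intros) (auto simp: add_nonneg_eq_0_iff)

lemma weighted_L2_bound:
  assumes F: "weighted_L2 s F" and G: "G \<in> borel_measurable lebesgue"
    and le: "AE \<omega> in lebesgue. norm (G \<omega>) \<le> K * norm (F \<omega>)"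
  shows "weighted_L2 s G"
  unfolding weighted_L2_def
proof (intro conjI G)
  show "integrable lebesgue (\<lambda>\<omega>. weight s \<omega> * (norm (G \<omega>))\<^sup>2)"
  proof (rule Bochner_Integration.integrable_bound)
    show "integrable lebesgue (\<lambda>\<omega>. K\<^sup>2 * (weight s \<omega> * (norm (F \<omega>))\<^sup>2))"
      using F unfolding weighted_L2_def by (intro integrable_mult_right) blast
    show "(\<lambda>\<omega>. weight s \<omega> * (norm (G \<omega>))\<^sup>2) \<in> borel_measurable lebesgue"
      using G by measurable
    show "AE \<omega> in lebesgue. norm (weight s \<omega> * (norm (G \<omega>))\<^sup>2)
        \<le> norm (K\<^sup>2 * (weight s \<omega> * (norm (F \<omega>))\<^sup>2))"
      using le
    proof eventually_elim
      case (elim \<omega>)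
      then have "(norm (G \<omega>))\<^sup>2 \<le> (K * norm (F \<omega>))\<^sup>2" by (intro power_mono) auto
      then have "weight s \<omega> * (norm (G \<omega>))\<^sup>2 \<le> weight s \<omega> * (K * norm (F \<omega>))\<^sup>2"
        by (intro mult_left_mono) auto
      then show ?case by (simp add: power_mult_distrib mult_ac)
    qed
  qed
qed

lemma weighted_L2_add:
  assumes F: "weighted_L2 s F" and G: "weighted_L2 s G"
  shows "weighted_L2 s (\<lambda>\<omega>. F \<omega> + G \<omega>)"
  unfolding weighted_L2_def
proof
  have m: "F \<in> borel_measurable lebesgue" "G \<in> borel_measurable lebesgue"
    using F G unfolding weighted_L2_def by auto
  show "(\<lambda>\<omega>. F \<omega> + G \<omega>) \<in> borel_measurable lebesgue" using m by measurable
  show "integrable lebesgue (\<lambda>\<omega>. weight s \<omega> * (norm (F \<omega> + G \<omega>))\<^sup>2)"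
  proof (rule Bochner_Integration.integrable_bound)
    show "integrable lebesgue (\<lambda>\<omega>. 2 * (weight s \<omega> * (norm (F \<omega>))\<^sup>2) + 2 * (weight s \<omega> * (norm (G \<omega>))\<^sup>2))"
      using F G unfolding weighted_L2_def by auto
    show "(\<lambda>\<omega>. weight s \<omega> * (norm (F \<omega> + G \<omega>))\<^sup>2) \<in> borel_measurable lebesgue"
      using m by measurable
    have "weight s \<omega> * (norm (F \<omega> + G \<omega>))\<^sup>2
        \<le> 2 * (weight s \<omega> * (norm (F \<omega>))\<^sup>2) + 2 * (weight s \<omega> * (norm (G \<omega>))\<^sup>2)" for \<omega>
    proof -
      have "(norm (F \<omega> + G \<omega>))\<^sup>2 \<le> (norm (F \<omega>) + norm (G \<omega>))\<^sup>2"
        by (intro power_mono norm_triangle_ineq) auto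
      also have "\<dots> \<le> 2 * (norm (F \<omega>))\<^sup>2 + 2 * (norm (G \<omega>))\<^sup>2"
        using zero_le_power2[of "norm (F \<omega>) - norm (G \<omega>)"] by (simp add: power2_eq_square algebra_simps)
      finally have "weight s \<omega> * (norm (F \<omega> + G \<omega>))\<^sup>2 \<le> weight s \<omega> * (2 * (norm (F \<omega>))\<^sup>2 + 2 * (norm (G \<omega>))\<^sup>2)"
        by (intro mult_left_mono) auto
      then show ?thesis by (simp add: algebra_simps)
    qed
    then show "AE \<omega> in lebesgue. norm (weight s \<omega> * (norm (F \<omega> + G \<omega>))\<^sup>2)
        \<le> norm (2 * (weight s \<omega> * (norm (F \<omega>))\<^sup>2) + 2 * (weight s \<omega> * (norm (G \<omega>))\<^sup>2))"
      by (intro AE_I2) simp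
  qed
qed

lemma weighted_L2_cmult: "weighted_L2 s F \<Longrightarrow> weighted_L2 s (\<lambda>\<omega>. c * F \<omega>)"
  by (rule weighted_L2_bound[of s F _ "norm c"]) (auto simp: weighted_L2_def norm_mult)

lemma weighted_L2_diff:
  "weighted_L2 s F \<Longrightarrow> weighted_L2 s G \<Longrightarrow> weighted_L2 s (\<lambda>\<omega>. F \<omega> - G \<omega>)"
  using weighted_L2_add[of s F "\<lambda>\<omega>. (-1) * G \<omega>"] weighted_L2_cmult[of s G "-1"] by simp

lemma weighted_L2_sum:
  "finite I \<Longrightarrow> (\<And>i. i \<in> I \<Longrightarrow> weighted_L2 s (F i)) \<Longrightarrow> weighted_L2 s (\<lambda>\<omega>. \<Sum>i\<in>I. F i \<omega>)"
  by (induction I rule: finite_induct) (auto simp: weighted_L2_add, simp add: weighted_L2_def)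

lemma weighted_L2_dilate:
  fixes F :: "real^'d::finite \<Rightarrow> complex"
  assumes F: "weighted_L2 s F" and h: "h > 0"
  shows "weighted_L2 s (\<lambda>\<omega>. F (h *\<^sub>R \<omega>))"
  unfolding weighted_L2_def
proof
  have Fm: "F \<in> borel_measurable lebesgue" and Fi: "integrable lebesgue (\<lambda>\<omega>. weight s \<omega> * (norm (F \<omega>))\<^sup>2)"
    using F unfolding weighted_L2_def by auto
  show m: "(\<lambda>\<omega>. F (h *\<^sub>R \<omega>)) \<in> borel_measurable lebesgue"
    using borel_measurable_lebesgue_affine[OF Fm, of h 0] h by simp
  \<comment> \<open>bounds for the ratio of \<open>1 + |\<omega>|\<close> and \<open>1 + |h \<omega>|\<close>; either one is the relevant bound, according to the sign of \<open>s\<close>\<close>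
  define a b where "a = min 1 (1 / h)" and "b = max 1 (1 / h)"
  have ab: "0 < a" "0 < b" using h unfolding a_def b_def by auto
  show "integrable lebesgue (\<lambda>\<omega>. weight s \<omega> * (norm (F (h *\<^sub>R \<omega>)))\<^sup>2)"
  proof (rule Bochner_Integration.integrable_bound)
    show "integrable lebesgue (\<lambda>\<omega>. (a powr (2 * s) + b powr (2 * s)) * ((1 + norm (h *\<^sub>R \<omega>)) powr (2 * s) * (norm (F (h *\<^sub>R \<omega>)))\<^sup>2))"
      using integrable_lebesgue_affine[OF Fi, of h 0] h by (intro integrable_mult_right) simp
    show "(\<lambda>\<omega>. weight s \<omega> * (norm (F (h *\<^sub>R \<omega>)))\<^sup>2) \<in> borel_measurable lebesgue"
      using m by measurable
    have le: "weight s \<omega> \<le> (a powr (2 * s) + b powr (2 * s)) * (1 + norm (h *\<^sub>R \<omega>)) powr (2 * s)" for \<omega> :: "real^'d"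
    proof -
      define q where "q = (1 + norm \<omega>) / (1 + norm (h *\<^sub>R \<omega>))"
      have pos: "1 + norm (h *\<^sub>R \<omega>) > 0" by (simp add: add_pos_nonneg)
      have "a \<le> q" "q \<le> b"
        unfolding q_def a_def b_def using pos h
        by (auto simp: field_simps min_def max_def mult_right_mono[of h 1 "norm \<omega>", simplified]
            mult_right_mono[of 1 h "norm \<omega>", simplified] mult_le_cancel_left1 mult_le_cancel_right1)
      have "q > 0" using ab \<open>a \<le> q\<close> by linarith
      have "q powr (2 * s) \<le> a powr (2 * s) + b powr (2 * s)"
      proof (cases "s \<ge> 0")
        case True
        then have "q powr (2 * s) \<le> b powr (2 * s)" using \<open>q > 0\<close> \<open>q \<le> b\<close> by (intro powr_mono2) auto
        then show ?thesis by (simp add: add_increasing)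
      next
        case False
        then have "q powr (2 * s) \<le> a powr (2 * s)" using ab \<open>a \<le> q\<close> by (intro powr_mono2') auto
        then show ?thesis by (simp add: add_increasing2)
      qed
      moreover have "weight s \<omega> = q powr (2 * s) * (1 + norm (h *\<^sub>R \<omega>)) powr (2 * s)"
        using pos \<open>q > 0\<close> unfolding q_def by (subst powr_mult[symmetric]) auto
      ultimately show ?thesis by (simp add: mult_right_mono)
    qed
    show "AE \<omega> in lebesgue. norm (weight s \<omega> * (norm (F (h *\<^sub>R \<omega>)))\<^sup>2)
       \<le> norm ((a powr (2 * s) + b powr (2 * s)) * ((1 + norm (h *\<^sub>R \<omega>)) powr (2 * s) * (norm (F (h *\<^sub>R \<omega>)))\<^sup>2))"
      using mult_right_mono[OF le zero_le_power2, of _ "norm (F (h *\<^sub>R _))"]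
      by (intro AE_I2) (simp add: mult.assoc abs_mult del: norm_scaleR)
  qed
qed

text \<open>
  The product is split by the inequality between the arithmetic and the geometric mean into
  the weighted square of \<open>F\<close> and an integrable power of \<open>1 + |\<omega>|\<close>.
\<close>
lemma weighted_L2_integrable:
  fixes F :: "real^'d::finite \<Rightarrow> complex"
  assumes F: "weighted_L2 s F"
  obtains M where "integrable lebesgue (\<lambda>\<omega>. norm (F \<omega>) * inverse ((1 + norm \<omega>) ^ M))"
proof -
  define N where "N = DIM(real^'d) + 2"
  \<comment> \<open>large enough for \<open>(1 + |\<omega>|) powr (- 2 s - 2 M)\<close> to be integrable\<close>
  define M where "M = nat \<lceil>\<bar>s\<bar>\<rceil> + N"
  have sM: "\<bar>s\<bar> + real N \<le> real M" unfolding M_def by linarith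
  have Fm: "F \<in> borel_measurable lebesgue" using F unfolding weighted_L2_def by blast
  have nz: "1 + norm \<omega> \<noteq> 0" for \<omega> :: "real^'d" using norm_ge_zero[of \<omega>] by linarith
  have m1: "(\<lambda>\<omega>::real^'d. inverse ((1 + norm \<omega>) ^ M)) \<in> borel_measurable lebesgue"
    using nz by (intro borel_measurable_lebesgue_continuous continuous_intros) auto
  have "integrable lebesgue (\<lambda>\<omega>. norm (F \<omega>) * inverse ((1 + norm \<omega>) ^ M))"
  proof (rule Bochner_Integration.integrable_bound)
    show "integrable lebesgue (\<lambda>\<omega>. weight s \<omega> * (norm (F \<omega>))\<^sup>2 + inverse ((1 + norm \<omega>) ^ N))"
      using F integrable_inverse_power_norm[where 'a="real^'d"] unfolding weighted_L2_def N_def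
      by (intro Bochner_Integration.integrable_add) auto
    show "(\<lambda>\<omega>. norm (F \<omega>) * inverse ((1 + norm \<omega>) ^ M)) \<in> borel_measurable lebesgue"
      using Fm m1 by (intro borel_measurable_times borel_measurable_norm) auto
    have le: "norm (F \<omega>) * inverse ((1 + norm \<omega>) ^ M) \<le> weight s \<omega> * (norm (F \<omega>))\<^sup>2 + inverse ((1 + norm \<omega>) ^ N)" for \<omega>
    proof -
      let ?w = "1 + norm \<omega>"
      have w: "?w \<ge> 1" by simp
      define a b where "a = ?w powr s * norm (F \<omega>)" and "b = ?w powr (- s) * ?w powr (- real M)"
      have "a * b = (?w powr s * ?w powr (- s)) * (norm (F \<omega>) * ?w powr (- real M))"
        unfolding a_def b_def by (simp add: mult_ac)
      also have "\<dots> = norm (F \<omega>) * inverse (?w ^ M)"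
      proof -
        have "?w powr s * ?w powr (- s) = 1" using nz[of \<omega>] by (simp add: powr_add[symmetric] del: powr_minus)
        moreover have "?w powr (- real M) = inverse (?w ^ M)"
          using w by (simp add: powr_minus powr_realpow add_pos_nonneg)
        ultimately show ?thesis by simp
      qed
      finally have ab: "norm (F \<omega>) * inverse (?w ^ M) = a * b" by simp
      have "2 * (a * b) \<le> a\<^sup>2 + b\<^sup>2"
        using zero_le_power2[of "a - b"] by (simp add: power2_eq_square algebra_simps)
      moreover have "0 \<le> a * b" unfolding a_def b_def by simp
      moreover have "a\<^sup>2 = ?w powr (2 * s) * (norm (F \<omega>))\<^sup>2"
        unfolding a_def by (simp add: power_mult_distrib power2_eq_square powr_add[symmetric])
      moreover have "b\<^sup>2 \<le> inverse (?w ^ N)"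
      proof -
        have "b\<^sup>2 = ?w powr (- 2 * s - 2 * real M)"
          unfolding b_def by (simp add: power2_eq_square powr_add[symmetric])
        also have "\<dots> \<le> ?w powr (- real N)"
          using sM w by (intro powr_mono) auto
        also have "\<dots> = inverse (?w ^ N)" using w by (simp add: powr_minus powr_realpow add_pos_nonneg)
        finally show ?thesis .
      qed
      ultimately show ?thesis unfolding ab by linarith
    qed
    show "AE \<omega> in lebesgue. norm (norm (F \<omega>) * inverse ((1 + norm \<omega>) ^ M))
        \<le> norm (weight s \<omega> * (norm (F \<omega>))\<^sup>2 + inverse ((1 + norm \<omega>) ^ N))"
      unfolding real_norm_def by (intro AE_I2 order_trans[OF eq_refl[OF abs_of_nonneg] order_trans[OF le abs_ge_self]]) simp
  qed
  then show ?thesis by (rule that)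
qed

lemma norm_mult_decay_le:
  fixes F :: "real^'d::finite \<Rightarrow> complex"
  assumes "(1 + norm \<omega>) ^ M * norm (g \<omega>) \<le> C"
  shows "norm (F \<omega> * g \<omega>) \<le> C * (norm (F \<omega>) * inverse ((1 + norm \<omega>) ^ M))"
  using mult_left_mono[OF norm_le_decay[where f=g and x=\<omega>, OF assms] norm_ge_zero[of "F \<omega>"]]
  by (simp add: norm_mult mult_ac)

text \<open>
  The distribution is \<open>g \<mapsto> \<integral> F (inverse_fourier g)\<close>; it is continuous because finitely many
  Schwartz seminorms of \<open>g\<close> control the decay of its transform.
\<close>
lemma has_fourier_exists:
  fixes F :: "real^'d::finite \<Rightarrow> complex"
  assumes F: "weighted_L2 s F"
  shows "\<exists>T. tempered T \<and> has_fourier T F"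
proof -
  obtain M where M: "integrable lebesgue (\<lambda>\<omega>. norm (F \<omega>) * inverse ((1 + norm \<omega>) ^ M))"
    using weighted_L2_integrable[OF F] .
  have Fm: "F \<in> borel_measurable lebesgue" using F unfolding weighted_L2_def by blast
  have int: "integrable lebesgue (\<lambda>\<omega>. F \<omega> * g \<omega>)" if g: "schwartz g" for g
  proof -
    obtain C where C: "\<And>x. (1 + norm x) ^ M * norm (g x) \<le> C"
      using schwartz_rapid[OF g] unfolding rapid_def by blast
    show ?thesis
    proof (rule Bochner_Integration.integrable_bound[OF integrable_mult_right[OF M, of C]])
      show "(\<lambda>\<omega>. F \<omega> * g \<omega>) \<in> borel_measurable lebesgue"
        by (intro borel_measurable_times Fm schwartz_measurable g)
      show "AE \<omega> in lebesgue. norm (F \<omega> * g \<omega>) \<le> norm (C * (norm (F \<omega>) * inverse ((1 + norm \<omega>) ^ M)))"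
      proof (rule AE_I2)
        fix \<omega>
        show "norm (F \<omega> * g \<omega>) \<le> norm (C * (norm (F \<omega>) * inverse ((1 + norm \<omega>) ^ M)))"
          using norm_mult_decay_le[where F=F and g=g and \<omega>=\<omega>, OF C] by (metis abs_ge_self order_trans real_norm_def)
      qed
    qed
  qed
  define T where "T g = (if schwartz g then \<integral>\<omega>. F \<omega> * inverse_fourier g \<omega> \<partial>lebesgue else 0)" for g
  have inv_add: "inverse_fourier (\<lambda>x. f x + g x) \<omega> = inverse_fourier f \<omega> + inverse_fourier g \<omega>"
    if "schwartz f" "schwartz g" for f g :: "real^'d \<Rightarrow> complex" and \<omega>
    using that by (simp add: inverse_fourier_def fourier_add distrib_left)
  have inv_cmult: "inverse_fourier (\<lambda>x. c * f x) \<omega> = c * inverse_fourier f \<omega>" for c and f :: "real^'d \<Rightarrow> complex" and \<omega>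
    by (simp add: inverse_fourier_def fourier_cmult)
  have "tempered T"
    unfolding tempered_def
  proof (intro conjI allI impI)
    fix f g :: "real^'d \<Rightarrow> complex" assume fg: "schwartz f" "schwartz g"
    then show "T (\<lambda>x. f x + g x) = T f + T g"
      unfolding T_def using int[OF schwartz_inverse_fourier[OF fg(1)]] int[OF schwartz_inverse_fourier[OF fg(2)]]
      by (simp add: schwartz_add inv_add distrib_left)
  next
    fix c and f :: "real^'d \<Rightarrow> complex" assume f: "schwartz f"
    then show "T (\<lambda>x. c * f x) = c * T f"
      unfolding T_def by (simp add: schwartz_cmult inv_cmult mult.left_commute)
  next
    obtain C where "C \<ge> 0" and C: "\<And>f :: real^'d \<Rightarrow> complex. \<And>\<omega>. schwartz f \<Longrightarrow>
      (1 + norm \<omega>) ^ M * norm (fourier f \<omega>) \<le> C * schwartz_norm (DIM(real^'d) + 2 + M) f"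
      using fourier_decay[of M, where 'd='d] by blast
    define N where "N = DIM(real^'d) + 2 + M"
    define c where "c = norm (inverse ((gauss_mass TYPE('d))\<^sup>2))"
    define A where "A = (\<integral>\<omega>. norm (F \<omega>) * inverse ((1 + norm \<omega>) ^ M) \<partial>lebesgue)"
    have "norm (T f) \<le> c * C * A * schwartz_norm N f" if f: "schwartz f" for f
    proof -
      let ?B = "c * (C * schwartz_norm N f)"
      have "(1 + norm \<omega>) ^ M * norm (inverse_fourier f \<omega>) \<le> ?B" for \<omega>
      proof -
        have "c * ((1 + norm (- \<omega>)) ^ M * norm (fourier f (- \<omega>))) \<le> ?B"
          unfolding N_def by (intro mult_left_mono C[OF f]) (simp add: c_def)
        then show ?thesis by (simp add: inverse_fourier_def norm_mult c_def mult_ac)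
      qed
      then have le: "norm (F \<omega> * inverse_fourier f \<omega>) \<le> ?B * (norm (F \<omega>) * inverse ((1 + norm \<omega>) ^ M))" for \<omega>
        by (rule norm_mult_decay_le)
      have "norm (T f) \<le> (\<integral>\<omega>. ?B * (norm (F \<omega>) * inverse ((1 + norm \<omega>) ^ M)) \<partial>lebesgue)"
        unfolding T_def using f
        by (simp only: if_True) (intro order_trans[OF integral_norm_bound] integral_mono integrable_norm
            int schwartz_inverse_fourier integrable_mult_right M le)
      then show ?thesis unfolding A_def by (simp add: mult_ac)
    qed
    then show "\<exists>C N. \<forall>f. schwartz f \<longrightarrow> norm (T f) \<le> C * schwartz_norm N f" by blast
  next
    fix f :: "real^'d \<Rightarrow> complex" assume "\<not> schwartz f" then show "T f = 0" unfolding T_def by simp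
  qed
  moreover have "has_fourier T F"
    unfolding has_fourier_def
    by (intro conjI allI impI Fm int) (simp_all add: T_def schwartz_fourier inverse_fourier_fourier)
  ultimately show ?thesis by blast
qed

lemma set_integrable_compact_if_weighted_L2:
  fixes F :: "real^'d::finite \<Rightarrow> complex"
  assumes F: "weighted_L2 s F" and K: "compact K"
  shows "set_integrable lebesgue K (\<lambda>\<omega>. (norm (F \<omega>))\<^sup>2)"
proof -
  obtain R where R: "\<And>\<omega>. \<omega> \<in> K \<Longrightarrow> norm \<omega> \<le> R" using compact_imp_bounded[OF K] bounded_iff by blast
  define c where "c = (1 + \<bar>R\<bar>) powr (- 2 * \<bar>s\<bar>)"
  have "c > 0" unfolding c_def by simp
  have c: "c \<le> weight s \<omega>" if "\<omega> \<in> K" for \<omega>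
  proof -
    have "c \<le> (1 + norm \<omega>) powr (- 2 * \<bar>s\<bar>)"
      unfolding c_def using R[OF that] by (intro powr_mono2') (auto intro: add_pos_nonneg)
    also have "\<dots> \<le> weight s \<omega>" by (intro powr_mono) auto
    finally show ?thesis .
  qed
  have Km: "K \<in> sets lebesgue" using K by (simp add: compact_imp_closed)
  have Fm: "F \<in> borel_measurable lebesgue" using F unfolding weighted_L2_def by blast
  show ?thesis unfolding set_integrable_def
  proof (rule Bochner_Integration.integrable_bound)
    show "integrable lebesgue (\<lambda>\<omega>. inverse c * (weight s \<omega> * (norm (F \<omega>))\<^sup>2))"
      using F unfolding weighted_L2_def by (intro integrable_mult_right) blast
    show "(\<lambda>\<omega>. indicat_real K \<omega> *\<^sub>R (norm (F \<omega>))\<^sup>2) \<in> borel_measurable lebesgue"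
      using Fm Km by (intro borel_measurable_scaleR borel_measurable_indicator borel_measurable_power
          measurable_compose[OF Fm borel_measurable_norm])
    have "indicat_real K \<omega> *\<^sub>R (norm (F \<omega>))\<^sup>2 \<le> inverse c * (weight s \<omega> * (norm (F \<omega>))\<^sup>2)" for \<omega>
    proof (cases "\<omega> \<in> K")
      case True
      have "c * (norm (F \<omega>))\<^sup>2 \<le> weight s \<omega> * (norm (F \<omega>))\<^sup>2"
        by (intro mult_right_mono c True) auto
      then show ?thesis using True \<open>c > 0\<close> by (simp add: field_simps)
    qed (use \<open>c > 0\<close> in auto)
    then show "AE \<omega> in lebesgue. norm (indicat_real K \<omega> *\<^sub>R (norm (F \<omega>))\<^sup>2) \<le> norm (inverse c * (weight s \<omega> * (norm (F \<omega>))\<^sup>2))"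
      using \<open>c > 0\<close> by (intro AE_I2) (simp add: abs_mult)
  qed
qed

lemma sobolevI: "tempered T \<Longrightarrow> has_fourier T F \<Longrightarrow> weighted_L2 s F \<Longrightarrow> T \<in> sobolev s"
  unfolding sobolev_def using set_integrable_compact_if_weighted_L2[of s F]
  by (auto simp: weighted_L2_def)

lemma weighted_L2_cong:
  assumes F: "weighted_L2 s F" and "AE \<omega> in lebesgue. F \<omega> = G \<omega>" and G: "G \<in> borel_measurable lebesgue"
  shows "weighted_L2 s G"
  by (rule weighted_L2_bound[OF F G, of 1]) (use assms(2) in eventually_elim, simp)

lemma sobolevD:
  assumes "T \<in> sobolev s"
  shows "tempered T" "has_fourier T (fhat T)" "weighted_L2 s (fhat T)"
proof -
  obtain F where F: "tempered T" "has_fourier T F" "weighted_L2 s F"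
    using assms has_fourierD(1) unfolding sobolev_def weighted_L2_def by blast
  show "tempered T" by fact
  show h: "has_fourier T (fhat T)" by (rule has_fourier_fhat[OF F(2)])
  show "weighted_L2 s (fhat T)"
    by (rule weighted_L2_cong[OF F(3) has_fourier_unique[OF F(2) h] has_fourierD(1)[OF h]])
qed

lemma sobolev_exists:
  assumes "weighted_L2 s F" obtains T where "T \<in> sobolev s" "has_fourier T F"
  using has_fourier_exists[OF assms] sobolevI[OF _ _ assms] by blast

lemma sobolev_norm_eq:
  assumes F: "has_fourier T F"
  shows "sobolev_norm s T = sqrt (\<integral>\<omega>. weight s \<omega> * (norm (F \<omega>))\<^sup>2 \<partial>lebesgue)"
proof -
  have [measurable]: "F \<in> borel_measurable lebesgue" "fhat T \<in> borel_measurable lebesgue"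
    using has_fourierD(1)[OF F] has_fourierD(1)[OF has_fourier_fhat[OF F]] by auto
  have "(\<integral>\<omega>. weight s \<omega> * (norm (fhat T \<omega>))\<^sup>2 \<partial>lebesgue)
      = (\<integral>\<omega>. weight s \<omega> * (norm (F \<omega>))\<^sup>2 \<partial>lebesgue)"
  proof (rule integral_cong_AE)
    show "AE \<omega> in lebesgue. weight s \<omega> * (norm (fhat T \<omega>))\<^sup>2 = weight s \<omega> * (norm (F \<omega>))\<^sup>2"
      using fhat_AE[OF F] by eventually_elim simp
  qed measurable
  then show ?thesis unfolding sobolev_norm_def by simp
qed

lemma weighted_L2_mono:
  assumes F: "weighted_L2 k F" and "s \<le> k"
  shows "weighted_L2 s F"
  unfolding weighted_L2_def
proof
  show m: "F \<in> borel_measurable lebesgue" using F unfolding weighted_L2_def by blast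
  show "integrable lebesgue (\<lambda>\<omega>. weight s \<omega> * (norm (F \<omega>))\<^sup>2)"
  proof (rule Bochner_Integration.integrable_bound)
    show "integrable lebesgue (\<lambda>\<omega>. weight k \<omega> * (norm (F \<omega>))\<^sup>2)"
      using F unfolding weighted_L2_def by blast
    show "(\<lambda>\<omega>. weight s \<omega> * (norm (F \<omega>))\<^sup>2) \<in> borel_measurable lebesgue"
      using m by measurable
    show "AE \<omega> in lebesgue. norm (weight s \<omega> * (norm (F \<omega>))\<^sup>2)
      \<le> norm (weight k \<omega> * (norm (F \<omega>))\<^sup>2)"
      using \<open>s \<le> k\<close> by (intro AE_I2) (auto intro!: mult_right_mono powr_mono)
  qed
qed

section \<open>Periodic multipliers on closed shift-invariant spaces\<close>

text \<open>
  Dominated convergence on the Fourier side is convergence in the Sobolev norm.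
\<close>
lemma closed_si_dominated_limit:
  assumes S: "closed_shift_invariant s S"
    and T: "T \<in> sobolev s" "has_fourier T F"
    and U: "\<And>n. \<exists>U\<in>S. has_fourier U (Fn n)"
    and lim: "AE \<omega> in lebesgue. (\<lambda>n. Fn n \<omega>) \<longlonglongrightarrow> F \<omega>"
    and dom: "\<And>n. AE \<omega> in lebesgue. norm (F \<omega> - Fn n \<omega>) \<le> norm (G \<omega>)" and G: "weighted_L2 s G"
  shows "T \<in> S"
proof -
  have Fm[measurable]: "F \<in> borel_measurable lebesgue" by (rule has_fourierD(1)[OF T(2)])
  have Fnm[measurable]: "Fn n \<in> borel_measurable lebesgue" for n using U[of n] has_fourierD(1) by blast
  let ?I = "\<lambda>n. \<integral>\<omega>. weight s \<omega> * (norm (F \<omega> - Fn n \<omega>))\<^sup>2 \<partial>lebesgue"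
  have "?I \<longlonglongrightarrow> integral\<^sup>L lebesgue (\<lambda>\<omega> :: real^'a. 0)"
  proof (rule integral_dominated_convergence)
    show "integrable lebesgue (\<lambda>\<omega>. weight s \<omega> * (norm (G \<omega>))\<^sup>2)"
      using G unfolding weighted_L2_def by blast
    show "AE \<omega> in lebesgue. (\<lambda>n. weight s \<omega> * (norm (F \<omega> - Fn n \<omega>))\<^sup>2) \<longlonglongrightarrow> 0"
      using lim
    proof eventually_elim
      case (elim \<omega>)
      then have "(\<lambda>n. weight s \<omega> * (norm (F \<omega> - Fn n \<omega>))\<^sup>2) \<longlonglongrightarrow> weight s \<omega> * (norm (F \<omega> - F \<omega>))\<^sup>2"
        by (intro tendsto_intros)
      then show ?case by simp
    qed
    show "AE \<omega> in lebesgue. norm (weight s \<omega> * (norm (F \<omega> - Fn n \<omega>))\<^sup>2)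
      \<le> weight s \<omega> * (norm (G \<omega>))\<^sup>2" for n
      using dom[of n]
    proof eventually_elim
      case (elim \<omega>)
      then have "(norm (F \<omega> - Fn n \<omega>))\<^sup>2 \<le> (norm (G \<omega>))\<^sup>2" by (intro power_mono) auto
      then show ?case by (simp add: abs_mult mult_left_mono)
    qed
  qed measurable
  then have "(\<lambda>n. sqrt (?I n)) \<longlonglongrightarrow> sqrt 0" by (intro tendsto_real_sqrt) simp
  then have lim0: "(\<lambda>n. sqrt (?I n)) \<longlonglongrightarrow> 0" by simp
  have "\<exists>g\<in>S. sobolev_norm s (T - g) < e" if "e > 0" for e
  proof -
    obtain n where n: "sqrt (?I n) < e"
      using order_tendstoD(2)[OF lim0 \<open>e > 0\<close>] by (auto simp: eventually_sequentially)
    obtain g where g: "g \<in> S" "has_fourier g (Fn n)" using U by blast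
    have "sobolev_norm s (T - g) = sqrt (?I n)"
      by (rule sobolev_norm_eq[OF has_fourier_diff[OF T(2) g(2)]])
    with n g(1) show ?thesis by (intro bexI[of _ g]) simp_all
  qed
  with S T(1) show ?thesis unfolding closed_shift_invariant_def by blast
qed

text \<open>
  Multiplication by an exponential with integer frequency is an integer translation, and the
  multipliers that keep \<open>T\<close> inside \<open>S\<close> are closed under bounded pointwise limits, since \<open>S\<close> is
  closed; hence all bounded periodic multipliers are among them.
\<close>
lemma bounded_multiplier_in_closed_si:
  fixes S :: "'d::finite distr set"
  assumes S: "closed_shift_invariant s S" and T: "T \<in> S" "has_fourier T F"
    and m: "m \<in> borel_measurable lebesgue" "periodic m" and K: "\<And>\<omega>. norm (m \<omega>) \<le> K"
  shows "\<exists>U\<in>S. has_fourier U (\<lambda>\<omega>. m \<omega> * F \<omega>)"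
proof -
  have sub: "distr.subspace S" and Ssob: "S \<subseteq> sobolev s"
    and tr: "\<And>a U. integer_vec a \<Longrightarrow> U \<in> S \<Longrightarrow> translate a U \<in> S"
    using S unfolding closed_shift_invariant_def integer_vec_def by auto
  have Fm: "F \<in> borel_measurable lebesgue" by (rule has_fourierD(1)[OF T(2)])
  have FL: "weighted_L2 s F"
    using sobolevD[of T s] T Ssob by (intro weighted_L2_cong[OF _ fhat_AE[OF T(2)] Fm]) auto
  let ?M = "{m \<in> borel_measurable lebesgue. (\<exists>K. \<forall>\<omega>. norm (m \<omega>) \<le> K) \<and> (\<exists>U\<in>S. has_fourier U (\<lambda>\<omega>. m \<omega> * F \<omega>))}"
  have "bounded_limit_closed ?M"
    unfolding bounded_limit_closed_def
  proof (intro conjI ballI allI impI)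
    fix f g assume f: "f \<in> ?M" and g: "g \<in> ?M"
    from f obtain K U where K: "\<And>x. norm (f x) \<le> K" and U: "U \<in> S" "has_fourier U (\<lambda>\<omega>. f \<omega> * F \<omega>)" by auto
    from g obtain L V where L: "\<And>x. norm (g x) \<le> L" and V: "V \<in> S" "has_fourier V (\<lambda>\<omega>. g \<omega> * F \<omega>)" by auto
    have "norm (f x + g x) \<le> K + L" for x using norm_triangle_ineq[of "f x" "g x"] K[of x] L[of x] by linarith
    moreover have "U + V \<in> S" using U V sub by (simp add: distr.subspace_add)
    moreover have "has_fourier (U + V) (\<lambda>\<omega>. (f \<omega> + g \<omega>) * F \<omega>)"
      using has_fourier_add[OF U(2) V(2)] by (simp add: distrib_right)
    ultimately show "(\<lambda>x. f x + g x) \<in> ?M" using f g by auto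
  next
    fix f c assume f: "f \<in> ?M"
    from f obtain K U where K: "\<And>x. norm (f x) \<le> K" and U: "U \<in> S" "has_fourier U (\<lambda>\<omega>. f \<omega> * F \<omega>)" by auto
    have "norm (c * f x) \<le> norm c * K" for x unfolding norm_mult by (intro mult_left_mono K) auto
    moreover have "distr_scale c U \<in> S" using U sub by (simp add: distr.subspace_scale)
    moreover have "has_fourier (distr_scale c U) (\<lambda>\<omega>. (c * f \<omega>) * F \<omega>)"
      using has_fourier_scale[OF U(2)] by (simp add: mult.assoc)
    ultimately show "(\<lambda>x. c * f x) \<in> ?M" using f by auto
  next
    fix f :: "nat \<Rightarrow> real^'d \<Rightarrow> complex" and g K
    assume f: "\<forall>n. f n \<in> ?M" and K: "\<forall>n x. norm (f n x) \<le> K" and lim: "\<forall>x. (\<lambda>n. f n x) \<longlonglongrightarrow> g x"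
    have fm: "f n \<in> borel_measurable lebesgue" for n using f by blast
    have gm: "g \<in> borel_measurable lebesgue"
      using lim by (intro borel_measurable_LIMSEQ_metric[OF fm]) auto
    have gK: "norm (g x) \<le> K" for x
      using lim K by (intro Lim_bounded[OF tendsto_norm[of "\<lambda>n. f n x" "g x"], of 0 K]) auto
    have gFm: "(\<lambda>\<omega>. g \<omega> * F \<omega>) \<in> borel_measurable lebesgue" using gm Fm by (rule borel_measurable_times)
    have "weighted_L2 s (\<lambda>\<omega>. g \<omega> * F \<omega>)"
      by (rule weighted_L2_bound[OF FL gFm, of K]) (auto simp: norm_mult intro!: AE_I2 mult_right_mono gK)
    then obtain V where V: "V \<in> sobolev s" "has_fourier V (\<lambda>\<omega>. g \<omega> * F \<omega>)" by (rule sobolev_exists)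
    have "V \<in> S"
    proof (rule closed_si_dominated_limit[OF S V, where Fn="\<lambda>n \<omega>. f n \<omega> * F \<omega>" and G="\<lambda>\<omega>. of_real (2 * K) * F \<omega>"])
      show "\<exists>U\<in>S. has_fourier U (\<lambda>\<omega>. f n \<omega> * F \<omega>)" for n using f by blast
      show "AE \<omega> in lebesgue. (\<lambda>n. f n \<omega> * F \<omega>) \<longlonglongrightarrow> g \<omega> * F \<omega>"
        using lim by (intro AE_I2 tendsto_mult_right) auto
      show "AE \<omega> in lebesgue. norm (g \<omega> * F \<omega> - f n \<omega> * F \<omega>) \<le> norm (of_real (2 * K) * F \<omega>)" for n
      proof (rule AE_I2)
        fix \<omega>
        have "norm (g \<omega> - f n \<omega>) \<le> 2 * K"
          using norm_triangle_ineq4[of "g \<omega>" "f n \<omega>"] gK[of \<omega>] K[rule_format, of n \<omega>] by linarith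
        then have "norm ((g \<omega> - f n \<omega>) * F \<omega>) \<le> norm (complex_of_real (2 * K) * F \<omega>)"
          unfolding norm_mult norm_of_real by (intro mult_right_mono) auto
        then show "norm (g \<omega> * F \<omega> - f n \<omega> * F \<omega>) \<le> norm (of_real (2 * K) * F \<omega>)"
          by (simp only: left_diff_distrib)
      qed
    qed (rule weighted_L2_cmult[OF FL])
    with V(2) gm gK show "g \<in> ?M" by blast
  qed
  moreover have "expi a \<in> ?M" if a: "integer_vec a" for a
  proof -
    have "translate (- a) T \<in> S" using a T(1) by (intro tr) (auto simp: integer_vec_def)
    moreover have "has_fourier (translate (- a) T) (\<lambda>\<omega>. expi a \<omega> * F \<omega>)"
      using has_fourier_translate[OF T(2), of "- a"] by simp
    ultimately show ?thesis
      by (auto intro!: borel_measurable_lebesgue_continuous continuous_intros exI[of _ 1])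
  qed
  ultimately have "\<exists>g\<in>?M. AE \<omega> in lebesgue. m \<omega> = g \<omega>"
    by (rule periodic_in_closed) (use m K in auto)
  then obtain g U where g: "AE \<omega> in lebesgue. m \<omega> = g \<omega>" and U: "U \<in> S" "has_fourier U (\<lambda>\<omega>. g \<omega> * F \<omega>)" by auto
  have "has_fourier U (\<lambda>\<omega>. m \<omega> * F \<omega>)"
  proof (rule has_fourier_cong[OF U(2)])
    show "AE \<omega> in lebesgue. g \<omega> * F \<omega> = m \<omega> * F \<omega>" using g by eventually_elim simp
    show "(\<lambda>\<omega>. m \<omega> * F \<omega>) \<in> borel_measurable lebesgue" by (rule borel_measurable_times[OF m(1) Fm])
  qed
  with U(1) show ?thesis by blast
qed

text \<open>
  Truncating the multiplier where it is large reduces this to bounded multipliers.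
\<close>
lemma multiplier_in_closed_si:
  fixes S :: "'d::finite distr set"
  assumes S: "closed_shift_invariant s S" and T: "T \<in> S" "has_fourier T F"
    and m: "m \<in> borel_measurable lebesgue" "periodic m"
    and U: "U \<in> sobolev s" "has_fourier U (\<lambda>\<omega>. m \<omega> * F \<omega>)"
  shows "U \<in> S"
proof -
  define mn where "mn n \<omega> = (if norm (m \<omega>) \<le> real n then m \<omega> else 0)" for n :: nat and \<omega>
  have UL: "weighted_L2 s (\<lambda>\<omega>. m \<omega> * F \<omega>)"
    using sobolevD[OF U(1)] by (intro weighted_L2_cong[OF _ fhat_AE[OF U(2)] has_fourierD(1)[OF U(2)]]) auto
  show ?thesis
  proof (rule closed_si_dominated_limit[OF S U, where Fn="\<lambda>n \<omega>. mn n \<omega> * F \<omega>", OF _ _ _ UL])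
    show "\<exists>V\<in>S. has_fourier V (\<lambda>\<omega>. mn n \<omega> * F \<omega>)" for n
    proof (rule bounded_multiplier_in_closed_si[OF S T])
      show "mn n \<in> borel_measurable lebesgue"
        unfolding mn_def[abs_def] using m(1) by measurable
      show "periodic (mn n)" using m(2) unfolding periodic_def mn_def by auto
      show "norm (mn n \<omega>) \<le> real n" for \<omega> unfolding mn_def by simp
    qed
    show "AE \<omega> in lebesgue. (\<lambda>n. mn n \<omega> * F \<omega>) \<longlonglongrightarrow> m \<omega> * F \<omega>"
    proof (intro AE_I2 tendsto_mult_right tendsto_eventually)
      fix \<omega>
      obtain N where "norm (m \<omega>) \<le> real N" using real_arch_simple by blast
      then show "\<forall>\<^sub>F n in sequentially. mn n \<omega> = m \<omega>"
        unfolding mn_def by (intro eventually_sequentiallyI[of N]) auto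
    qed
    show "AE \<omega> in lebesgue. norm (m \<omega> * F \<omega> - mn n \<omega> * F \<omega>) \<le> norm (m \<omega> * F \<omega>)" for n
      unfolding mn_def by (intro AE_I2) auto
  qed
qed

section \<open>The dual lattice and periodization\<close>

lemma dual_lattice_0 [simp]: "0 \<in> dual_lattice"
  unfolding dual_lattice_def by (auto intro: exI[of _ 0])

lemma dual_lattice_add: "\<alpha> \<in> dual_lattice \<Longrightarrow> \<beta> \<in> dual_lattice \<Longrightarrow> \<alpha> + \<beta> \<in> dual_lattice"
  unfolding dual_lattice_def
proof (safe, simp)
  fix i assume "\<forall>i. \<exists>n::int. \<alpha> $ i = 2 * pi * of_int n" "\<forall>i. \<exists>n::int. \<beta> $ i = 2 * pi * of_int n"
  then obtain m n :: int where "\<alpha> $ i = 2 * pi * of_int m" "\<beta> $ i = 2 * pi * of_int n" by blast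
  then show "\<exists>n::int. \<alpha> $ i + \<beta> $ i = 2 * pi * of_int n"
    by (intro exI[of _ "m + n"]) (simp add: algebra_simps)
qed

lemma dual_lattice_uminus: "\<alpha> \<in> dual_lattice \<Longrightarrow> - \<alpha> \<in> dual_lattice"
  unfolding dual_lattice_def
proof (safe, simp)
  fix i assume "\<forall>i. \<exists>n::int. \<alpha> $ i = 2 * pi * of_int n"
  then obtain m :: int where "\<alpha> $ i = 2 * pi * of_int m" by blast
  then show "\<exists>n::int. - \<alpha> $ i = 2 * pi * of_int n"
    by (intro exI[of _ "- m"]) simp
qed

lemma dual_lattice_diff: "\<alpha> \<in> dual_lattice \<Longrightarrow> \<beta> \<in> dual_lattice \<Longrightarrow> \<alpha> - \<beta> \<in> dual_lattice"
  using dual_lattice_add[of \<alpha> "- \<beta>"] dual_lattice_uminus[of \<beta>] by simp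

lemma norm_dual_lattice_ge:
  assumes "\<alpha> \<in> dual_lattice" "\<alpha> \<noteq> 0" shows "2 * pi \<le> norm \<alpha>"
proof -
  obtain i where i: "\<alpha> $ i \<noteq> 0" using assms(2) by (auto simp: vec_eq_iff)
  obtain n :: int where n: "\<alpha> $ i = 2 * pi * of_int n" using assms(1) unfolding dual_lattice_def by blast
  with i have "\<bar>n\<bar> \<ge> 1" by auto
  then have "1 \<le> \<bar>real_of_int n\<bar>" by linarith
  then have "2 * pi * 1 \<le> 2 * pi * \<bar>real_of_int n\<bar>" by (intro mult_left_mono) auto
  then have "2 * pi \<le> \<bar>\<alpha> $ i\<bar>" using n by (simp add: abs_mult)
  then show ?thesis using component_le_norm_cart[of \<alpha> i] by linarith
qed

lemma dual_lattice_close_unique: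
  assumes "\<alpha> \<in> dual_lattice" "\<beta> \<in> dual_lattice" "norm (\<omega> - \<alpha>) < 1" "norm (\<omega> - \<beta>) < 1"
  shows "\<alpha> = \<beta>"
proof (rule ccontr)
  assume "\<alpha> \<noteq> \<beta>"
  then have "2 * pi \<le> norm (\<alpha> - \<beta>)" using assms by (intro norm_dual_lattice_ge dual_lattice_diff) auto
  also have "\<dots> \<le> norm (\<omega> - \<beta>) + norm (\<omega> - \<alpha>)"
    using norm_triangle_ineq4[of "\<omega> - \<beta>" "\<omega> - \<alpha>"] by simp
  finally show False using assms(3,4) pi_ge_two by linarith
qed

text \<open>
  An enumeration without repetition, so that sums over the nonzero dual lattice points become
  series to which monotone convergence applies.
\<close>
definition lat :: "nat \<Rightarrow> real^'d::finite" where
  "lat = from_nat_into (dual_lattice - {0})"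

lemma bij_betw_lat: "bij_betw (lat :: nat \<Rightarrow> real^'d::finite) UNIV (dual_lattice - {0})"
  unfolding lat_def
proof (rule bij_betw_from_nat_into)
  show "countable (dual_lattice - {0} :: (real^'d) set)" using countable_dual_lattice by (rule countable_Diff)
  have "infinite ((\<lambda>n::nat. axis (undefined::'d) (2 * pi * real (Suc n)) :: real^'d) ` UNIV)"
    by (rule range_inj_infinite) (auto simp: inj_def axis_eq_axis)
  moreover have "(\<lambda>n::nat. axis (undefined::'d) (2 * pi * real (Suc n)) :: real^'d) ` UNIV \<subseteq> dual_lattice - {0}"
  proof (rule image_subsetI)
    fix n :: nat
    let ?a = "axis (undefined::'d) (2 * pi * real (Suc n)) :: real^'d"
    have "\<exists>m::int. ?a $ i = 2 * pi * of_int m" for i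
      by (cases "i = undefined") (auto simp: axis_def intro: exI[of _ "int (Suc n)"] exI[of _ 0])
    moreover have "?a \<noteq> 0" by (simp add: axis_eq_0_iff del: of_nat_Suc)
    ultimately show "?a \<in> dual_lattice - {0}" unfolding dual_lattice_def by blast
  qed
  ultimately show "infinite (dual_lattice - {0} :: (real^'d) set)" using finite_subset by blast
qed

lemma lat_in: "lat n \<in> dual_lattice" "lat n \<noteq> 0"
  using bij_betwE[OF bij_betw_lat] by auto

lemma lat_surj: "\<alpha> \<in> dual_lattice \<Longrightarrow> \<alpha> \<noteq> 0 \<Longrightarrow> \<exists>n. lat n = \<alpha>"
  using bij_betw_imp_surj_on[OF bij_betw_lat] by (metis DiffI empty_iff imageE insertE)

text \<open>
  For \<open>\<rho> \<le> 1\<close> the balls of radius \<open>\<rho>\<close> around the dual lattice points are disjoint and the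
  chosen lattice point is the only candidate; between the balls the value is zero.
\<close>
definition periodize :: "real \<Rightarrow> (real^'d::finite \<Rightarrow> 'b::zero) \<Rightarrow> real^'d \<Rightarrow> 'b" where
  "periodize \<rho> u \<omega> = (if \<exists>\<alpha>\<in>dual_lattice. norm (\<omega> - \<alpha>) < \<rho>
     then u (\<omega> - (SOME \<alpha>. \<alpha> \<in> dual_lattice \<and> norm (\<omega> - \<alpha>) < \<rho>)) else 0)"

lemma periodize_eq:
  assumes "\<alpha> \<in> dual_lattice" "norm (\<omega> - \<alpha>) < \<rho>" "\<rho> \<le> 1"
  shows "periodize \<rho> u \<omega> = u (\<omega> - \<alpha>)"
proof -
  have "(SOME \<alpha>. \<alpha> \<in> dual_lattice \<and> norm (\<omega> - \<alpha>) < \<rho>) = \<alpha>"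
    using assms by (intro some_equality) (auto intro: dual_lattice_close_unique[of _ _ \<omega>])
  then show ?thesis unfolding periodize_def using assms by auto
qed

lemma periodize_eq_0: "(\<And>\<alpha>. \<alpha> \<in> dual_lattice \<Longrightarrow> \<rho> \<le> norm (\<omega> - \<alpha>)) \<Longrightarrow> periodize \<rho> u \<omega> = 0"
  unfolding periodize_def by fastforce

lemma periodic_periodize:
  assumes "\<rho> \<le> 1" shows "periodic (periodize \<rho> u)"
  unfolding periodic_def
proof (intro allI ballI)
  fix \<omega> \<beta> :: "real^'a" assume \<beta>: "\<beta> \<in> dual_lattice"
  show "periodize \<rho> u (\<omega> + \<beta>) = periodize \<rho> u \<omega>"
  proof (cases "\<exists>\<alpha>\<in>dual_lattice. norm (\<omega> - \<alpha>) < \<rho>")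
    case True
    then obtain \<alpha> where \<alpha>: "\<alpha> \<in> dual_lattice" "norm (\<omega> - \<alpha>) < \<rho>" by blast
    then show ?thesis
      using periodize_eq[of "\<alpha> + \<beta>" "\<omega> + \<beta>" \<rho> u] periodize_eq[of \<alpha> \<omega> \<rho> u] \<beta> assms
      by (simp add: dual_lattice_add)
  next
    case False
    then have 1: "periodize \<rho> u \<omega> = 0" by (intro periodize_eq_0) (auto simp: not_less)
    have "\<rho> \<le> norm (\<omega> + \<beta> - \<alpha>)" if "\<alpha> \<in> dual_lattice" for \<alpha>
    proof -
      have "\<rho> \<le> norm (\<omega> - (\<alpha> - \<beta>))" using False dual_lattice_diff[OF that \<beta>] by (auto simp: not_less)
      then show ?thesis by (simp add: algebra_simps)
    qed
    then have "periodize \<rho> u (\<omega> + \<beta>) = 0" by (intro periodize_eq_0)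
    with 1 show ?thesis by simp
  qed
qed

lemma borel_measurable_periodize:
  fixes u :: "real^'d::finite \<Rightarrow> 'b::euclidean_space"
  assumes \<rho>: "\<rho> \<le> 1" and u: "(\<lambda>\<omega>. if norm \<omega> < \<rho> then u \<omega> else 0) \<in> borel_measurable lebesgue"
  shows "periodize \<rho> u \<in> borel_measurable lebesgue"
proof -
  let ?u = "\<lambda>\<omega>. if norm \<omega> < \<rho> then u \<omega> else 0"
  have "periodize \<rho> u \<omega> = ?u \<omega> + (\<Sum>n. ?u (\<omega> - lat n))" for \<omega>
  proof (cases "\<exists>\<alpha>\<in>dual_lattice. norm (\<omega> - \<alpha>) < \<rho>")
    case True
    then obtain \<alpha> where \<alpha>: "\<alpha> \<in> dual_lattice" "norm (\<omega> - \<alpha>) < \<rho>" by blast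
    have uniq: "\<beta> = \<alpha>" if "\<beta> \<in> dual_lattice" "norm (\<omega> - \<beta>) < \<rho>" for \<beta>
      using that \<alpha> \<rho> by (intro dual_lattice_close_unique[of _ _ \<omega>]) auto
    show ?thesis
    proof (cases "\<alpha> = 0")
      case True
      have "?u (\<omega> - lat n) = 0" for n using uniq[of "lat n"] lat_in[of n] True by auto
      then show ?thesis using periodize_eq[OF \<alpha> \<rho>] \<alpha> True by simp
    next
      case False
      then obtain n where n: "lat n = \<alpha>" using lat_surj \<alpha> by blast
      have "?u (\<omega> - lat j) = 0" if "j \<noteq> n" for j
        using uniq[of "lat j"] lat_in(1)[of j] that n bij_betw_imp_inj_on[OF bij_betw_lat] by (auto dest: injD)
      then have "(\<Sum>j. ?u (\<omega> - lat j)) = (\<Sum>j\<in>{n}. ?u (\<omega> - lat j))"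
        by (intro suminf_finite) auto
      moreover have "?u \<omega> = 0" using uniq[of 0] False by auto
      ultimately show ?thesis using periodize_eq[OF \<alpha> \<rho>] \<alpha> n by simp
    qed
  next
    case False
    then have 1: "periodize \<rho> u \<omega> = 0" by (intro periodize_eq_0) (auto simp: not_less)
    have "?u (\<omega> - lat n) = 0" for n using False lat_in(1)[of n] by auto
    moreover have "?u \<omega> = 0" using False bspec[of dual_lattice "\<lambda>\<alpha>. \<not> norm (\<omega> - \<alpha>) < \<rho>" 0] by auto
    ultimately show ?thesis using 1 by simp
  qed
  then have "periodize \<rho> u = (\<lambda>\<omega>. ?u \<omega> + (\<Sum>n. ?u (\<omega> - lat n)))" by blast
  also have "\<dots> \<in> borel_measurable lebesgue"
    using borel_measurable_lebesgue_translate[OF u, of "- lat _", unfolded add_uminus_conv_diff]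
    by (intro borel_measurable_add u borel_measurable_suminf)
  finally show ?thesis .
qed

section \<open>Approximation order from a single superfunction\<close>

text \<open>
  At frequencies \<open>x / h\<close> with \<open>x \<ge> 1 \<ge> h\<close>, which is where the translates of the ball around
  the origin lie, the Sobolev weight is at most a multiple of the homogeneous one.
\<close>
lemma weight_near_lattice_le:
  fixes x h s :: real
  assumes x: "1 \<le> x" and h: "0 < h" "h \<le> 1"
  shows "(1 + x / h) powr (2 * s) \<le> (1 + 2 powr (2 * s)) * (h powr (- 2 * s) * x powr (2 * s))"
proof -
  define q where "q = (h + x) / x"
  have q: "1 \<le> q" "q \<le> 2" using x h unfolding q_def by (auto simp: field_simps)
  have "q powr (2 * s) \<le> 1 + 2 powr (2 * s)"
  proof (cases "s \<ge> 0")
    case True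
    then have "q powr (2 * s) \<le> 2 powr (2 * s)" using q by (intro powr_mono2) auto
    then show ?thesis by simp
  next
    case False
    then have "q powr (2 * s) \<le> 1 powr (2 * s)" using q by (intro powr_mono2') auto
    then show ?thesis by (simp add: add_increasing2)
  qed
  moreover have "(1 + x / h) powr (2 * s) = q powr (2 * s) * (h powr (- 2 * s) * x powr (2 * s))"
  proof -
    have "1 + x / h = q * (x / h)" using x h unfolding q_def by (simp add: field_simps)
    then have "(1 + x / h) powr (2 * s) = q powr (2 * s) * (x powr (2 * s) / h powr (2 * s))"
      using q x h by (simp add: powr_mult powr_divide)
    then show ?thesis by (simp add: powr_minus field_simps)
  qed
  ultimately show ?thesis by (simp add: mult_right_mono)
qed

text \<open>
  The truncated Gramian of a single function, as an extended nonnegative number, so that it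
  has a meaning also where the series diverges.
\<close>
definition lattice_tail :: "real \<Rightarrow> (real^'d::finite \<Rightarrow> complex) \<Rightarrow> real^'d \<Rightarrow> ennreal" where
  "lattice_tail s \<Psi> \<omega> = (\<Sum>n. ennreal (norm (\<omega> + lat n) powr (2 * s) * (norm (\<Psi> (\<omega> + lat n)))\<^sup>2))"

text \<open>
  The approximant \<open>m \<Psi>\<close> reproduces \<open>fh\<close> in the dilated ball around the origin. What remains
  is \<open>fh\<close> outside that ball, where the weight of order \<open>s\<close> is at most a multiple
  of \<open>h powr (2 k - 2 s)\<close> times that of order \<open>k\<close>, and the copies of \<open>fh\<close> that \<open>\<Psi>\<close> produces around the other lattice
  points. Shifted back to the origin, the latter sum up to the lattice tail of \<open>\<Psi>\<close> divided by
  \<open>|\<Psi>|\<^sup>2\<close>, and the factor \<open>|h \<omega>| powr (2 k)\<close> in its bound yields the required power of \<open>h\<close>.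
\<close>
lemma superfunction_error:
  fixes \<Psi> fh :: "real^'d::finite \<Rightarrow> complex"
  assumes sk: "s < k" "0 \<le> k"
    and \<Psi>: "\<Psi> \<in> borel_measurable lebesgue" and fh: "weighted_L2 k fh"
    and \<rho>: "0 < \<rho>" "\<rho> \<le> 1" and C: "0 \<le> C"
    and near: "AE \<omega> in lebesgue. norm \<omega> < \<rho> \<longrightarrow> \<Psi> \<omega> \<noteq> 0 \<and>
      lattice_tail s \<Psi> \<omega> \<le> ennreal (C * norm \<omega> powr (2 * k) * (norm (\<Psi> \<omega>))\<^sup>2)"
    and h: "0 < h" "h \<le> 1"
  defines "m \<equiv> periodize \<rho> (\<lambda>\<xi>. fh (inverse h *\<^sub>R \<xi>) / \<Psi> \<xi>)"
  defines "e \<equiv> (\<lambda>\<omega>. fh \<omega> - m (h *\<^sub>R \<omega>) * \<Psi> (h *\<^sub>R \<omega>))"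
  shows "weighted_L2 s e"
    and "(\<integral>\<omega>. weight s \<omega> * (norm (e \<omega>))\<^sup>2 \<partial>lebesgue)
      \<le> (2 * \<rho> powr (2 * s - 2 * k) + 2 * (1 + 2 powr (2 * s)) * C) * h powr (2 * k - 2 * s)
        * (\<integral>\<omega>. weight k \<omega> * (norm (fh \<omega>))\<^sup>2 \<partial>lebesgue)"
    and "m \<in> borel_measurable lebesgue"
proof -
  define W where "W t \<omega> = weight t \<omega>" for t and \<omega> :: "real^'d"
  have [measurable]: "W t \<in> borel_measurable lebesgue" for t unfolding W_def[abs_def] by (rule measurable_weight)
  have W0 [simp]: "0 \<le> W t \<omega>" for t \<omega> unfolding W_def by simp
  have fm: "fh \<in> borel_measurable lebesgue" and fi: "integrable lebesgue (\<lambda>\<omega>. W k \<omega> * (norm (fh \<omega>))\<^sup>2)"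
    using fh unfolding weighted_L2_def W_def by auto
  note [measurable] = fm \<Psi>
  have meas: "(\<lambda>\<omega>. g (a + c *\<^sub>R \<omega>)) \<in> borel_measurable lebesgue"
    if "g \<in> borel_measurable lebesgue" "c \<noteq> 0" for g :: "real^'d \<Rightarrow> complex" and a c
    by (rule borel_measurable_lebesgue_affine[OF that])
  have normm[measurable]: "(\<lambda>\<omega>::real^'d. norm (a + c *\<^sub>R \<omega>)) \<in> borel_measurable lebesgue" for a c
    by (intro borel_measurable_lebesgue_continuous continuous_intros)
  have [measurable]: "(\<lambda>\<omega>::real^'d. \<omega>) \<in> borel_measurable lebesgue"
    by (intro borel_measurable_lebesgue_continuous continuous_intros)
  show m[measurable]: "m \<in> borel_measurable lebesgue"
    unfolding m_def
  proof (rule borel_measurable_periodize[OF \<rho>(2)])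
    have [measurable]: "(\<lambda>\<xi>. fh (inverse h *\<^sub>R \<xi>)) \<in> borel_measurable lebesgue"
      using meas[OF fm, of "inverse h" 0] h by simp
    show "(\<lambda>\<xi>. if norm \<xi> < \<rho> then fh (inverse h *\<^sub>R \<xi>) / \<Psi> \<xi> else 0) \<in> borel_measurable lebesgue"
      by measurable
  qed
  have [measurable]: "(\<lambda>\<omega>. \<Psi> (h *\<^sub>R \<omega>)) \<in> borel_measurable lebesgue" "(\<lambda>\<omega>. m (h *\<^sub>R \<omega>)) \<in> borel_measurable lebesgue"
    using meas[OF \<Psi>, of h 0] meas[OF m, of h 0] h by simp_all
  have em[measurable]: "e \<in> borel_measurable lebesgue" unfolding e_def by measurable

  \<comment> \<open>the part of \<open>fh\<close> outside the ball, and the aliases of the part inside\<close>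
  define A where "A \<omega> = (if \<rho> \<le> norm (h *\<^sub>R \<omega>) then (norm (fh \<omega>))\<^sup>2 else 0)" for \<omega>
  define B where "B n \<omega> = (if norm (h *\<^sub>R \<omega> - lat n) < \<rho>
    then (norm (fh (\<omega> - inverse h *\<^sub>R lat n) * \<Psi> (h *\<^sub>R \<omega>) / \<Psi> (h *\<^sub>R \<omega> - lat n)))\<^sup>2 else 0)" for n \<omega>
  have [measurable]: "(\<lambda>\<omega>. fh (\<omega> - inverse h *\<^sub>R lat n)) \<in> borel_measurable lebesgue"
    "(\<lambda>\<omega>. \<Psi> (h *\<^sub>R \<omega> - lat n)) \<in> borel_measurable lebesgue"
    for n
    using meas[OF fm, of 1 "- (inverse h *\<^sub>R lat n)"] meas[OF \<Psi>, of h "- lat n"] h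
    by (simp_all add: algebra_simps)
  have [measurable]: "(\<lambda>\<omega>::real^'d. norm (h *\<^sub>R \<omega> - lat n)) \<in> borel_measurable lebesgue"
    "(\<lambda>\<omega>::real^'d. norm (h *\<^sub>R \<omega>)) \<in> borel_measurable lebesgue" for n
    by (intro borel_measurable_lebesgue_continuous continuous_intros)+
  have [measurable]: "A \<in> borel_measurable lebesgue" unfolding A_def[abs_def] by measurable
  have [measurable]: "B n \<in> borel_measurable lebesgue" for n unfolding B_def[abs_def] by measurable
  have A0: "0 \<le> A \<omega>" and B0: "0 \<le> B n \<omega>" for \<omega> n unfolding A_def B_def by auto

  have near_h: "AE \<omega> in lebesgue. norm (h *\<^sub>R \<omega>) < \<rho> \<longrightarrow> \<Psi> (h *\<^sub>R \<omega>) \<noteq> 0 \<and>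
      lattice_tail s \<Psi> (h *\<^sub>R \<omega>) \<le> ennreal (C * norm (h *\<^sub>R \<omega>) powr (2 * k) * (norm (\<Psi> (h *\<^sub>R \<omega>)))\<^sup>2)"
    using AE_lebesgue_affine[OF near, of h 0] h by simp

  have pointwise: "AE \<omega> in lebesgue. ennreal ((norm (e \<omega>))\<^sup>2) \<le> 2 * (ennreal (A \<omega>) + (\<Sum>n. ennreal (B n \<omega>)))"
    using near_h
  proof eventually_elim
    case (elim \<omega>)
    have scale: "inverse h *\<^sub>R (h *\<^sub>R \<omega> - \<alpha>) = \<omega> - inverse h *\<^sub>R \<alpha>" for \<alpha>
      using h by (simp add: scaleR_diff_right)
    consider (origin) "norm (h *\<^sub>R \<omega>) < \<rho>"
      | (shifted) n where "norm (h *\<^sub>R \<omega> - lat n) < \<rho>" "\<rho> \<le> norm (h *\<^sub>R \<omega>)"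
      | (far) "\<rho> \<le> norm (h *\<^sub>R \<omega>)" "\<And>n. \<rho> \<le> norm (h *\<^sub>R \<omega> - lat n)"
      by (meson not_less)
    then show ?case
    proof cases
      case origin
      then have "m (h *\<^sub>R \<omega>) = fh \<omega> / \<Psi> (h *\<^sub>R \<omega>)"
        unfolding m_def using periodize_eq[of 0 "h *\<^sub>R \<omega>" \<rho> "\<lambda>\<xi>. fh (inverse h *\<^sub>R \<xi>) / \<Psi> \<xi>"] \<rho> h by simp
      then have "e \<omega> = 0" unfolding e_def using elim origin by simp
      then show ?thesis by simp
    next
      case (shifted n)
      have "m (h *\<^sub>R \<omega>) = fh (\<omega> - inverse h *\<^sub>R lat n) / \<Psi> (h *\<^sub>R \<omega> - lat n)"
        unfolding m_def using periodize_eq[OF lat_in(1) shifted(1) \<rho>(2), of "\<lambda>\<xi>. fh (inverse h *\<^sub>R \<xi>) / \<Psi> \<xi>"] scale by simp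
      then have e: "e \<omega> = fh \<omega> - fh (\<omega> - inverse h *\<^sub>R lat n) * \<Psi> (h *\<^sub>R \<omega>) / \<Psi> (h *\<^sub>R \<omega> - lat n)" (is "_ = _ - ?b")
        unfolding e_def by simp
      have "(norm (e \<omega>))\<^sup>2 \<le> (norm (fh \<omega>) + norm ?b)\<^sup>2"
        unfolding e by (intro power_mono norm_triangle_ineq4) auto
      also have "\<dots> \<le> 2 * (norm (fh \<omega>))\<^sup>2 + 2 * (norm ?b)\<^sup>2"
        using zero_le_power2[of "norm (fh \<omega>) - norm ?b"] by (simp add: power2_eq_square algebra_simps)
      also have "\<dots> = 2 * (A \<omega> + B n \<omega>)" unfolding A_def B_def using shifted by simp
      finally have "ennreal ((norm (e \<omega>))\<^sup>2) \<le> ennreal (2 * (A \<omega> + B n \<omega>))" by (rule ennreal_leI)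
      also have "\<dots> = 2 * (ennreal (A \<omega>) + ennreal (B n \<omega>))"
        using A0 B0 by (simp add: ennreal_mult ennreal_plus)
      also have "ennreal (B n \<omega>) = sum (\<lambda>n. ennreal (B n \<omega>)) {n}" by simp
      also have "\<dots> \<le> (\<Sum>n. ennreal (B n \<omega>))"
        by (rule sum_le_suminf[OF summableI]) auto
      finally show ?thesis by (simp add: mult_left_mono add_left_mono)
    next
      case far
      have "\<rho> \<le> norm (h *\<^sub>R \<omega> - \<alpha>)" if "\<alpha> \<in> dual_lattice" for \<alpha>
        using far lat_surj[OF that] by (cases "\<alpha> = 0") auto
      then have "m (h *\<^sub>R \<omega>) = 0" unfolding m_def by (rule periodize_eq_0)
      then have "(norm (e \<omega>))\<^sup>2 \<le> 2 * A \<omega>" unfolding e_def A_def using far by simp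
      then have "ennreal ((norm (e \<omega>))\<^sup>2) \<le> 2 * ennreal (A \<omega>)"
        using A0[of \<omega>] by (metis ennreal_leI ennreal_mult' ennreal_numeral zero_le_numeral)
      also have "\<dots> \<le> 2 * (ennreal (A \<omega>) + (\<Sum>n. ennreal (B n \<omega>)))"
        by (intro mult_left_mono) auto
      finally show ?thesis .
    qed
  qed

  let ?N = "\<integral>\<^sup>+\<omega>. ennreal (W k \<omega> * (norm (fh \<omega>))\<^sup>2) \<partial>lebesgue"
  let ?hp = "h powr (2 * k - 2 * s)"
  have A_int: "(\<integral>\<^sup>+\<omega>. ennreal (W s \<omega> * A \<omega>) \<partial>lebesgue) \<le> ennreal (\<rho> powr (2 * s - 2 * k) * ?hp) * ?N"
  proof -
    have "W s \<omega> * A \<omega> \<le> (\<rho> powr (2 * s - 2 * k) * ?hp) * (W k \<omega> * (norm (fh \<omega>))\<^sup>2)" for \<omega>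
    proof (cases "\<rho> \<le> norm (h *\<^sub>R \<omega>)")
      case True
      then have "\<rho> / h \<le> 1 + norm \<omega>" using h by (simp add: field_simps)
      then have "(1 + norm \<omega>) powr (2 * s - 2 * k) \<le> (\<rho> / h) powr (2 * s - 2 * k)"
        using sk \<rho> h by (intro powr_mono2') auto
      also have "\<dots> = \<rho> powr (2 * s - 2 * k) * ?hp"
      proof -
        have "(\<rho> / h) powr (2 * s - 2 * k) = \<rho> powr (2 * s - 2 * k) / h powr (- (2 * k - 2 * s))"
          using \<rho> h by (simp add: powr_divide)
        then show ?thesis by (simp only: powr_minus) (simp add: field_simps)
      qed
      finally have "(1 + norm \<omega>) powr (2 * s - 2 * k) * (W k \<omega> * (norm (fh \<omega>))\<^sup>2)
        \<le> (\<rho> powr (2 * s - 2 * k) * ?hp) * (W k \<omega> * (norm (fh \<omega>))\<^sup>2)"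
        by (intro mult_right_mono) auto
      moreover have "(1 + norm \<omega>) powr (2 * s - 2 * k) * W k \<omega> = W s \<omega>"
        by (simp add: W_def powr_add[symmetric])
      ultimately show ?thesis unfolding A_def using True by (simp add: mult.assoc[symmetric])
    qed (simp add: A_def)
    then have "(\<integral>\<^sup>+\<omega>. ennreal (W s \<omega> * A \<omega>) \<partial>lebesgue)
        \<le> (\<integral>\<^sup>+\<omega>. ennreal (\<rho> powr (2 * s - 2 * k) * ?hp) * ennreal (W k \<omega> * (norm (fh \<omega>))\<^sup>2) \<partial>lebesgue)"
      by (intro nn_integral_mono) (simp add: ennreal_mult[symmetric] ennreal_leI)
    moreover have "(\<lambda>\<omega>. ennreal (W k \<omega> * (norm (fh \<omega>))\<^sup>2)) \<in> borel_measurable lebesgue" by measurable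
    ultimately show ?thesis by (simp add: nn_integral_cmult)
  qed

  let ?K = "1 + 2 powr (2 * s)"
  define c where "c \<eta> = (if norm (h *\<^sub>R \<eta>) < \<rho>
    then ?K * h powr (- 2 * s) * ((norm (fh \<eta>))\<^sup>2 / (norm (\<Psi> (h *\<^sub>R \<eta>)))\<^sup>2) else 0)" for \<eta>
  have c0: "0 \<le> c \<eta>" for \<eta> unfolding c_def by simp
  have B_int: "(\<Sum>n. \<integral>\<^sup>+\<omega>. ennreal (W s \<omega> * B n \<omega>) \<partial>lebesgue) \<le> ennreal (?K * C * ?hp) * ?N"
  proof -
    let ?t = "\<lambda>n \<eta>. norm (h *\<^sub>R \<eta> + lat n) powr (2 * s) * (norm (\<Psi> (h *\<^sub>R \<eta> + lat n)))\<^sup>2"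
    have [measurable]: "(\<lambda>\<omega>. \<Psi> (h *\<^sub>R \<omega> + lat n)) \<in> borel_measurable lebesgue"
      "(\<lambda>\<omega>::real^'d. norm (h *\<^sub>R \<omega> + lat n)) \<in> borel_measurable lebesgue" for n
      using meas[OF \<Psi>, of h "lat n"] normm[of "lat n" h] h by (simp_all add: add.commute)
    have cm[measurable]: "c \<in> borel_measurable lebesgue" unfolding c_def[abs_def] by measurable
    have shift: "(\<integral>\<^sup>+\<omega>. ennreal (W s \<omega> * B n \<omega>) \<partial>lebesgue) \<le> (\<integral>\<^sup>+\<eta>. ennreal (c \<eta> * ?t n \<eta>) \<partial>lebesgue)" for n
    proof -
      let ?a = "inverse h *\<^sub>R lat n"
      have "(\<integral>\<^sup>+\<omega>. ennreal (W s \<omega> * B n \<omega>) \<partial>lebesgue) = (\<integral>\<^sup>+\<eta>. ennreal (W s (?a + \<eta>) * B n (?a + \<eta>)) \<partial>lebesgue)"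
      proof -
        have "(\<lambda>\<omega>. ennreal (W s \<omega> * B n \<omega>)) \<in> borel_measurable lebesgue" by measurable
        from nn_integral_lebesgue_affine[OF this, of 1 ?a] show ?thesis by simp
      qed
      also have "\<dots> \<le> (\<integral>\<^sup>+\<eta>. ennreal (c \<eta> * ?t n \<eta>) \<partial>lebesgue)"
      proof (intro nn_integral_mono ennreal_leI)
        fix \<eta> :: "real^'d"
        have arg: "h *\<^sub>R (?a + \<eta>) = h *\<^sub>R \<eta> + lat n" using h by (simp add: scaleR_add_right add.commute)
        show "W s (?a + \<eta>) * B n (?a + \<eta>) \<le> c \<eta> * ?t n \<eta>"
        proof (cases "norm (h *\<^sub>R \<eta>) < \<rho>")
          case True
          define x where "x = norm (h *\<^sub>R \<eta> + lat n)"
          have "norm (lat n :: real^'d) \<le> norm (h *\<^sub>R \<eta> + lat n) + norm (h *\<^sub>R \<eta>)"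
            using norm_triangle_ineq4[of "h *\<^sub>R \<eta> + lat n" "h *\<^sub>R \<eta>"] by simp
          moreover have "2 * pi \<le> norm (lat n :: real^'d)" by (rule norm_dual_lattice_ge[OF lat_in])
          ultimately have x: "1 \<le> x"
            using True \<rho> pi_ge_two unfolding x_def by linarith
          have "norm (?a + \<eta>) = x / h"
          proof -
            have "h * norm (?a + \<eta>) = x" unfolding x_def arg[symmetric] using h by simp
            then show ?thesis using h by (simp add: field_simps)
          qed
          then have W: "W s (?a + \<eta>) \<le> ?K * (h powr (- 2 * s) * x powr (2 * s))"
            using weight_near_lattice_le[OF x h] by (simp add: W_def)
          have "B n (?a + \<eta>) = (norm (fh \<eta>))\<^sup>2 / (norm (\<Psi> (h *\<^sub>R \<eta>)))\<^sup>2 * (norm (\<Psi> (h *\<^sub>R \<eta> + lat n)))\<^sup>2"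
            unfolding B_def arg using True by (simp add: norm_mult norm_divide power_mult_distrib power_divide)
          then show ?thesis using mult_right_mono[OF W B0[of n "?a + \<eta>"]] True unfolding c_def x_def
            by (simp add: mult_ac)
        qed (simp add: B_def c_def arg)
      qed
      finally show ?thesis .
    qed
    have "(\<Sum>n. \<integral>\<^sup>+\<omega>. ennreal (W s \<omega> * B n \<omega>) \<partial>lebesgue) \<le> (\<Sum>n. \<integral>\<^sup>+\<eta>. ennreal (c \<eta> * ?t n \<eta>) \<partial>lebesgue)"
      by (intro suminf_le shift summableI)
    also have "\<dots> = (\<integral>\<^sup>+\<eta>. (\<Sum>n. ennreal (c \<eta> * ?t n \<eta>)) \<partial>lebesgue)"
      by (rule nn_integral_suminf[symmetric]) measurable
    also have "\<dots> \<le> (\<integral>\<^sup>+\<eta>. ennreal (?K * C * ?hp) * ennreal (W k \<eta> * (norm (fh \<eta>))\<^sup>2) \<partial>lebesgue)"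
    proof (rule nn_integral_mono_AE)
      show "AE \<eta> in lebesgue. (\<Sum>n. ennreal (c \<eta> * ?t n \<eta>)) \<le> ennreal (?K * C * ?hp) * ennreal (W k \<eta> * (norm (fh \<eta>))\<^sup>2)"
        using near_h
      proof eventually_elim
        case (elim \<eta>)
        have sum: "(\<Sum>n. ennreal (c \<eta> * ?t n \<eta>)) = ennreal (c \<eta>) * lattice_tail s \<Psi> (h *\<^sub>R \<eta>)"
          unfolding lattice_tail_def using c0 by (simp add: ennreal_mult)
        show ?case
        proof (cases "norm (h *\<^sub>R \<eta>) < \<rho>")
          case True
          with elim have nz: "\<Psi> (h *\<^sub>R \<eta>) \<noteq> 0"
            and tail: "lattice_tail s \<Psi> (h *\<^sub>R \<eta>) \<le> ennreal (C * norm (h *\<^sub>R \<eta>) powr (2 * k) * (norm (\<Psi> (h *\<^sub>R \<eta>)))\<^sup>2)" by auto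
          have "(\<Sum>n. ennreal (c \<eta> * ?t n \<eta>)) \<le> ennreal (c \<eta>) * ennreal (C * norm (h *\<^sub>R \<eta>) powr (2 * k) * (norm (\<Psi> (h *\<^sub>R \<eta>)))\<^sup>2)"
            unfolding sum by (intro mult_left_mono tail) simp
          also have "\<dots> = ennreal (c \<eta> * (C * norm (h *\<^sub>R \<eta>) powr (2 * k) * (norm (\<Psi> (h *\<^sub>R \<eta>)))\<^sup>2))"
            using c0 C by (simp add: ennreal_mult)
          also have "\<dots> \<le> ennreal ((?K * C * ?hp) * (W k \<eta> * (norm (fh \<eta>))\<^sup>2))"
          proof (rule ennreal_leI)
            have "c \<eta> * (C * norm (h *\<^sub>R \<eta>) powr (2 * k) * (norm (\<Psi> (h *\<^sub>R \<eta>)))\<^sup>2)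
              = ?K * C * (h powr (- 2 * s) * (h powr (2 * k))) * (norm \<eta> powr (2 * k) * (norm (fh \<eta>))\<^sup>2)"
              unfolding c_def using True nz h by (simp add: powr_mult field_simps)
            also have "h powr (- 2 * s) * (h powr (2 * k)) = ?hp"
              by (simp add: powr_add[symmetric])
            also have "?K * C * ?hp * (norm \<eta> powr (2 * k) * (norm (fh \<eta>))\<^sup>2) \<le> ?K * C * ?hp * (W k \<eta> * (norm (fh \<eta>))\<^sup>2)"
              unfolding W_def using C sk by (intro mult_left_mono mult_right_mono powr_mono2) auto
            finally show "c \<eta> * (C * norm (h *\<^sub>R \<eta>) powr (2 * k) * (norm (\<Psi> (h *\<^sub>R \<eta>)))\<^sup>2)
              \<le> (?K * C * ?hp) * (W k \<eta> * (norm (fh \<eta>))\<^sup>2)" .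
          qed
          finally show ?thesis using C by (simp add: ennreal_mult)
        next
          case False
          then show ?thesis unfolding sum c_def by simp
        qed
      qed
    qed
    also have "\<dots> = ennreal (?K * C * ?hp) * ?N"
      by (rule nn_integral_cmult) measurable
    finally show ?thesis .
  qed

  have N: "?N = ennreal (\<integral>\<omega>. W k \<omega> * (norm (fh \<omega>))\<^sup>2 \<partial>lebesgue)" (is "_ = ennreal ?NN")
    by (rule nn_integral_eq_integral[OF fi]) auto
  have NN0: "?NN \<ge> 0" by (intro integral_nonneg_AE) auto
  have "(\<integral>\<^sup>+\<omega>. ennreal (W s \<omega> * (norm (e \<omega>))\<^sup>2) \<partial>lebesgue)
      \<le> (\<integral>\<^sup>+\<omega>. 2 * (ennreal (W s \<omega> * A \<omega>) + (\<Sum>n. ennreal (W s \<omega> * B n \<omega>))) \<partial>lebesgue)"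
  proof (rule nn_integral_mono_AE)
    show "AE \<omega> in lebesgue. ennreal (W s \<omega> * (norm (e \<omega>))\<^sup>2) \<le> 2 * (ennreal (W s \<omega> * A \<omega>) + (\<Sum>n. ennreal (W s \<omega> * B n \<omega>)))"
      using pointwise
    proof eventually_elim
      case (elim \<omega>)
      have "ennreal (W s \<omega> * (norm (e \<omega>))\<^sup>2) \<le> ennreal (W s \<omega>) * (2 * (ennreal (A \<omega>) + (\<Sum>n. ennreal (B n \<omega>))))"
        using elim by (simp add: ennreal_mult mult_left_mono)
      also have "\<dots> = 2 * (ennreal (W s \<omega> * A \<omega>) + (\<Sum>n. ennreal (W s \<omega> * B n \<omega>)))"
        using A0 B0 by (simp add: ennreal_mult distrib_left mult_ac)
      finally show ?case .
    qed
  qed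
  also have "\<dots> = 2 * ((\<integral>\<^sup>+\<omega>. ennreal (W s \<omega> * A \<omega>) \<partial>lebesgue) + (\<Sum>n. \<integral>\<^sup>+\<omega>. ennreal (W s \<omega> * B n \<omega>) \<partial>lebesgue))"
  proof -
    have m: "(\<lambda>\<omega>. ennreal (W s \<omega> * A \<omega>)) \<in> borel_measurable lebesgue"
      "(\<lambda>\<omega>. ennreal (W s \<omega> * B n \<omega>)) \<in> borel_measurable lebesgue" for n by measurable
    then have ms: "(\<lambda>\<omega>. \<Sum>n. ennreal (W s \<omega> * B n \<omega>)) \<in> borel_measurable lebesgue" by measurable
    show ?thesis
      by (simp only: nn_integral_cmult[OF borel_measurable_add[OF m(1) ms]] nn_integral_add[OF m(1) ms] nn_integral_suminf[OF m(2)])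
  qed
  also have "\<dots> \<le> 2 * (ennreal (\<rho> powr (2 * s - 2 * k) * ?hp) * ?N + ennreal (?K * C * ?hp) * ?N)"
    by (intro mult_left_mono add_mono A_int B_int) simp
  also have "\<dots> = ennreal ((2 * \<rho> powr (2 * s - 2 * k) + 2 * ?K * C) * ?hp * ?NN)"
  proof -
    have "(2 * \<rho> powr (2 * s - 2 * k) + 2 * ?K * C) * ?hp * ?NN
      = 2 * ((\<rho> powr (2 * s - 2 * k) * ?hp) * ?NN + (?K * C * ?hp) * ?NN)" by (simp add: algebra_simps)
    then show ?thesis unfolding N using C NN0
      by (simp add: ennreal_mult ennreal_plus)
  qed
  finally have main: "(\<integral>\<^sup>+\<omega>. ennreal (W s \<omega> * (norm (e \<omega>))\<^sup>2) \<partial>lebesgue)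
    \<le> ennreal ((2 * \<rho> powr (2 * s - 2 * k) + 2 * ?K * C) * ?hp * ?NN)" .
  have int: "integrable lebesgue (\<lambda>\<omega>. W s \<omega> * (norm (e \<omega>))\<^sup>2)"
  proof (rule integrableI_bounded)
    show "(\<integral>\<^sup>+\<omega>. ennreal (norm (W s \<omega> * (norm (e \<omega>))\<^sup>2)) \<partial>lebesgue) < \<infinity>"
      using le_less_trans[OF main ennreal_less_top] by (simp add: abs_mult)
  qed measurable
  then show "weighted_L2 s e" unfolding weighted_L2_def W_def using em by blast
  have "ennreal (\<integral>\<omega>. W s \<omega> * (norm (e \<omega>))\<^sup>2 \<partial>lebesgue)
    \<le> ennreal ((2 * \<rho> powr (2 * s - 2 * k) + 2 * ?K * C) * ?hp * ?NN)"
    using main by (subst nn_integral_eq_integral[OF int, symmetric]) auto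
  then have "(\<integral>\<omega>. W s \<omega> * (norm (e \<omega>))\<^sup>2 \<partial>lebesgue) \<le> (2 * \<rho> powr (2 * s - 2 * k) + 2 * ?K * C) * ?hp * ?NN"
    using C NN0 by (subst (asm) ennreal_le_iff) auto
  then show "(\<integral>\<omega>. weight s \<omega> * (norm (e \<omega>))\<^sup>2 \<partial>lebesgue)
      \<le> (2 * \<rho> powr (2 * s - 2 * k) + 2 * ?K * C) * ?hp
        * (\<integral>\<omega>. weight k \<omega> * (norm (fh \<omega>))\<^sup>2 \<partial>lebesgue)"
    unfolding W_def .
qed

lemma sobolev_norm_nonneg: "0 \<le> sobolev_norm s T"
  unfolding sobolev_norm_def by (intro real_sqrt_ge_zero integral_nonneg_AE) auto

lemma sobolev_norm_mono:
  assumes "T \<in> sobolev k" "s \<le> k" shows "sobolev_norm s T \<le> sobolev_norm k T"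
  unfolding sobolev_norm_def
  using sobolevD(3)[OF assms(1)] weighted_L2_mono[OF sobolevD(3)[OF assms(1)] assms(2)] assms(2)
  unfolding weighted_L2_def
  by (intro real_sqrt_le_mono integral_mono) (auto intro!: mult_right_mono powr_mono)

lemma zero_in_sobolev: "0 \<in> sobolev s"
proof (rule sobolevI[OF _ has_fourier_zero])
  have "\<exists>C N. \<forall>f :: real^'a \<Rightarrow> complex. schwartz f \<longrightarrow> norm ((0 :: 'a distr) f) \<le> C * schwartz_norm N f"
    by (intro exI[of _ 0]) simp
  then show "tempered (0 :: 'a distr)" unfolding tempered_def by simp
qed (simp add: weighted_L2_def)

lemma dilate_zero: "dilate h 0 = 0"
  unfolding dilate_def by (simp add: fun_eq_iff)

text \<open>
  For \<open>h \<le> 1\<close> the approximant comes from the error estimate. For \<open>h > 1\<close> zero is a sufficiently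
  good approximant, because \<open>s < k\<close>.
\<close>
theorem approximation_order_if_superfunction:
  fixes \<Psi> :: "real^'d::finite \<Rightarrow> complex" and S :: "'d distr set"
  assumes sk: "s < k" "0 \<le> k" and \<Psi>: "\<Psi> \<in> borel_measurable lebesgue"
    and mult: "\<And>g m. g \<in> sobolev s \<Longrightarrow> periodic m \<Longrightarrow> m \<in> borel_measurable lebesgue \<Longrightarrow>
      has_fourier g (\<lambda>\<omega>. m \<omega> * \<Psi> \<omega>) \<Longrightarrow> g \<in> S"
    and near: "ae_near_origin (\<lambda>\<omega>. \<Psi> \<omega> \<noteq> 0 \<and>
      lattice_tail s \<Psi> \<omega> \<le> ennreal (C * norm \<omega> powr (2 * k) * (norm (\<Psi> \<omega>))\<^sup>2))"
  shows "provides_approximation_order s k S"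
proof -
  obtain \<Omega> where "open \<Omega>" "0 \<in> \<Omega>" and ae: "AE \<omega> in lebesgue. \<omega> \<in> \<Omega> \<longrightarrow> \<Psi> \<omega> \<noteq> 0 \<and>
      lattice_tail s \<Psi> \<omega> \<le> ennreal (C * norm \<omega> powr (2 * k) * (norm (\<Psi> \<omega>))\<^sup>2)"
    using near unfolding ae_near_origin_def by blast
  then obtain \<delta> where \<delta>: "\<delta> > 0" "ball 0 \<delta> \<subseteq> \<Omega>" using open_contains_ball by blast
  define \<rho> where "\<rho> = min \<delta> 1"
  have \<rho>: "0 < \<rho>" "\<rho> \<le> 1" using \<delta> unfolding \<rho>_def by auto
  define C' where "C' = max C 0"
  have C': "0 \<le> C'" unfolding C'_def by simp
  have near': "AE \<omega> in lebesgue. norm \<omega> < \<rho> \<longrightarrow> \<Psi> \<omega> \<noteq> 0 \<and>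
      lattice_tail s \<Psi> \<omega> \<le> ennreal (C' * norm \<omega> powr (2 * k) * (norm (\<Psi> \<omega>))\<^sup>2)"
    using ae
  proof eventually_elim
    case (elim \<omega>)
    show ?case
    proof
      assume "norm \<omega> < \<rho>"
      then have "\<omega> \<in> \<Omega>" using \<delta>(2) unfolding \<rho>_def by auto
      moreover have "ennreal (C * norm \<omega> powr (2 * k) * (norm (\<Psi> \<omega>))\<^sup>2) \<le> ennreal (C' * norm \<omega> powr (2 * k) * (norm (\<Psi> \<omega>))\<^sup>2)"
        unfolding C'_def by (intro ennreal_leI mult_right_mono) auto
      ultimately show "\<Psi> \<omega> \<noteq> 0 \<and> lattice_tail s \<Psi> \<omega> \<le> ennreal (C' * norm \<omega> powr (2 * k) * (norm (\<Psi> \<omega>))\<^sup>2)"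
        using elim order_trans by blast
    qed
  qed
  define K0 where "K0 = 2 * \<rho> powr (2 * s - 2 * k) + 2 * (1 + 2 powr (2 * s)) * C'"
  have K0: "0 \<le> K0" unfolding K0_def using C' by simp
  have zero: "0 \<in> S"
    by (rule mult[of 0 "\<lambda>_. 0"]) (auto simp: zero_in_sobolev periodic_def has_fourier_zero)
  show ?thesis unfolding provides_approximation_order_def
  proof (intro exI[of _ "sqrt K0 + 1"] ballI allI impI)
    fix f :: "'d distr" and h :: real assume f: "f \<in> sobolev k" and h: "0 < h"
    have inf_le: "(INF g\<in>dilate h ` S. sobolev_norm s (f - g)) \<le> sobolev_norm s (f - dilate h g)" if "g \<in> S" for g
      using that by (intro cINF_lower bdd_belowI[of _ 0]) (auto simp: sobolev_norm_nonneg)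
    show "(INF g\<in>dilate h ` S. sobolev_norm s (f - g)) \<le> (sqrt K0 + 1) * h powr (k - s) * sobolev_norm k f"
    proof (cases "h \<le> 1")
      case False
      have "(INF g\<in>dilate h ` S. sobolev_norm s (f - g)) \<le> sobolev_norm s f"
        using inf_le[OF zero] by (simp add: dilate_zero)
      also have "\<dots> \<le> sobolev_norm k f" using sk by (intro sobolev_norm_mono f) auto
      also have "\<dots> \<le> ((sqrt K0 + 1) * h powr (k - s)) * sobolev_norm k f"
      proof -
        have "1 * 1 \<le> (sqrt K0 + 1) * h powr (k - s)"
          using False sk K0 by (intro mult_mono ge_one_powr_ge_zero) auto
        then show ?thesis using mult_right_mono[OF _ sobolev_norm_nonneg[of k f], of 1] by simp
      qed
      finally show ?thesis .
    next
      case True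
      let ?fh = "fhat f"
      note fD = sobolevD[OF f]
      define m where "m = periodize \<rho> (\<lambda>\<xi>. ?fh (inverse h *\<^sub>R \<xi>) / \<Psi> \<xi>)"
      define e where "e = (\<lambda>\<omega>. ?fh \<omega> - m (h *\<^sub>R \<omega>) * \<Psi> (h *\<^sub>R \<omega>))"
      note err = superfunction_error[OF sk \<Psi> fD(3) \<rho> C' near' h True, folded m_def K0_def, folded e_def]
      have "weighted_L2 s (\<lambda>\<omega>. ?fh \<omega> - e \<omega>)"
        using weighted_L2_mono[OF fD(3), of s] sk by (intro weighted_L2_diff err(1)) auto
      then have "weighted_L2 s (\<lambda>\<omega>. m (h *\<^sub>R \<omega>) * \<Psi> (h *\<^sub>R \<omega>))" unfolding e_def by simp
      from weighted_L2_dilate[OF this, of "inverse h"] h have L0: "weighted_L2 s (\<lambda>\<omega>. m \<omega> * \<Psi> \<omega>)" by simp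
      \<comment> \<open>compensates the factor \<open>h\<^sup>d\<close> of the dilation\<close>
      let ?c = "inverse (complex_of_real (h ^ CARD('d)))"
      from weighted_L2_cmult[OF L0, of ?c] have "weighted_L2 s (\<lambda>\<omega>. (?c * m \<omega>) * \<Psi> \<omega>)" by (simp add: mult.assoc)
      then obtain g where g: "g \<in> sobolev s" "has_fourier g (\<lambda>\<omega>. (?c * m \<omega>) * \<Psi> \<omega>)" by (rule sobolev_exists)
      have "g \<in> S"
      proof (rule mult[OF g(1) _ _ g(2)])
        have "periodic m" unfolding m_def by (rule periodic_periodize[OF \<rho>(2)])
        then show "periodic (\<lambda>\<omega>. ?c * m \<omega>)" unfolding periodic_def by simp
        show "(\<lambda>\<omega>. ?c * m \<omega>) \<in> borel_measurable lebesgue" using err(3) by simp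
      qed
      have "has_fourier (f - dilate h g) e"
        using has_fourier_diff[OF fD(2) has_fourier_dilate[OF g(2) h]] h unfolding e_def
        by (simp add: mult.assoc[symmetric])
      then have "sobolev_norm s (f - dilate h g) = sqrt (\<integral>\<omega>. weight s \<omega> * (norm (e \<omega>))\<^sup>2 \<partial>lebesgue)"
        by (rule sobolev_norm_eq)
      also have "\<dots> \<le> sqrt (K0 * h powr (2 * k - 2 * s) * (\<integral>\<omega>. weight k \<omega> * (norm (?fh \<omega>))\<^sup>2 \<partial>lebesgue))"
        unfolding e_def m_def K0_def
        by (intro real_sqrt_le_mono superfunction_error(2)[OF sk \<Psi> fD(3) \<rho> C' near' h True])
      also have "\<dots> = sqrt K0 * h powr (k - s) * sobolev_norm k f"
      proof -
        have "h powr (2 * k - 2 * s) = (h powr (k - s))\<^sup>2"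
          by (simp add: power2_eq_square powr_add[symmetric])
        then show ?thesis unfolding sobolev_norm_def by (simp add: real_sqrt_mult)
      qed
      also have "\<dots> \<le> (sqrt K0 + 1) * h powr (k - s) * sobolev_norm k f"
        by (intro mult_right_mono sobolev_norm_nonneg) auto
      finally show ?thesis using inf_le[OF \<open>g \<in> S\<close>] by linarith
    qed
  qed
qed

section \<open>Quadratic forms of Gramians as lattice sums\<close>

lemma ae_near_originE:
  assumes "ae_near_origin Q"
  obtains \<rho> where "0 < \<rho>" "\<rho> \<le> 1" "AE \<omega> in lebesgue. norm \<omega> < \<rho> \<longrightarrow> Q \<omega>"
proof -
  obtain \<Omega> where \<Omega>: "open \<Omega>" "0 \<in> \<Omega>" and ae: "AE \<omega> in lebesgue. \<omega> \<in> \<Omega> \<longrightarrow> Q \<omega>"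
    using assms unfolding ae_near_origin_def by blast
  then obtain \<delta> where \<delta>: "\<delta> > 0" "ball 0 \<delta> \<subseteq> \<Omega>" using open_contains_ball by blast
  have "AE \<omega> in lebesgue. norm \<omega> < min \<delta> 1 \<longrightarrow> Q \<omega>"
    using ae by eventually_elim (use \<delta>(2) in auto)
  with \<delta>(1) show ?thesis by (intro that[of "min \<delta> 1"]) auto
qed

lemma ae_near_originI:
  assumes "0 < \<rho>" "AE \<omega> in lebesgue. norm \<omega> < \<rho> \<longrightarrow> Q \<omega>"
  shows "ae_near_origin Q"
  unfolding ae_near_origin_def using assms by (intro exI[of _ "ball 0 \<rho>"]) auto

lemma ae_near_origin_AE: "AE \<omega> in lebesgue. Q \<omega> \<Longrightarrow> ae_near_origin Q"
  by (rule ae_near_originI[of 1]) auto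

lemma ae_near_origin_mono:
  assumes "ae_near_origin P" "\<And>\<omega>. P \<omega> \<Longrightarrow> Q \<omega>"
  shows "ae_near_origin Q"
proof -
  obtain \<rho> where \<rho>: "0 < \<rho>" "AE \<omega> in lebesgue. norm \<omega> < \<rho> \<longrightarrow> P \<omega>" using ae_near_originE[OF assms(1)] .
  show ?thesis by (rule ae_near_originI[OF \<rho>(1)]) (use \<rho>(2) in eventually_elim, use assms(2) in blast)
qed

lemma ae_near_origin_conj:
  assumes "ae_near_origin P" "ae_near_origin Q"
  shows "ae_near_origin (\<lambda>\<omega>. P \<omega> \<and> Q \<omega>)"
proof -
  obtain \<rho> where \<rho>: "0 < \<rho>" "AE \<omega> in lebesgue. norm \<omega> < \<rho> \<longrightarrow> P \<omega>" using ae_near_originE[OF assms(1)] .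
  obtain \<sigma> where \<sigma>: "0 < \<sigma>" "AE \<omega> in lebesgue. norm \<omega> < \<sigma> \<longrightarrow> Q \<omega>" using ae_near_originE[OF assms(2)] .
  have "AE \<omega> in lebesgue. norm \<omega> < min \<rho> \<sigma> \<longrightarrow> P \<omega> \<and> Q \<omega>"
    using \<rho>(2) \<sigma>(2) by eventually_elim auto
  then show ?thesis using \<rho>(1) \<sigma>(1) by (intro ae_near_originI[of "min \<rho> \<sigma>"]) auto
qed

lemma ae_near_origin_ball:
  assumes "0 < \<rho>" shows "ae_near_origin (\<lambda>\<omega>. norm \<omega> < \<rho> \<and> \<omega> \<noteq> 0)"
proof (rule ae_near_originI[OF assms])
  have "AE \<omega> :: real^'a in lebesgue. \<omega> \<noteq> 0" by (rule AE_completion[OF AE_lborel_singleton])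
  then show "AE \<omega> :: real^'a in lebesgue. norm \<omega> < \<rho> \<longrightarrow> norm \<omega> < \<rho> \<and> \<omega> \<noteq> 0" by eventually_elim simp
qed

lemma powr_le_weight:
  fixes x s :: real
  assumes "1 \<le> x" shows "x powr (2 * s) \<le> (1 + 2 powr (- 2 * s)) * (1 + x) powr (2 * s)"
proof (cases "s \<ge> 0")
  case True
  then have "x powr (2 * s) \<le> (1 + x) powr (2 * s)" using assms by (intro powr_mono2) auto
  moreover have "0 \<le> 2 powr (- 2 * s) * (1 + x) powr (2 * s)" by simp
  ultimately show ?thesis unfolding distrib_right mult_1_left by linarith
next
  case False
  then have "x powr (2 * s) \<le> ((1 + x) / 2) powr (2 * s)" using assms by (intro powr_mono2') auto
  also have "\<dots> = 2 powr (- 2 * s) * (1 + x) powr (2 * s)"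
    using assms by (simp add: powr_divide powr_minus field_simps)
  finally have "x powr (2 * s) \<le> 2 powr (- 2 * s) * (1 + x) powr (2 * s)" .
  moreover have "0 \<le> (1 + x) powr (2 * s)" by simp
  ultimately show ?thesis unfolding distrib_right mult_1_left by linarith
qed

lemma borel_measurable_lattice_term:
  fixes F :: "real^'d::finite \<Rightarrow> complex"
  assumes F: "F \<in> borel_measurable lebesgue"
  shows "(\<lambda>\<omega>. ennreal (norm (\<omega> + \<alpha>) powr t * (norm (F (\<omega> + \<alpha>)))\<^sup>2)) \<in> borel_measurable lebesgue"
proof -
  have [measurable]: "(\<lambda>\<omega>. F (\<omega> + \<alpha>)) \<in> borel_measurable lebesgue" "(\<lambda>\<omega>::real^'d. norm (\<omega> + \<alpha>)) \<in> borel_measurable lebesgue"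
    using borel_measurable_lebesgue_translate[OF F] by (auto intro!: borel_measurable_lebesgue_continuous continuous_intros)
  have [measurable]: "(\<lambda>\<omega>::real^'d. norm (\<omega> + \<alpha>) powr t) \<in> borel_measurable lebesgue"
    by (rule measurable_compose[of "\<lambda>\<omega>. norm (\<omega> + \<alpha>)" _ borel "\<lambda>x. x powr t"]) measurable
  show ?thesis by measurable
qed

lemma borel_measurable_lattice_tail:
  "F \<in> borel_measurable lebesgue \<Longrightarrow> lattice_tail s F \<in> borel_measurable lebesgue"
  unfolding lattice_tail_def[abs_def]
  by (intro borel_measurable_suminf_order borel_measurable_lattice_term)

text \<open>
  The unit balls around the nonzero lattice points are disjoint and keep away from the
  origin, so the integral of the lattice sum over the unit ball is at most a multiple of
  the weighted norm.
\<close>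
lemma lattice_tail_finite:
  fixes F :: "real^'d::finite \<Rightarrow> complex"
  assumes F: "weighted_L2 s F"
  shows "AE \<omega> in lebesgue. norm \<omega> < 1 \<longrightarrow> lattice_tail s F \<omega> \<noteq> \<infinity>"
proof -
  have Fm[measurable]: "F \<in> borel_measurable lebesgue" and Fi: "integrable lebesgue (\<lambda>\<omega>. weight s \<omega> * (norm (F \<omega>))\<^sup>2)"
    using F unfolding weighted_L2_def by auto
  let ?K = "1 + 2 powr (- 2 * s)"
  let ?g = "\<lambda>\<xi>. ennreal (norm \<xi> powr (2 * s) * (norm (F \<xi>))\<^sup>2)"
  let ?w = "\<lambda>\<xi>. ennreal (weight s \<xi> * (norm (F \<xi>))\<^sup>2)"
  let ?i = "\<lambda>n \<xi>. indicator (ball (lat n) 1) \<xi> :: ennreal"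
  have gm: "(\<lambda>\<omega>. ?g (\<omega> + \<alpha>)) \<in> borel_measurable lebesgue" for \<alpha> by (rule borel_measurable_lattice_term[OF Fm])
  have wm: "?w \<in> borel_measurable lebesgue"
    by (intro measurable_compose[OF _ measurable_ennreal] borel_measurable_times measurable_weight borel_measurable_power
        measurable_compose[OF Fm borel_measurable_norm])
  have bm: "(\<lambda>\<xi>. ?i n \<xi>) \<in> borel_measurable lebesgue" "(\<lambda>\<xi>. indicator (ball 0 1) (\<xi> :: real^'d) :: ennreal) \<in> borel_measurable lebesgue" for n
    by (intro borel_measurable_indicator fmeasurableD lmeasurable_ball)+
  have one: "(\<Sum>n. ?i n \<xi>) \<le> 1" for \<xi> :: "real^'d"
  proof (cases "\<exists>n. \<xi> \<in> ball (lat n) 1")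
    case True
    then obtain n where n: "\<xi> \<in> ball (lat n) 1" by blast
    have "?i j \<xi> = 0" if "j \<noteq> n" for j
    proof -
      have "lat j \<noteq> (lat n :: real^'d)" using that bij_betw_imp_inj_on[OF bij_betw_lat] by (auto dest: injD)
      then have "\<xi> \<notin> ball (lat j) 1"
        using dual_lattice_close_unique[OF lat_in(1) lat_in(1), of \<xi> j n] n by (auto simp: dist_norm norm_minus_commute)
      then show ?thesis by simp
    qed
    then have "(\<Sum>j. ?i j \<xi>) = (\<Sum>j\<in>{n}. ?i j \<xi>)" by (intro suminf_finite) auto
    also have "\<dots> = ?i n \<xi>" by (simp only: sum.insert finite.emptyI sum.empty empty_iff not_False_eq_True add_0_right)
    finally show ?thesis by (auto simp: indicator_def)
  next
    case False
    then have "?i n \<xi> = 0" for n by simp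
    then show ?thesis by simp
  qed
  have "(\<integral>\<^sup>+\<omega>. indicator (ball 0 1) \<omega> * lattice_tail s F \<omega> \<partial>lebesgue)
      = (\<integral>\<^sup>+\<omega>. (\<Sum>n. indicator (ball 0 1) \<omega> * ?g (\<omega> + lat n)) \<partial>lebesgue)"
    unfolding lattice_tail_def by simp
  also have "\<dots> = (\<Sum>n. \<integral>\<^sup>+\<omega>. indicator (ball 0 1) \<omega> * ?g (\<omega> + lat n) \<partial>lebesgue)"
    by (intro nn_integral_suminf borel_measurable_times_ennreal bm gm)
  also have "\<dots> \<le> (\<Sum>n. \<integral>\<^sup>+\<xi>. ?i n \<xi> * (ennreal ?K * ?w \<xi>) \<partial>lebesgue)"
  proof (intro suminf_le summableI)
    fix n
    have "(\<lambda>\<xi>. ?i n \<xi> * ?g (\<xi> + 0)) \<in> borel_measurable lebesgue"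
      by (intro borel_measurable_times_ennreal bm gm)
    from nn_integral_lebesgue_affine[OF this, of 1 "lat n"]
    have "(\<integral>\<^sup>+\<xi>. ?i n \<xi> * ?g \<xi> \<partial>lebesgue) = (\<integral>\<^sup>+\<omega>. ?i n (lat n + \<omega>) * ?g (lat n + \<omega>) \<partial>lebesgue)" by simp
    moreover have "?i n (lat n + \<omega>) = indicator (ball 0 1) \<omega>" for \<omega> :: "real^'d"
      by (simp add: indicator_def dist_norm)
    ultimately have "(\<integral>\<^sup>+\<omega>. indicator (ball 0 1) \<omega> * ?g (\<omega> + lat n) \<partial>lebesgue) = (\<integral>\<^sup>+\<xi>. ?i n \<xi> * ?g \<xi> \<partial>lebesgue)"
      by (simp add: add.commute)
    also have "\<dots> \<le> (\<integral>\<^sup>+\<xi>. ?i n \<xi> * (ennreal ?K * ?w \<xi>) \<partial>lebesgue)"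
    proof (intro nn_integral_mono)
      fix \<xi> :: "real^'d"
      show "?i n \<xi> * ?g \<xi> \<le> ?i n \<xi> * (ennreal ?K * ?w \<xi>)"
      proof (cases "\<xi> \<in> ball (lat n) 1")
        case True
        have "2 * pi \<le> norm (lat n :: real^'d)" by (rule norm_dual_lattice_ge[OF lat_in])
        moreover have "norm (lat n :: real^'d) \<le> norm (lat n - \<xi>) + norm \<xi>" using norm_triangle_ineq[of "lat n - \<xi>" \<xi>] by simp
        ultimately have "1 \<le> norm \<xi>" using True pi_ge_two by (simp add: dist_norm)
        then have "norm \<xi> powr (2 * s) * (norm (F \<xi>))\<^sup>2 \<le> ?K * (weight s \<xi> * (norm (F \<xi>))\<^sup>2)"
          using mult_right_mono[OF powr_le_weight[of "norm \<xi>" s] zero_le_power2[of "norm (F \<xi>)"]] by (simp add: mult.assoc)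
        then have "?g \<xi> \<le> ennreal (?K * (weight s \<xi> * (norm (F \<xi>))\<^sup>2))" by (rule ennreal_leI)
        also have "\<dots> = ennreal ?K * ?w \<xi>" by (rule ennreal_mult) (simp_all add: add_nonneg_nonneg)
        finally have "?g \<xi> \<le> ennreal ?K * ?w \<xi>" .
        then show ?thesis by (intro mult_left_mono) auto
      qed simp
    qed
    finally show "(\<integral>\<^sup>+\<omega>. indicator (ball 0 1) \<omega> * ?g (\<omega> + lat n) \<partial>lebesgue) \<le> (\<integral>\<^sup>+\<xi>. ?i n \<xi> * (ennreal ?K * ?w \<xi>) \<partial>lebesgue)" .
  qed
  also have "\<dots> = (\<integral>\<^sup>+\<xi>. (\<Sum>n. ?i n \<xi> * (ennreal ?K * ?w \<xi>)) \<partial>lebesgue)"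
    by (intro nn_integral_suminf[symmetric] borel_measurable_times_ennreal bm wm borel_measurable_const)
  also have "\<dots> \<le> (\<integral>\<^sup>+\<xi>. ennreal ?K * ?w \<xi> \<partial>lebesgue)"
  proof (intro nn_integral_mono)
    fix \<xi> :: "real^'d"
    have "(\<Sum>n. ?i n \<xi> * (ennreal ?K * ?w \<xi>)) = (\<Sum>n. ?i n \<xi>) * (ennreal ?K * ?w \<xi>)" by simp
    also have "\<dots> \<le> 1 * (ennreal ?K * ?w \<xi>)" by (intro mult_right_mono one) auto
    finally show "(\<Sum>n. ?i n \<xi> * (ennreal ?K * ?w \<xi>)) \<le> ennreal ?K * ?w \<xi>" by simp
  qed
  also have "\<dots> = ennreal ?K * (\<integral>\<^sup>+\<xi>. ?w \<xi> \<partial>lebesgue)" by (rule nn_integral_cmult[OF wm])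
  also have "\<dots> < \<infinity>"
    using nn_integral_eq_integral[OF Fi] by (simp add: ennreal_mult_less_top)
  finally have fin: "(\<integral>\<^sup>+\<omega>. indicator (ball 0 1) \<omega> * lattice_tail s F \<omega> \<partial>lebesgue) \<noteq> \<infinity>" by simp
  have "AE \<omega> in lebesgue. indicator (ball 0 1) \<omega> * lattice_tail s F \<omega> \<noteq> \<infinity>"
    by (rule nn_integral_PInf_AE[OF _ fin]) (intro borel_measurable_times_ennreal bm borel_measurable_lattice_tail Fm)
  then show ?thesis by eventually_elim (auto split: split_indicator_asm)
qed

lemma qform_add: "qform (G + H) v = qform G v + qform H v"
  by (simp add: qform_def star_prod_def matrix_vector_mult_add_rdistrib distrib_left sum.distrib)

lemma qform_0: "qform 0 v = 0"
  by (simp add: qform_def star_prod_def)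

lemma qform_zero_right: "qform G 0 = 0"
  by (simp add: qform_def star_prod_def)

lemma qform_sum: "finite I \<Longrightarrow> qform (\<Sum>i\<in>I. G i) v = (\<Sum>i\<in>I. qform (G i) v)"
  by (induction I rule: finite_induct) (simp_all add: qform_0 qform_add)

lemma qform_scaleR_left: "qform (c *\<^sub>R G) v = c * qform G v"
proof -
  have "(c *\<^sub>R G) *v v = c *\<^sub>R (G *v v)"
    by (simp add: matrix_vector_mult_def vec_eq_iff scaleR_sum_right)
  then show ?thesis by (simp add: qform_def star_prod_def sum_distrib_left)
qed

lemma bounded_linear_qform: "bounded_linear (\<lambda>G :: complex^'r^'r::finite. qform G v)"
  unfolding linear_conv_bounded_linear[symmetric]
  by (intro linearI qform_add) (simp add: qform_scaleR_left)

lemma qform_scaleR_right: "qform G (c *\<^sub>R v) = c\<^sup>2 * qform G v"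
proof -
  have "G *v (c *\<^sub>R v) = c *\<^sub>R (G *v v)"
    by (simp add: matrix_vector_mult_def vec_eq_iff scaleR_sum_right)
  then have "star_prod (c *\<^sub>R v) (G *v (c *\<^sub>R v)) = of_real (c\<^sup>2) * star_prod v (G *v v)"
    by (simp add: star_prod_def sum_distrib_left power2_eq_square scaleR_conv_of_real[where 'a=complex] mult_ac)
  then show ?thesis by (simp add: qform_def)
qed

lemma continuous_on_qform: "continuous_on A (\<lambda>v. qform G v)"
  unfolding qform_def star_prod_def matrix_vector_mult_def by (intro continuous_intros)

abbreviation rank_one :: "complex^'r::finite \<Rightarrow> real \<Rightarrow> complex^'r^'r" where
  "rank_one u t \<equiv> \<chi> i j. u $ i * cnj (u $ j) * of_real t"

text \<open>
  The matrices of rank one are the summands of the Gramians.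
\<close>
lemma qform_rank_one: "qform (rank_one u t) v = t * (norm (star_prod v u))\<^sup>2"
proof -
  have c: "cnj (star_prod v u) = (\<Sum>j\<in>UNIV. cnj (u $ j) * v $ j)"
    by (simp add: star_prod_def mult.commute)
  have "star_prod v (rank_one u t *v v) = (\<Sum>i\<in>UNIV. \<Sum>j\<in>UNIV. cnj (v $ i) * (u $ i * cnj (u $ j) * of_real t * v $ j))"
    by (simp add: star_prod_def matrix_vector_mult_def sum_distrib_left)
  also have "\<dots> = of_real t * (\<Sum>i\<in>UNIV. \<Sum>j\<in>UNIV. (cnj (v $ i) * u $ i) * (cnj (u $ j) * v $ j))"
    unfolding sum_distrib_left by (intro sum.cong refl) (simp only: mult_ac)
  also have "\<dots> = of_real t * (star_prod v u * cnj (star_prod v u))"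
    unfolding c by (simp only: star_prod_def sum_product)
  also have "\<dots> = of_real (t * (norm (star_prod v u))\<^sup>2)"
    by (simp add: complex_norm_square[symmetric])
  finally show ?thesis by (simp only: qform_def Re_complex_of_real)
qed

lemma norm_rank_one_le:
  assumes "t \<ge> 0"
  shows "norm (rank_one u t) \<le> (\<Sum>i\<in>UNIV. \<Sum>j\<in>UNIV. t * (norm (u $ i))\<^sup>2 + t * (norm (u $ j))\<^sup>2)"
proof -
  have "norm (rank_one u t) \<le> (\<Sum>i\<in>UNIV. norm (rank_one u t $ i))"
    unfolding norm_vec_def by (rule L2_set_le_sum) (simp add: L2_set_nonneg)
  also have "\<dots> \<le> (\<Sum>i\<in>UNIV. \<Sum>j\<in>UNIV. norm (rank_one u t $ i $ j))"
    unfolding norm_vec_def by (intro sum_mono order_trans[OF L2_set_le_sum]) auto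
  also have "\<dots> \<le> (\<Sum>i\<in>UNIV. \<Sum>j\<in>UNIV. t * (norm (u $ i))\<^sup>2 + t * (norm (u $ j))\<^sup>2)"
  proof (intro sum_mono)
    fix i j
    have "2 * (norm (u $ i) * norm (u $ j)) \<le> (norm (u $ i))\<^sup>2 + (norm (u $ j))\<^sup>2"
      using zero_le_power2[of "norm (u $ i) - norm (u $ j)"] by (simp add: power2_eq_square algebra_simps)
    moreover have "0 \<le> norm (u $ i) * norm (u $ j)" by simp
    ultimately have "t * (norm (u $ i) * norm (u $ j)) \<le> t * ((norm (u $ i))\<^sup>2 + (norm (u $ j))\<^sup>2)"
      using assms by (intro mult_left_mono) linarith+
    then show "norm (rank_one u t $ i $ j) \<le> t * (norm (u $ i))\<^sup>2 + t * (norm (u $ j))\<^sup>2"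
      using assms by (simp add: norm_mult distrib_left mult_ac)
  qed
  finally show ?thesis .
qed

abbreviation pairing :: "complex^'r::finite \<Rightarrow> 'd::finite distr ^ 'r \<Rightarrow> real^'d \<Rightarrow> complex" where
  "pairing v \<Phi> \<omega> \<equiv> star_prod v (fhat_vec \<Phi> \<omega>)"

text \<open>
  The relation between the Gramians and the Fourier transforms that holds wherever the
  defining series converge.
\<close>
definition lattice_form ::
  "real \<Rightarrow> ('d::finite distr ^ 'r::finite) set \<Rightarrow> real^'d \<Rightarrow> bool" where
  "lattice_form s B \<omega> \<longleftrightarrow> (\<forall>v.
     0 \<le> qform (truncated_combined_gramian s B \<omega>) v \<and>
     ennreal (qform (truncated_combined_gramian s B \<omega>) v) = (\<Sum>\<Phi>\<in>B. lattice_tail s (pairing v \<Phi>) \<omega>) \<and>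
     qform (combined_gramian s B \<omega>) v = norm \<omega> powr (2 * s) * (\<Sum>\<Phi>\<in>B. (norm (pairing v \<Phi> \<omega>))\<^sup>2)
       + qform (truncated_combined_gramian s B \<omega>) v)"

lemma lattice_formD:
  assumes "lattice_form s B \<omega>"
  shows "0 \<le> qform (truncated_combined_gramian s B \<omega>) v"
    and "ennreal (qform (truncated_combined_gramian s B \<omega>) v) = (\<Sum>\<Phi>\<in>B. lattice_tail s (pairing v \<Phi>) \<omega>)"
    and "qform (combined_gramian s B \<omega>) v = norm \<omega> powr (2 * s) * (\<Sum>\<Phi>\<in>B. (norm (pairing v \<Phi> \<omega>))\<^sup>2)
       + qform (truncated_combined_gramian s B \<omega>) v"
  using assms unfolding lattice_form_def by blast+

lemma combined_gramian_singleton: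
  "combined_gramian s {\<Phi>} \<omega> = gramian s \<Phi> \<omega>"
  "truncated_combined_gramian s {\<Phi>} \<omega> = truncated_gramian s \<Phi> \<omega>"
  unfolding combined_gramian_def truncated_combined_gramian_def by simp_all

lemma sum_singleton: "(\<Sum>x\<in>{a}. f x) = f a"
  by simp

text \<open>
  Almost everywhere in the unit ball the series of matrices converges absolutely, since its
  diagonal entries are finite lattice tails; a quadratic form may then be applied to each
  summand.
\<close>
lemma lattice_form_singleton:
  fixes \<Phi> :: "'d::finite distr ^ 'r::finite"
  assumes \<Phi>: "\<And>i. \<Phi> $ i \<in> sobolev s"
  shows "AE \<omega> in lebesgue. norm \<omega> < 1 \<longrightarrow> lattice_form s {\<Phi>} \<omega>"
proof -
  have "AE \<omega> in lebesgue. \<forall>i\<in>UNIV. norm \<omega> < 1 \<longrightarrow> lattice_tail s (fhat (\<Phi> $ i)) \<omega> \<noteq> \<infinity>"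
    by (subst AE_ball_countable) (auto intro!: countable_finite lattice_tail_finite[simplified] sobolevD \<Phi>)
  then show ?thesis
  proof (eventually_elim, unfold lattice_form_def combined_gramian_singleton, intro impI allI)
    fix \<omega> :: "real^'d" and v :: "complex^'r"
    assume *: "\<forall>i\<in>UNIV. norm \<omega> < 1 \<longrightarrow> lattice_tail s (fhat (\<Phi> $ i)) \<omega> \<noteq> \<infinity>" and "norm \<omega> < 1"
    define f where "f \<alpha> = rank_one (fhat_vec \<Phi> (\<omega> + \<alpha>)) (norm (\<omega> + \<alpha>) powr (2 * s))" for \<alpha>
    define a where "a i n = norm (\<omega> + lat n) powr (2 * s) * (norm (fhat_vec \<Phi> (\<omega> + lat n) $ i))\<^sup>2" for i n
    have sa: "summable (a i)" for i
    proof (rule summable_suminf_not_top)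
      have "(\<Sum>n. ennreal (a i n)) = lattice_tail s (fhat (\<Phi> $ i)) \<omega>"
        by (simp only: lattice_tail_def a_def fhat_vec_def vec_lambda_beta)
      moreover have "lattice_tail s (fhat (\<Phi> $ i)) \<omega> \<noteq> \<infinity>" using * \<open>norm \<omega> < 1\<close> by blast
      ultimately show "(\<Sum>n. ennreal (a i n)) \<noteq> top" by (metis infinity_ennreal_def)
    qed (simp add: a_def)
    have sn: "summable (\<lambda>n. norm (f (lat n)))"
    proof (rule summable_comparison_test')
      show "summable (\<lambda>n. \<Sum>i\<in>UNIV. \<Sum>j\<in>UNIV. a i n + a j n)"
        by (intro summable_sum summable_add sa)
      show "norm (norm (f (lat n))) \<le> (\<Sum>i\<in>UNIV. \<Sum>j\<in>UNIV. a i n + a j n)" if "n \<ge> 0" for n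
        unfolding f_def a_def real_norm_def abs_norm_cancel by (rule norm_rank_one_le) simp
    qed
    have hs: "((\<lambda>n. f (lat n)) has_sum (\<Sum>n. f (lat n))) UNIV"
      by (rule norm_summable_imp_has_sum[OF sn]) (rule summable_sums[OF summable_norm_cancel[OF sn]])
    have tg: "truncated_gramian s \<Phi> \<omega> = infsum f (dual_lattice - {0})"
      unfolding truncated_gramian_def gramian_over_def f_def ..
    also have "\<dots> = infsum (\<lambda>n. f (lat n)) UNIV"
      by (rule infsum_reindex_bij_betw[OF bij_betw_lat, symmetric])
    also have "\<dots> = (\<Sum>n. f (lat n))" using hs by (rule infsumI)
    finally have eq: "truncated_gramian s \<Phi> \<omega> = (\<Sum>n. f (lat n))" .
    have sf: "f summable_on (dual_lattice - {0})"
      using hs summable_on_reindex_bij_betw[OF bij_betw_lat, of f] by (auto simp: summable_on_def)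
    define q where "q n = norm (\<omega> + lat n) powr (2 * s) * (norm (pairing v \<Phi> (\<omega> + lat n)))\<^sup>2" for n
    have q: "qform (f (lat n)) v = q n" for n
      unfolding f_def q_def by (rule qform_rank_one)
    have q0: "0 \<le> q n" for n unfolding q_def by simp
    have sq: "summable q"
      using bounded_linear.summable[OF bounded_linear_qform summable_norm_cancel[OF sn], of v] unfolding q .
    have qs: "qform (truncated_gramian s \<Phi> \<omega>) v = (\<Sum>n. q n)"
      unfolding eq using bounded_linear.suminf[OF bounded_linear_qform summable_norm_cancel[OF sn], of v] unfolding q .
    show "0 \<le> qform (truncated_gramian s \<Phi> \<omega>) v \<and>
      ennreal (qform (truncated_gramian s \<Phi> \<omega>) v) = (\<Sum>\<Phi>\<in>{\<Phi>}. lattice_tail s (pairing v \<Phi>) \<omega>) \<and>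
      qform (gramian s \<Phi> \<omega>) v = norm \<omega> powr (2 * s) * (\<Sum>\<Phi>\<in>{\<Phi>}. (norm (pairing v \<Phi> \<omega>))\<^sup>2)
       + qform (truncated_gramian s \<Phi> \<omega>) v"
    proof (unfold sum_singleton, intro conjI)
      show "0 \<le> qform (truncated_gramian s \<Phi> \<omega>) v" unfolding qs by (intro suminf_nonneg sq q0)
      show "ennreal (qform (truncated_gramian s \<Phi> \<omega>) v) = lattice_tail s (pairing v \<Phi>) \<omega>"
        unfolding qs lattice_tail_def q_def[symmetric] by (rule suminf_ennreal2[symmetric, OF q0 sq])
      have "gramian s \<Phi> \<omega> = infsum f ({0} \<union> (dual_lattice - {0}))"
        unfolding gramian_def gramian_over_def f_def by (simp add: insert_absorb)
      also have "\<dots> = infsum f {0} + infsum f (dual_lattice - {0})"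
        by (rule infsum_Un_disjoint) (use sf in auto)
      also have "\<dots> = f 0 + truncated_gramian s \<Phi> \<omega>" unfolding tg by simp
      finally show "qform (gramian s \<Phi> \<omega>) v = norm \<omega> powr (2 * s) * (norm (pairing v \<Phi> \<omega>))\<^sup>2
       + qform (truncated_gramian s \<Phi> \<omega>) v"
        by (simp only: qform_add f_def qform_rank_one add_0_right)
    qed
  qed
qed

lemma lattice_form_AE:
  fixes B :: "('d::finite distr ^ 'r::finite) set"
  assumes B: "finite B" "\<And>\<Phi> i. \<Phi> \<in> B \<Longrightarrow> \<Phi> $ i \<in> sobolev s"
  shows "AE \<omega> in lebesgue. norm \<omega> < 1 \<longrightarrow> lattice_form s B \<omega>"
proof -
  have "AE \<omega> in lebesgue. \<forall>\<Phi>\<in>B. norm \<omega> < 1 \<longrightarrow> lattice_form s {\<Phi>} \<omega>"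
    using B by (subst AE_ball_countable) (auto intro!: countable_finite lattice_form_singleton)
  then show ?thesis
  proof (eventually_elim, intro impI)
    fix \<omega> :: "real^'d"
    assume *: "\<forall>\<Phi>\<in>B. norm \<omega> < 1 \<longrightarrow> lattice_form s {\<Phi>} \<omega>" and "norm \<omega> < 1"
    then have f: "\<And>\<Phi>. \<Phi> \<in> B \<Longrightarrow> lattice_form s {\<Phi>} \<omega>" by blast
    show "lattice_form s B \<omega>"
      unfolding lattice_form_def
    proof
      fix v
      note q = lattice_formD[OF f, of _ v, unfolded combined_gramian_singleton sum_singleton]
      have t: "qform (truncated_combined_gramian s B \<omega>) v = (\<Sum>\<Phi>\<in>B. qform (truncated_gramian s \<Phi> \<omega>) v)"
        unfolding truncated_combined_gramian_def by (rule qform_sum[OF B(1)])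
      have g: "qform (combined_gramian s B \<omega>) v = (\<Sum>\<Phi>\<in>B. qform (gramian s \<Phi> \<omega>) v)"
        unfolding combined_gramian_def by (rule qform_sum[OF B(1)])
      show "0 \<le> qform (truncated_combined_gramian s B \<omega>) v \<and>
       ennreal (qform (truncated_combined_gramian s B \<omega>) v) = (\<Sum>\<Phi>\<in>B. lattice_tail s (pairing v \<Phi>) \<omega>) \<and>
       qform (combined_gramian s B \<omega>) v = norm \<omega> powr (2 * s) * (\<Sum>\<Phi>\<in>B. (norm (pairing v \<Phi> \<omega>))\<^sup>2)
         + qform (truncated_combined_gramian s B \<omega>) v"
      proof (intro conjI)
        show "0 \<le> qform (truncated_combined_gramian s B \<omega>) v" unfolding t by (intro sum_nonneg q)
        have "ennreal (\<Sum>\<Phi>\<in>B. qform (truncated_gramian s \<Phi> \<omega>) v) = (\<Sum>\<Phi>\<in>B. ennreal (qform (truncated_gramian s \<Phi> \<omega>) v))"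
          by (rule sum_ennreal[symmetric]) (rule q)
        also have "\<dots> = (\<Sum>\<Phi>\<in>B. lattice_tail s (pairing v \<Phi>) \<omega>)"
          by (intro sum.cong refl q)
        finally show "ennreal (qform (truncated_combined_gramian s B \<omega>) v) = (\<Sum>\<Phi>\<in>B. lattice_tail s (pairing v \<Phi>) \<omega>)"
          unfolding t .
        have "(\<Sum>\<Phi>\<in>B. qform (gramian s \<Phi> \<omega>) v) = (\<Sum>\<Phi>\<in>B. norm \<omega> powr (2 * s) * (norm (pairing v \<Phi> \<omega>))\<^sup>2
           + qform (truncated_gramian s \<Phi> \<omega>) v)"
          by (intro sum.cong refl q)
        then show "qform (combined_gramian s B \<omega>) v = norm \<omega> powr (2 * s) * (\<Sum>\<Phi>\<in>B. (norm (pairing v \<Phi> \<omega>))\<^sup>2)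
           + qform (truncated_combined_gramian s B \<omega>) v"
          unfolding g t by (simp add: sum.distrib sum_distrib_left)
      qed
    qed
  qed
qed

section \<open>Shift-invariant spaces generated by a set\<close>

lemma si_space_base: "a \<in> A \<Longrightarrow> a \<in> si_space s A"
  unfolding si_space_def by auto

text \<open>
  A closed shift-invariant space that contains \<open>A\<close> contains each summand, hence a distribution
  with the same Fourier transform as \<open>\<psi>\<close>.
\<close>
lemma superfunction_in_si_space:
  fixes A :: "'d::finite distr set"
  assumes J: "finite J" and T: "\<And>j. j \<in> J \<Longrightarrow> T j \<in> A"
    and m: "\<And>j. j \<in> J \<Longrightarrow> m j \<in> borel_measurable lebesgue" "\<And>j. j \<in> J \<Longrightarrow> periodic (m j)"
      "\<And>j \<omega>. j \<in> J \<Longrightarrow> norm (m j \<omega>) \<le> K"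
    and \<psi>: "tempered \<psi>" "has_fourier \<psi> (\<lambda>\<omega>. \<Sum>j\<in>J. m j \<omega> * fhat (T j) \<omega>)"
  shows "\<psi> \<in> si_space s A"
  unfolding si_space_def
proof (rule InterI, safe)
  fix S assume S: "closed_shift_invariant s S" and "A \<subseteq> S"
  have sub: "distr.subspace S" "S \<subseteq> sobolev s" using S unfolding closed_shift_invariant_def by auto
  have "\<exists>U\<in>S. has_fourier U (\<lambda>\<omega>. m j \<omega> * fhat (T j) \<omega>)" if j: "j \<in> J" for j
  proof (rule bounded_multiplier_in_closed_si[OF S _ _ m(1)[OF j] m(2)[OF j] m(3)[OF j]])
    show "T j \<in> S" using T[OF j] \<open>A \<subseteq> S\<close> by blast
    then show "has_fourier (T j) (fhat (T j))" using sub sobolevD(2) by blast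
  qed
  then obtain U where U: "\<And>j. j \<in> J \<Longrightarrow> U j \<in> S" "\<And>j. j \<in> J \<Longrightarrow> has_fourier (U j) (\<lambda>\<omega>. m j \<omega> * fhat (T j) \<omega>)"
    by metis
  have US: "(\<Sum>j\<in>J. U j) \<in> S" using U by (intro distr.subspace_sum sub) auto
  then have Ut: "tempered (\<Sum>j\<in>J. U j)" using sub(2) by (intro sobolevD(1)) auto
  have "has_fourier (\<Sum>j\<in>J. U j) (\<lambda>\<omega>. \<Sum>j\<in>J. m j \<omega> * fhat (T j) \<omega>)"
    by (rule has_fourier_sum[OF J U(2)])
  from tempered_eqI[OF \<psi> Ut this] US show "\<psi> \<in> S" by simp
qed

lemma approximation_order_si_space:
  fixes A :: "'d::finite distr set"
  assumes sk: "s < k" "0 \<le> k" and \<psi>: "\<psi> \<in> si_space s A" "has_fourier \<psi> \<Psi>"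
    and near: "ae_near_origin (\<lambda>\<omega>. \<Psi> \<omega> \<noteq> 0 \<and>
      lattice_tail s \<Psi> \<omega> \<le> ennreal (C * norm \<omega> powr (2 * k) * (norm (\<Psi> \<omega>))\<^sup>2))"
  shows "provides_approximation_order s k (si_space s A)"
proof (rule approximation_order_if_superfunction[OF sk has_fourierD(1)[OF \<psi>(2)] _ near])
  fix g m assume g: "g \<in> sobolev s" and m: "periodic m" "m \<in> borel_measurable lebesgue"
    and gm: "has_fourier g (\<lambda>\<omega>. m \<omega> * \<Psi> \<omega>)"
  show "g \<in> si_space s A"
    unfolding si_space_def
  proof (rule InterI, safe)
    fix S assume S: "closed_shift_invariant s S" and "A \<subseteq> S"
    then have "\<psi> \<in> S" using \<psi>(1) unfolding si_space_def by blast
    from multiplier_in_closed_si[OF S this \<psi>(2) m(2,1) g gm] show "g \<in> S" .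
  qed
qed

lemma lattice_tail_cong:
  "(\<And>n. F (\<omega> + lat n) = G (\<omega> + lat n)) \<Longrightarrow> lattice_tail s F \<omega> = lattice_tail s G \<omega>"
  unfolding lattice_tail_def by simp

lemma lattice_tail_le_sum:
  assumes I: "finite I" and c: "0 \<le> c"
    and le: "\<And>n. (norm (F (\<omega> + lat n)))\<^sup>2 \<le> c * (\<Sum>i\<in>I. (norm (G i (\<omega> + lat n)))\<^sup>2)"
  shows "lattice_tail s F \<omega> \<le> ennreal c * (\<Sum>i\<in>I. lattice_tail s (G i) \<omega>)"
proof -
  let ?t = "\<lambda>n. norm (\<omega> + lat n) powr (2 * s)"
  have "lattice_tail s F \<omega> \<le> (\<Sum>n. ennreal c * (\<Sum>i\<in>I. ennreal (?t n * (norm (G i (\<omega> + lat n)))\<^sup>2)))"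
    unfolding lattice_tail_def
  proof (intro suminf_le summableI)
    fix n
    have "?t n * (norm (F (\<omega> + lat n)))\<^sup>2 \<le> ?t n * (c * (\<Sum>i\<in>I. (norm (G i (\<omega> + lat n)))\<^sup>2))"
      by (intro mult_left_mono le) auto
    also have "\<dots> = c * (\<Sum>i\<in>I. ?t n * (norm (G i (\<omega> + lat n)))\<^sup>2)"
      by (simp add: sum_distrib_left mult_ac)
    finally have "ennreal (?t n * (norm (F (\<omega> + lat n)))\<^sup>2) \<le> ennreal (c * (\<Sum>i\<in>I. ?t n * (norm (G i (\<omega> + lat n)))\<^sup>2))"
      by (rule ennreal_leI)
    also have "\<dots> = ennreal c * (\<Sum>i\<in>I. ennreal (?t n * (norm (G i (\<omega> + lat n)))\<^sup>2))"
    proof -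
      have "ennreal (\<Sum>i\<in>I. ?t n * (norm (G i (\<omega> + lat n)))\<^sup>2) = (\<Sum>i\<in>I. ennreal (?t n * (norm (G i (\<omega> + lat n)))\<^sup>2))"
        by (rule sum_ennreal[symmetric]) simp
      then show ?thesis using c by (subst ennreal_mult[OF c]) (simp_all only: sum_nonneg zero_le_power2 mult_nonneg_nonneg powr_ge_zero)
    qed
    finally show "ennreal (?t n * (norm (F (\<omega> + lat n)))\<^sup>2) \<le> ennreal c * (\<Sum>i\<in>I. ennreal (?t n * (norm (G i (\<omega> + lat n)))\<^sup>2))" .
  qed
  also have "\<dots> = ennreal c * (\<Sum>i\<in>I. lattice_tail s (G i) \<omega>)"
    unfolding lattice_tail_def by (simp only: ennreal_suminf_cmult suminf_sum[OF summableI])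
  finally show ?thesis .
qed

lemma norm_sum_mult_le:
  fixes a b :: "'i \<Rightarrow> complex"
  shows "(norm (\<Sum>i\<in>I. a i * b i))\<^sup>2 \<le> (\<Sum>i\<in>I. (norm (a i))\<^sup>2) * (\<Sum>i\<in>I. (norm (b i))\<^sup>2)"
proof -
  have "norm (\<Sum>i\<in>I. a i * b i) \<le> (\<Sum>i\<in>I. norm (a i) * norm (b i))"
    by (rule sum_norm_le) (simp add: norm_mult)
  then have "(norm (\<Sum>i\<in>I. a i * b i))\<^sup>2 \<le> (\<Sum>i\<in>I. norm (a i) * norm (b i))\<^sup>2" by (intro power_mono) auto
  also have "\<dots> \<le> (\<Sum>i\<in>I. (norm (a i))\<^sup>2) * (\<Sum>i\<in>I. (norm (b i))\<^sup>2)" by (rule Cauchy_Schwarz_ineq_sum)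
  finally show ?thesis .
qed

lemma star_prod_fhat_vec: "pairing v \<Phi> \<omega> = (\<Sum>i\<in>UNIV. cnj (v $ i) * fhat (\<Phi> $ i) \<omega>)"
  by (simp add: star_prod_def fhat_vec_def)

section \<open>Coherent approximation order\<close>

lemma measurable_fhat: "T \<in> sobolev s \<Longrightarrow> fhat T \<in> borel_measurable lebesgue"
  using sobolevD(2) has_fourierD(1) by blast

lemma measurable_vec_nth:
  fixes v :: "'a \<Rightarrow> complex^'r::finite"
  assumes "v \<in> borel_measurable M" shows "(\<lambda>\<omega>. v \<omega> $ i) \<in> borel_measurable M"
  by (rule measurable_compose[OF assms borel_measurable_continuous_onI]) (intro continuous_intros)

lemma measurable_cnj:
  assumes "f \<in> borel_measurable M" shows "(\<lambda>\<omega>. cnj (f \<omega>)) \<in> borel_measurable M"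
  by (rule measurable_compose[OF assms borel_measurable_continuous_onI]) (intro continuous_intros)

lemma measurable_star_prod:
  assumes "v \<in> borel_measurable lebesgue" "\<And>i. \<Phi> $ i \<in> sobolev s"
  shows "(\<lambda>\<omega>. pairing (v \<omega>) \<Phi> \<omega>) \<in> borel_measurable lebesgue"
  unfolding star_prod_fhat_vec
  by (intro borel_measurable_sum borel_measurable_times measurable_cnj measurable_vec_nth assms measurable_fhat[where s=s])

text \<open>
  The infimum in the coherence condition is attained up to a constant in an open set of
  directions, hence by one of the vectors of a fixed countable dense set; taking the first
  one gives a measurable choice.
\<close>
lemma coherent_supervector:
  fixes B :: "('d::finite distr ^ 'r::finite) set"
  assumes B: "finite B" "\<And>\<Phi> i. \<Phi> \<in> B \<Longrightarrow> \<Phi> $ i \<in> sobolev s"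
    and sk: "s < k" and coh: "coherent_approximation_order s k B"
  shows "\<exists>v C. v \<in> borel_measurable lebesgue \<and> (\<forall>\<omega>. norm (v \<omega>) \<le> 1) \<and> ae_near_origin (\<lambda>\<omega>.
      0 < (\<Sum>\<Phi>\<in>B. (norm (pairing (v \<omega>) \<Phi> \<omega>))\<^sup>2) \<and>
      (\<Sum>\<Phi>\<in>B. lattice_tail s (pairing (v \<omega>) \<Phi>) \<omega>)
        \<le> ennreal (C * norm \<omega> powr (2 * k) * (\<Sum>\<Phi>\<in>B. (norm (pairing (v \<omega>) \<Phi> \<omega>))\<^sup>2)))"
proof -
  define c2 where "c2 u \<omega> = (\<Sum>\<Phi>\<in>B. (norm (pairing u \<Phi> \<omega>))\<^sup>2)" for u \<omega>
  define t where "t u \<omega> = (\<Sum>\<Phi>\<in>B. lattice_tail s (pairing u \<Phi>) \<omega>)" for u \<omega>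
  obtain C0 where "ae_near_origin (\<lambda>\<omega>. ereal (norm \<omega> powr (- (2 * k - 2 * s))) *
        (INF v\<in>{v. qform (combined_gramian s B \<omega>) v \<noteq> 0}.
           ereal (qform (truncated_combined_gramian s B \<omega>) v / qform (combined_gramian s B \<omega>) v))
        \<le> ereal C0)"
    using coh unfolding coherent_approximation_order_def by blast
  define good where "good \<omega> \<longleftrightarrow> ereal (norm \<omega> powr (- (2 * k - 2 * s))) *
        (INF v\<in>{v. qform (combined_gramian s B \<omega>) v \<noteq> 0}.
           ereal (qform (truncated_combined_gramian s B \<omega>) v / qform (combined_gramian s B \<omega>) v))
        \<le> ereal C0" for \<omega>
  have C0: "ae_near_origin good" unfolding good_def[abs_def] by fact
  \<comment> \<open>strictly larger than \<open>C0\<close>, so that some direction stays below the corresponding bound\<close>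
  define C1 where "C1 = max C0 0 + 1"
  have C1: "C1 > 0" "C0 < C1" unfolding C1_def by auto
  obtain D :: "(complex^'r) set" where D: "countable D" "\<And>X. open X \<Longrightarrow> X \<noteq> {} \<Longrightarrow> \<exists>d\<in>D. d \<in> X"
    by (rule countable_dense_setE) blast
  have "D \<noteq> {}" using D(2)[OF open_UNIV] by auto
  define u where "u n = (if norm (from_nat_into D n) < 1 then from_nat_into D n else 0)" for n
  have u1: "norm (u n) \<le> 1" for n unfolding u_def by simp
  define E where "E n \<omega> \<longleftrightarrow> 0 < c2 (u n) \<omega> \<and> t (u n) \<omega> \<le> ennreal (2 * C1 * norm \<omega> powr (2 * k) * c2 (u n) \<omega>)" for n \<omega>
  define v where "v \<omega> = u (LEAST n. E n \<omega>)" for \<omega>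
  have sm: "(\<lambda>\<omega>. pairing (u n) \<Phi> \<omega>) \<in> borel_measurable lebesgue" if "\<Phi> \<in> B" for n \<Phi>
    by (rule measurable_star_prod) (use B(2) that in auto)
  have [measurable]: "c2 (u n) \<in> borel_measurable lebesgue" for n
    unfolding c2_def[abs_def]
    by (intro borel_measurable_sum borel_measurable_power measurable_compose[OF sm borel_measurable_norm])
  have [measurable]: "t (u n) \<in> borel_measurable lebesgue" for n
    unfolding t_def[abs_def] by (intro borel_measurable_sum borel_measurable_lattice_tail sm)
  have [measurable]: "(\<lambda>\<omega>::real^'d. norm \<omega> powr (2 * k)) \<in> borel_measurable lebesgue"
    by (rule measurable_compose[of norm _ borel "\<lambda>x. x powr (2 * k)"])
      (auto intro: borel_measurable_lebesgue_continuous continuous_intros)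
  have [measurable]: "Measurable.pred lebesgue (E n)" for n
    unfolding E_def[abs_def] by measurable
  have vm: "v \<in> borel_measurable lebesgue"
    unfolding v_def[abs_def] by (rule measurable_compose[of _ _ "count_space UNIV"]) measurable
  have least: "E (LEAST n. E n \<omega>) \<omega>" if "E n \<omega>" for n \<omega> using that by (rule LeastI)
  \<comment> \<open>for \<open>|\<omega>| < \<rho>\<close> the bound on the quotient of the forms is below 1/2, so that the term at the origin dominates\<close>
  define \<rho> where "\<rho> = (1 / (2 * C1)) powr (1 / (2 * k - 2 * s))"
  have \<rho>: "\<rho> > 0" using C1 unfolding \<rho>_def by simp
  have ex: "\<exists>n. E n \<omega>"
    if "good \<omega>"
      and \<omega>: "\<omega> \<noteq> 0" "norm \<omega> < \<rho>"
      and q: "lattice_form s B \<omega>" for \<omega>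
  proof -
    let ?x = "norm \<omega> powr (- (2 * k - 2 * s))"
    let ?I = "INF v\<in>{v. qform (combined_gramian s B \<omega>) v \<noteq> 0}.
           ereal (qform (truncated_combined_gramian s B \<omega>) v / qform (combined_gramian s B \<omega>) v)"
    have coh\<omega>: "ereal ?x * ?I \<le> ereal C0" using that(1) unfolding good_def .
    let ?qt = "qform (truncated_combined_gramian s B \<omega>)" and ?q = "qform (combined_gramian s B \<omega>)"
    define y where "y = C1 * norm \<omega> powr (2 * k - 2 * s)"
    have x: "?x > 0" using \<omega> by simp
    have "?x * norm \<omega> powr (2 * k - 2 * s) = 1" using \<omega> by (simp add: powr_add[symmetric])
    then have xy: "?x * y = C1" unfolding y_def by (simp add: mult.left_commute)
    have y0: "y > 0" using C1 \<omega> unfolding y_def by simp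
    have "norm \<omega> powr (2 * k - 2 * s) < \<rho> powr (2 * k - 2 * s)" using \<omega> sk by (intro powr_less_mono2) auto
    also have "\<dots> = 1 / (2 * C1)" unfolding \<rho>_def using C1 sk by (simp add: powr_powr)
    finally have y12: "y < 1 / 2" unfolding y_def using C1 by (simp add: field_simps)
    have "?I < ereal y"
    proof (rule ccontr)
      assume "\<not> ?I < ereal y"
      then have "ereal ?x * ereal y \<le> ereal ?x * ?I" using x by (intro ereal_mult_left_mono) auto
      also have "\<dots> \<le> ereal C0" by (rule coh\<omega>)
      finally show False using C1 xy by simp
    qed
    then have "\<exists>w\<in>{v. ?q v \<noteq> 0}. ereal (?qt w / ?q w) < ereal y"
      by (simp only: INF_less_iff)
    then obtain w where "w \<in> {v. ?q v \<noteq> 0}" "ereal (?qt w / ?q w) < ereal y"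
      by (elim bexE)
    then have w: "?q w \<noteq> 0" "?qt w / ?q w < y" by simp_all
    have qw: "?q w = norm \<omega> powr (2 * s) * c2 w \<omega> + ?qt w" "0 \<le> ?qt w" using lattice_formD[OF q, of w] unfolding c2_def by auto
    have c20: "0 \<le> c2 w \<omega>" for w unfolding c2_def by (intro sum_nonneg) auto
    have "?q w \<ge> 0" using qw c20[of w] by simp
    with w have "?qt w < y * ?q w" by (simp add: pos_divide_less_eq)
    also have "\<dots> = y * norm \<omega> powr (2 * s) * c2 w \<omega> + y * ?qt w" unfolding qw(1) by (simp add: algebra_simps)
    also have "y * ?qt w \<le> 1 / 2 * ?qt w" using y12 qw(2) by (intro mult_right_mono) auto
    also have "y * norm \<omega> powr (2 * s) = C1 * norm \<omega> powr (2 * k)"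
      unfolding y_def by (simp add: mult.assoc powr_add[symmetric])
    finally have main: "?qt w < 2 * C1 * norm \<omega> powr (2 * k) * c2 w \<omega>" by simp
    \<comment> \<open>both sides are quadratic forms, so the inequality is an open, scale-invariant condition\<close>
    define H where "H = truncated_combined_gramian s B \<omega>
      + (- (2 * C1 * norm \<omega> powr (2 * k))) *\<^sub>R (\<Sum>\<Phi>\<in>B. rank_one (fhat_vec \<Phi> \<omega>) 1)"
    have "qform (\<Sum>\<Phi>\<in>B. rank_one (fhat_vec \<Phi> \<omega>) 1) z = c2 z \<omega>" for z
      unfolding qform_sum[OF B(1)] qform_rank_one c2_def by simp
    then have H: "qform H z = ?qt z - 2 * C1 * norm \<omega> powr (2 * k) * c2 z \<omega>" for z
      unfolding H_def qform_add qform_scaleR_left by simp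
    define r where "r = 1 / (2 * (norm w + 1))"
    have r: "r > 0" unfolding r_def using norm_ge_zero[of w] by (auto simp del: norm_ge_zero intro!: divide_pos_pos)
    have "norm (r *\<^sub>R w) < 1" proof -
      have "norm w + 1 > 0" by (simp add: add_nonneg_pos)
      then show ?thesis unfolding r_def by (simp add: divide_less_eq)
    qed
    moreover have "qform H (r *\<^sub>R w) < 0" unfolding qform_scaleR_right using r main H[of w] by (simp add: mult_pos_neg)
    ultimately have "r *\<^sub>R w \<in> ball 0 1 \<inter> {z. qform H z < 0}" by simp
    moreover have "open (ball 0 1 \<inter> {z. qform H z < 0})"
      by (intro open_Int open_ball open_Collect_less continuous_on_qform continuous_on_const)
    ultimately obtain d where d: "d \<in> D" "norm d < 1" "qform H d < 0" using D(2) by (metis Int_iff dist_0_norm empty_iff mem_Collect_eq mem_ball)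
    obtain n where n: "from_nat_into D n = d" using from_nat_into_surj[OF D(1) d(1)] by blast
    then have un: "u n = d" using d(2) unfolding u_def by simp
    have lt: "?qt d < 2 * C1 * norm \<omega> powr (2 * k) * c2 d \<omega>" using d(3) H by simp
    have "0 \<le> ?qt d" and td: "t d \<omega> = ennreal (?qt d)" using lattice_formD[OF q, of d] unfolding t_def by auto
    then have "0 < 2 * C1 * norm \<omega> powr (2 * k) * c2 d \<omega>" using lt by linarith
    then have "c2 d \<omega> \<noteq> 0" by auto
    then have "0 < c2 d \<omega>" using c20[of d] by simp
    moreover have "t d \<omega> \<le> ennreal (2 * C1 * norm \<omega> powr (2 * k) * c2 d \<omega>)"
      unfolding td using lt by (intro ennreal_leI) simp
    ultimately show ?thesis unfolding E_def un[symmetric] by blast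
  qed
  have "ae_near_origin (lattice_form s B)"
    by (rule ae_near_originI[OF zero_less_one lattice_form_AE[OF B]])
  from ae_near_origin_conj[OF C0 ae_near_origin_conj[OF ae_near_origin_ball[OF \<rho>] this]]
  have "ae_near_origin (\<lambda>\<omega>. 0 < c2 (v \<omega>) \<omega> \<and> t (v \<omega>) \<omega> \<le> ennreal (2 * C1 * norm \<omega> powr (2 * k) * c2 (v \<omega>) \<omega>))"
  proof (rule ae_near_origin_mono)
    fix \<omega> assume *: "good \<omega> \<and> (norm \<omega> < \<rho> \<and> \<omega> \<noteq> 0) \<and> lattice_form s B \<omega>"
    obtain n where "E n \<omega>" using ex[OF conjunct1[OF *]] * by blast
    from least[OF this]
    show "0 < c2 (v \<omega>) \<omega> \<and> t (v \<omega>) \<omega> \<le> ennreal (2 * C1 * norm \<omega> powr (2 * k) * c2 (v \<omega>) \<omega>)"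
      unfolding E_def v_def .
  qed
  moreover have "norm (v \<omega>) \<le> 1" for \<omega> unfolding v_def by (rule u1)
  ultimately show ?thesis using vm unfolding c2_def t_def by blast
qed

lemma norm_periodize_le:
  assumes "\<And>x. norm (u x) \<le> K" shows "norm (periodize \<rho> u \<omega>) \<le> K"
  using assms order_trans[OF norm_ge_zero assms] unfolding periodize_def by auto

text \<open>
  With the measurable supervector \<open>v\<close> and \<open>c\<^sub>\<Phi> = v\<^sup>*\<Phi>\<close> on the Fourier side, the superfunction is
  the sum of the \<open>v\<^sup>*\<Phi>\<close> with the periodic coefficients \<open>cnj c\<^sub>\<Phi> / |c|\<close>. Its value near the origin
  is \<open>|c|\<close>, and at the other lattice points it is controlled through Cauchy-Schwarz by the
  combined form at \<open>v\<close>, which coherence makes small against \<open>|c|\<^sup>2\<close>.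
\<close>
theorem coherent_approximation_order_si_space:
  fixes B :: "('d::finite distr ^ 'r::finite) set"
  assumes B: "finite B" "\<And>\<Phi> i. \<Phi> \<in> B \<Longrightarrow> \<Phi> $ i \<in> sobolev s"
    and sk: "s < k" "0 \<le> k" and coh: "coherent_approximation_order s k B"
  shows "provides_approximation_order s k (si_space s (\<Union>\<Phi>\<in>B. entries \<Phi>))"
proof -
  obtain v C where vm: "v \<in> borel_measurable lebesgue" and v1: "\<And>\<omega>. norm (v \<omega>) \<le> 1"
    and near: "ae_near_origin (\<lambda>\<omega>.
      0 < (\<Sum>\<Phi>\<in>B. (norm (pairing (v \<omega>) \<Phi> \<omega>))\<^sup>2) \<and>
      (\<Sum>\<Phi>\<in>B. lattice_tail s (pairing (v \<omega>) \<Phi>) \<omega>)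
        \<le> ennreal (C * norm \<omega> powr (2 * k) * (\<Sum>\<Phi>\<in>B. (norm (pairing (v \<omega>) \<Phi> \<omega>))\<^sup>2)))"
    using coherent_supervector[OF B sk(1) coh] by blast
  define c where "c \<Phi> \<omega> = pairing (v \<omega>) \<Phi> \<omega>" for \<Phi> and \<omega> :: "real^'d"
  define N where "N \<omega> = sqrt (\<Sum>\<Phi>\<in>B. (norm (c \<Phi> \<omega>))\<^sup>2)" for \<omega>
  define J where "J = B \<times> (UNIV :: 'r set)"
  define a where "a p \<omega> = cnj (c (fst p) \<omega> / of_real (N \<omega>)) * cnj (v \<omega> $ snd p)" for p \<omega>
  define m where "m p = periodize 1 (a p)" for p
  define T where "T p = fst p $ snd p" for p :: "('d distr ^ 'r) \<times> 'r"
  define \<Psi> where "\<Psi> \<omega> = (\<Sum>p\<in>J. m p \<omega> * fhat (T p) \<omega>)" for \<omega>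
  have J: "finite J" unfolding J_def using B(1) by simp
  have T: "T p \<in> sobolev s" if "p \<in> J" for p using that B(2) unfolding J_def T_def by auto
  have a1: "norm (a p \<omega>) \<le> 1" if "p \<in> J" for p \<omega>
  proof -
    have "(norm (c (fst p) \<omega>))\<^sup>2 \<le> (\<Sum>\<Phi>\<in>B. (norm (c \<Phi> \<omega>))\<^sup>2)"
      using that B(1) by (intro member_le_sum) (auto simp: J_def)
    then have "norm (c (fst p) \<omega>) \<le> N \<omega>" unfolding N_def by (rule real_le_rsqrt)
    then have "norm (c (fst p) \<omega> / of_real (N \<omega>)) \<le> 1" by (auto simp: norm_divide divide_le_eq_1)
    moreover have "norm (v \<omega> $ snd p) \<le> 1" using Finite_Cartesian_Product.norm_nth_le[of "v \<omega>" "snd p"] v1[of \<omega>] by linarith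
    ultimately have "norm (c (fst p) \<omega> / of_real (N \<omega>)) * norm (v \<omega> $ snd p) \<le> 1 * 1" by (intro mult_mono) auto
    then show ?thesis unfolding a_def by (simp add: norm_mult norm_divide)
  qed
  have cm: "c \<Phi> \<in> borel_measurable lebesgue" if "\<Phi> \<in> B" for \<Phi>
    unfolding c_def[abs_def] by (rule measurable_star_prod[OF vm]) (use B(2) that in auto)
  have Nm[measurable]: "N \<in> borel_measurable lebesgue"
    unfolding N_def[abs_def]
    by (intro measurable_compose[OF _ borel_measurable_sqrt] borel_measurable_sum borel_measurable_power
        measurable_compose[OF cm borel_measurable_norm])
  have am: "a p \<in> borel_measurable lebesgue" if "p \<in> J" for p
  proof -
    have [measurable]: "c (fst p) \<in> borel_measurable lebesgue" using that cm by (auto simp: J_def)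
    show ?thesis unfolding a_def[abs_def]
      by (intro borel_measurable_times measurable_cnj measurable_vec_nth vm) measurable
  qed
  have mm: "m p \<in> borel_measurable lebesgue" if "p \<in> J" for p
    unfolding m_def
  proof (rule borel_measurable_periodize)
    have [measurable]: "a p \<in> borel_measurable lebesgue" "(\<lambda>\<omega>::real^'d. norm \<omega>) \<in> borel_measurable lebesgue"
      using am[OF that] by (auto intro!: borel_measurable_lebesgue_continuous continuous_intros)
    show "(\<lambda>\<omega>. if norm \<omega> < 1 then a p \<omega> else 0) \<in> borel_measurable lebesgue" by measurable
  qed simp
  have mp: "periodic (m p)" for p unfolding m_def by (rule periodic_periodize) simp
  have m1: "norm (m p \<omega>) \<le> 1" if "p \<in> J" for p \<omega>
    unfolding m_def by (rule norm_periodize_le[OF a1[OF that]])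
  have "weighted_L2 s \<Psi>"
    unfolding \<Psi>_def[abs_def]
  proof (rule weighted_L2_sum[OF J])
    fix p assume p: "p \<in> J"
    show "weighted_L2 s (\<lambda>\<omega>. m p \<omega> * fhat (T p) \<omega>)"
      by (rule weighted_L2_bound[OF sobolevD(3)[OF T[OF p]], of _ 1])
        (auto simp: norm_mult intro!: borel_measurable_times mm p measurable_fhat[OF T] AE_I2 mult_left_le_one_le m1)
  qed
  then obtain \<psi> where \<psi>: "\<psi> \<in> sobolev s" "has_fourier \<psi> \<Psi>" by (rule sobolev_exists)
  have "\<psi> \<in> si_space s (\<Union>\<Phi>\<in>B. entries \<Phi>)"
  proof (rule superfunction_in_si_space[OF J _ mm mp m1 sobolevD(1)[OF \<psi>(1)]])
    show "has_fourier \<psi> (\<lambda>\<omega>. \<Sum>p\<in>J. m p \<omega> * fhat (T p) \<omega>)" using \<psi>(2) unfolding \<Psi>_def[abs_def] .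
    show "T p \<in> (\<Union>\<Phi>\<in>B. entries \<Phi>)" if "p \<in> J" for p using that unfolding J_def T_def entries_def by (auto intro!: bexI[of _ "fst p"])
  qed
  moreover have "ae_near_origin (\<lambda>\<omega>. \<Psi> \<omega> \<noteq> 0 \<and>
      lattice_tail s \<Psi> \<omega> \<le> ennreal (C * norm \<omega> powr (2 * k) * (norm (\<Psi> \<omega>))\<^sup>2))"
    using ae_near_origin_conj[OF near ae_near_origin_ball[OF zero_less_one]]
  proof (rule ae_near_origin_mono)
    fix \<omega> :: "real^'d"
    assume *: "(0 < (\<Sum>\<Phi>\<in>B. (norm (pairing (v \<omega>) \<Phi> \<omega>))\<^sup>2) \<and>
      (\<Sum>\<Phi>\<in>B. lattice_tail s (pairing (v \<omega>) \<Phi>) \<omega>)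
        \<le> ennreal (C * norm \<omega> powr (2 * k) * (\<Sum>\<Phi>\<in>B. (norm (pairing (v \<omega>) \<Phi> \<omega>))\<^sup>2)))
      \<and> norm \<omega> < 1 \<and> \<omega> \<noteq> 0"
    have N2: "(N \<omega>)\<^sup>2 = (\<Sum>\<Phi>\<in>B. (norm (c \<Phi> \<omega>))\<^sup>2)" unfolding N_def by (simp add: sum_nonneg)
    have Npos: "N \<omega> > 0" using * unfolding N_def c_def by simp
    let ?b = "\<lambda>\<Phi>. cnj (c \<Phi> \<omega> / of_real (N \<omega>))"
    have shift: "\<Psi> (\<omega> + \<alpha>) = (\<Sum>\<Phi>\<in>B. ?b \<Phi> * pairing (v \<omega>) \<Phi> (\<omega> + \<alpha>))" if "\<alpha> \<in> dual_lattice" for \<alpha>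
    proof -
      have "m p (\<omega> + \<alpha>) = a p \<omega>" for p
        unfolding m_def using periodize_eq[OF that, of "\<omega> + \<alpha>" 1 "a p"] * by simp
      then have "\<Psi> (\<omega> + \<alpha>) = (\<Sum>p\<in>B \<times> UNIV. a p \<omega> * fhat (T p) (\<omega> + \<alpha>))"
        unfolding \<Psi>_def J_def by simp
      also have "\<dots> = (\<Sum>\<Phi>\<in>B. \<Sum>i\<in>UNIV. a (\<Phi>, i) \<omega> * fhat (T (\<Phi>, i)) (\<omega> + \<alpha>))"
        by (simp add: sum.cartesian_product)
      finally show ?thesis
        unfolding star_prod_fhat_vec a_def T_def by (simp add: sum_distrib_left mult.assoc)
    qed
    have \<Psi>0: "\<Psi> \<omega> = of_real (N \<omega>)"
    proof -
      have "\<Psi> \<omega> = (\<Sum>\<Phi>\<in>B. ?b \<Phi> * c \<Phi> \<omega>)" using shift[of 0] unfolding c_def by simp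
      also have "\<dots> = (\<Sum>\<Phi>\<in>B. of_real ((norm (c \<Phi> \<omega>))\<^sup>2)) / of_real (N \<omega>)"
        by (simp add: sum_divide_distrib complex_norm_square mult.commute del: of_real_power)
      also have "\<dots> = of_real ((N \<omega>)\<^sup>2) / of_real (N \<omega>)" unfolding N2 by simp
      also have "\<dots> = of_real (N \<omega>)" using Npos by (simp add: power2_eq_square)
      finally show ?thesis .
    qed
    have b1: "(\<Sum>\<Phi>\<in>B. (norm (?b \<Phi>))\<^sup>2) = 1"
      using Npos by (simp add: norm_divide power_divide sum_divide_distrib[symmetric] N2[symmetric])
    have "lattice_tail s \<Psi> \<omega> \<le> ennreal 1 * (\<Sum>\<Phi>\<in>B. lattice_tail s (pairing (v \<omega>) \<Phi>) \<omega>)"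
    proof (rule lattice_tail_le_sum[OF B(1)])
      fix n
      show "(norm (\<Psi> (\<omega> + lat n)))\<^sup>2 \<le> 1 * (\<Sum>\<Phi>\<in>B. (norm (pairing (v \<omega>) \<Phi> (\<omega> + lat n)))\<^sup>2)"
        unfolding shift[OF lat_in(1)] b1[symmetric] by (rule norm_sum_mult_le)
    qed simp
    also have "\<dots> \<le> ennreal (C * norm \<omega> powr (2 * k) * (N \<omega>)\<^sup>2)" using * unfolding N2 c_def by simp
    finally show "\<Psi> \<omega> \<noteq> 0 \<and> lattice_tail s \<Psi> \<omega> \<le> ennreal (C * norm \<omega> powr (2 * k) * (norm (\<Psi> \<omega>))\<^sup>2)"
      unfolding \<Psi>0 using Npos by simp
  qed
  ultimately show ?thesis by (intro approximation_order_si_space[OF sk _ \<psi>(2)])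
qed

section \<open>Regular universal supervectors\<close>

lemma span_entries:
  fixes B :: "('d::finite distr ^ 'r::finite) set"
  assumes S: "distr.subspace S" and B: "\<And>\<Phi> i. \<Phi> \<in> B \<Longrightarrow> \<Phi> $ i \<in> S" and \<Phi>: "\<Phi> \<in> distr_vec.span B"
  shows "\<Phi> $ i \<in> S"
proof -
  have "distr_vec.subspace {\<Phi> :: 'd distr ^ 'r. \<forall>i. \<Phi> $ i \<in> S}"
    using S unfolding distr_vec.subspace_def distr.subspace_def by (simp add: distr_vec_scale_def)
  with B have "distr_vec.span B \<subseteq> {\<Phi>. \<forall>i. \<Phi> $ i \<in> S}" by (intro distr_vec.span_minimal) auto
  with \<Phi> show ?thesis by blast
qed

lemma si_space_span:
  fixes B :: "('d::finite distr ^ 'r::finite) set"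
  shows "si_space s (\<Union>\<Phi>\<in>distr_vec.span B. entries \<Phi>) = si_space s (\<Union>\<Phi>\<in>B. entries \<Phi>)"
proof -
  have "(\<Union>\<Phi>\<in>distr_vec.span B. entries \<Phi>) \<subseteq> S \<longleftrightarrow> (\<Union>\<Phi>\<in>B. entries \<Phi>) \<subseteq> S" if S: "closed_shift_invariant s S" for S
  proof
    assume "(\<Union>\<Phi>\<in>distr_vec.span B. entries \<Phi>) \<subseteq> S"
    then show "(\<Union>\<Phi>\<in>B. entries \<Phi>) \<subseteq> S" using distr_vec.span_base[of _ B] by blast
  next
    assume "(\<Union>\<Phi>\<in>B. entries \<Phi>) \<subseteq> S"
    then have b: "\<Phi> $ i \<in> S" if "\<Phi> \<in> B" for \<Phi> i using that unfolding entries_def by auto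
    have "distr.subspace S" using S unfolding closed_shift_invariant_def by blast
    then have "\<Phi> $ i \<in> S" if "\<Phi> \<in> distr_vec.span B" for \<Phi> i by (rule span_entries[OF _ b that])
    then show "(\<Union>\<Phi>\<in>distr_vec.span B. entries \<Phi>) \<subseteq> S" unfolding entries_def by auto
  qed
  then have "{S. closed_shift_invariant s S \<and> (\<Union>\<Phi>\<in>distr_vec.span B. entries \<Phi>) \<subseteq> S}
    = {S. closed_shift_invariant s S \<and> (\<Union>\<Phi>\<in>B. entries \<Phi>) \<subseteq> S}" by blast
  then show ?thesis unfolding si_space_def by simp
qed

text \<open>
  The Fourier transform of \<open>\<Phi>\<close> is a linear combination of those of the basis, so by
  Cauchy-Schwarz the form of its Gramian is dominated by that of the combined Gramian.
\<close>
lemma span_lattice_tail_le: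
  fixes B :: "('d::finite distr ^ 'r::finite) set"
  assumes B: "finite B" "\<And>\<Phi> i. \<Phi> \<in> B \<Longrightarrow> \<Phi> $ i \<in> sobolev s" and \<Phi>: "\<Phi> \<in> distr_vec.span B" "\<And>i. \<Phi> $ i \<in> sobolev s"
  shows "\<exists>A\<ge>0. AE \<omega> in lebesgue. \<forall>v. lattice_tail s (pairing v \<Phi>) \<omega>
     \<le> ennreal A * (\<Sum>\<Psi>\<in>B. lattice_tail s (pairing v \<Psi>) \<omega>)"
proof -
  obtain a where a: "\<Phi> = (\<Sum>\<Psi>\<in>B. distr_vec_scale (a \<Psi>) \<Psi>)"
    using \<Phi>(1) unfolding distr_vec.span_finite[OF B(1)] by blast
  define A where "A = (\<Sum>\<Psi>\<in>B. (norm (a \<Psi>))\<^sup>2)"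
  have "AE \<omega> in lebesgue. fhat (\<Phi> $ i) \<omega> = (\<Sum>\<Psi>\<in>B. a \<Psi> * fhat (\<Psi> $ i) \<omega>)" for i
  proof (rule fhat_AE)
    have "\<Phi> $ i = (\<Sum>\<Psi>\<in>B. distr_scale (a \<Psi>) (\<Psi> $ i))"
      by (subst a) (simp add: sum_component distr_vec_scale_def)
    then show "has_fourier (\<Phi> $ i) (\<lambda>\<omega>. \<Sum>\<Psi>\<in>B. a \<Psi> * fhat (\<Psi> $ i) \<omega>)"
      using B by (auto intro!: has_fourier_sum has_fourier_scale sobolevD(2))
  qed
  then have "AE \<omega> in lebesgue. \<forall>i\<in>UNIV. fhat (\<Phi> $ i) \<omega> = (\<Sum>\<Psi>\<in>B. a \<Psi> * fhat (\<Psi> $ i) \<omega>)"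
    by (subst AE_ball_countable) (auto intro: countable_finite)
  from AE_lebesgue_translate[OF this]
  have "AE \<omega> in lebesgue. \<forall>n. \<forall>i\<in>UNIV. fhat (\<Phi> $ i) (\<omega> + lat n) = (\<Sum>\<Psi>\<in>B. a \<Psi> * fhat (\<Psi> $ i) (\<omega> + lat n))"
    by (subst AE_all_countable) blast
  then have "AE \<omega> in lebesgue. \<forall>v. lattice_tail s (pairing v \<Phi>) \<omega>
     \<le> ennreal A * (\<Sum>\<Psi>\<in>B. lattice_tail s (pairing v \<Psi>) \<omega>)"
  proof (eventually_elim, intro allI)
    fix \<omega> :: "real^'d" and v :: "complex^'r"
    assume *: "\<forall>n. \<forall>i\<in>UNIV. fhat (\<Phi> $ i) (\<omega> + lat n) = (\<Sum>\<Psi>\<in>B. a \<Psi> * fhat (\<Psi> $ i) (\<omega> + lat n))"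
    show "lattice_tail s (pairing v \<Phi>) \<omega>
     \<le> ennreal A * (\<Sum>\<Psi>\<in>B. lattice_tail s (pairing v \<Psi>) \<omega>)"
    proof (rule lattice_tail_le_sum[OF B(1)])
      show "0 \<le> A" unfolding A_def by (intro sum_nonneg) auto
      fix n
      have "pairing v \<Phi> (\<omega> + lat n) = (\<Sum>i\<in>UNIV. cnj (v $ i) * (\<Sum>\<Psi>\<in>B. a \<Psi> * fhat (\<Psi> $ i) (\<omega> + lat n)))"
        unfolding star_prod_fhat_vec using * by simp
      also have "\<dots> = (\<Sum>i\<in>UNIV. \<Sum>\<Psi>\<in>B. a \<Psi> * (cnj (v $ i) * fhat (\<Psi> $ i) (\<omega> + lat n)))"
        by (simp add: sum_distrib_left mult.left_commute)
      also have "\<dots> = (\<Sum>\<Psi>\<in>B. \<Sum>i\<in>UNIV. a \<Psi> * (cnj (v $ i) * fhat (\<Psi> $ i) (\<omega> + lat n)))"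
        by (rule sum.swap)
      also have "\<dots> = (\<Sum>\<Psi>\<in>B. a \<Psi> * pairing v \<Psi> (\<omega> + lat n))"
        unfolding star_prod_fhat_vec by (simp add: sum_distrib_left)
      finally show "(norm (pairing v \<Phi> (\<omega> + lat n)))\<^sup>2
        \<le> A * (\<Sum>\<Psi>\<in>B. (norm (pairing v \<Psi> (\<omega> + lat n)))\<^sup>2)"
        unfolding A_def by (simp only: norm_sum_mult_le)
    qed
  qed
  moreover have "0 \<le> A" unfolding A_def by (intro sum_nonneg) auto
  ultimately show ?thesis by blast
qed

lemma supervector_lattice_tail:
  fixes B :: "('d::finite distr ^ 'r::finite) set"
  assumes B: "finite B" "\<And>\<Phi> i. \<Phi> \<in> B \<Longrightarrow> \<Phi> $ i \<in> sobolev s" and \<Phi>: "\<Phi> \<in> distr_vec.span B" "\<And>i. \<Phi> $ i \<in> sobolev s"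
    and v: "regular_universal_supervector s k B v" "bounded_near_origin v"
  shows "\<exists>C\<ge>0. ae_near_origin (\<lambda>\<omega>. lattice_tail s (pairing (v \<omega>) \<Phi>) \<omega> \<le> ennreal (C * norm \<omega> powr (2 * k)))"
proof -
  obtain A where A: "A \<ge> 0" "AE \<omega> in lebesgue. \<forall>v. lattice_tail s (pairing v \<Phi>) \<omega>
     \<le> ennreal A * (\<Sum>\<Psi>\<in>B. lattice_tail s (pairing v \<Psi>) \<omega>)"
    using span_lattice_tail_le[OF B \<Phi>] by blast
  obtain C where C: "ae_near_origin (\<lambda>\<omega>. \<bar>qform (truncated_combined_gramian s B \<omega>) (v \<omega>) / (norm (v \<omega>))\<^sup>2\<bar> \<le> C * norm \<omega> powr (2 * k))"
    using v(1) unfolding regular_universal_supervector_def by blast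
  obtain K where K: "ae_near_origin (\<lambda>\<omega>. norm (v \<omega>) \<le> K)"
    using v(2) unfolding bounded_near_origin_def by blast
  define C' where "C' = A * (\<bar>C\<bar> * K\<^sup>2)"
  have "ae_near_origin (lattice_form s B)"
    by (rule ae_near_originI[OF zero_less_one lattice_form_AE[OF B]])
  from ae_near_origin_conj[OF ae_near_origin_conj[OF C K] ae_near_origin_conj[OF ae_near_origin_AE[OF A(2)] this]]
  have "ae_near_origin (\<lambda>\<omega>. lattice_tail s (pairing (v \<omega>) \<Phi>) \<omega> \<le> ennreal (C' * norm \<omega> powr (2 * k)))"
  proof (rule ae_near_origin_mono, elim conjE)
    fix \<omega>
    let ?q = "qform (truncated_combined_gramian s B \<omega>) (v \<omega>)"
    assume 1: "\<bar>?q / (norm (v \<omega>))\<^sup>2\<bar> \<le> C * norm \<omega> powr (2 * k)" and 2: "norm (v \<omega>) \<le> K"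
      and 3: "\<forall>v. lattice_tail s (pairing v \<Phi>) \<omega>
       \<le> ennreal A * (\<Sum>\<Psi>\<in>B. lattice_tail s (pairing v \<Psi>) \<omega>)"
      and 4: "lattice_form s B \<omega>"
    have q: "?q \<le> \<bar>C\<bar> * K\<^sup>2 * norm \<omega> powr (2 * k)"
    proof (cases "v \<omega> = 0")
      case True
      then show ?thesis by (simp add: qform_zero_right)
    next
      case False
      have "?q = (?q / (norm (v \<omega>))\<^sup>2) * (norm (v \<omega>))\<^sup>2" using False by simp
      also have "\<dots> \<le> (C * norm \<omega> powr (2 * k)) * (norm (v \<omega>))\<^sup>2"
        using abs_le_D1[OF 1] by (intro mult_right_mono) auto
      also have "\<dots> \<le> (\<bar>C\<bar> * norm \<omega> powr (2 * k)) * K\<^sup>2"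
        using 2 by (intro mult_mono mult_right_mono power_mono) auto
      finally show ?thesis by (simp add: mult_ac)
    qed
    have "lattice_tail s (pairing (v \<omega>) \<Phi>) \<omega> \<le> ennreal A * ennreal ?q"
      using 3 lattice_formD(2)[OF 4, of "v \<omega>"] by simp
    also have "\<dots> = ennreal (A * ?q)" using A(1) lattice_formD(1)[OF 4] by (simp add: ennreal_mult)
    also have "\<dots> \<le> ennreal (C' * norm \<omega> powr (2 * k))"
      using mult_left_mono[OF q A(1)] unfolding C'_def by (intro ennreal_leI) (simp add: mult.assoc)
    finally show "lattice_tail s (pairing (v \<omega>) \<Phi>) \<omega> \<le> ennreal (C' * norm \<omega> powr (2 * k))" .
  qed
  moreover have "C' \<ge> 0" unfolding C'_def using A(1) by simp
  ultimately show ?thesis by blast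
qed

lemma periodic_extension_lattice_tail:
  assumes "periodic V" "V \<omega> = w"
  shows "lattice_tail s (\<lambda>\<xi>. pairing (V \<xi>) \<Phi> \<xi>) \<omega> = lattice_tail s (pairing w \<Phi>) \<omega>"
proof (rule lattice_tail_cong)
  fix n
  have "V (\<omega> + lat n) = w" using assms bspec[OF _ lat_in(1)[of n]] unfolding periodic_def by blast
  then show "pairing (V (\<omega> + lat n)) \<Phi> (\<omega> + lat n) = pairing w \<Phi> (\<omega> + lat n)" by simp
qed

lemma weighted_L2_star_prod:
  fixes V :: "real^'d::finite \<Rightarrow> complex^'r::finite"
  assumes V: "V \<in> borel_measurable lebesgue" "\<And>\<omega>. norm (V \<omega>) \<le> K" and \<Phi>: "\<And>i. \<Phi> $ i \<in> sobolev s"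
  shows "weighted_L2 s (\<lambda>\<omega>. pairing (V \<omega>) \<Phi> \<omega>)"
  unfolding star_prod_fhat_vec
proof (rule weighted_L2_sum)
  fix i
  show "weighted_L2 s (\<lambda>\<omega>. cnj (V \<omega> $ i) * fhat (\<Phi> $ i) \<omega>)"
  proof (rule weighted_L2_bound[OF sobolevD(3)[OF \<Phi>[of i]], of _ K])
    show "(\<lambda>\<omega>. cnj (V \<omega> $ i) * fhat (\<Phi> $ i) \<omega>) \<in> borel_measurable lebesgue"
      by (intro borel_measurable_times measurable_cnj measurable_vec_nth V measurable_fhat[OF \<Phi>])
    have "norm (V \<omega> $ i) \<le> K" for \<omega> using Finite_Cartesian_Product.norm_nth_le[of "V \<omega>" i] V(2)[of \<omega>] by linarith
    then show "AE \<omega> in lebesgue. norm (cnj (V \<omega> $ i) * fhat (\<Phi> $ i) \<omega>) \<le> K * norm (fhat (\<Phi> $ i) \<omega>)"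
      by (auto simp: norm_mult intro!: AE_I2 mult_right_mono)
  qed
qed simp

lemma periodic_extensionD:
  assumes "periodic_extension v V"
  obtains K where "V \<in> borel_measurable lebesgue" "periodic V" "\<And>\<omega>. norm (V \<omega>) \<le> K" "ae_near_origin (\<lambda>\<omega>. V \<omega> = v \<omega>)"
  using assms unfolding periodic_extension_def bounded_iff by auto

lemma supervector_product_unique:
  assumes V: "periodic_extension v V" and \<Phi>: "\<And>i. \<Phi> $ i \<in> sobolev s"
  shows "\<exists>!\<psi>. supervector_product V \<Phi> \<psi>"
proof -
  obtain K where K: "V \<in> borel_measurable lebesgue" "\<And>\<omega>. norm (V \<omega>) \<le> K"
    using periodic_extensionD[OF V] by metis
  obtain \<psi> where "supervector_product V \<Phi> \<psi>"
    using has_fourier_exists[OF weighted_L2_star_prod[OF K \<Phi>]] unfolding supervector_product_def by blast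
  then show ?thesis
    unfolding supervector_product_def using tempered_eqI by blast
qed

lemma supervector_product_in_si_space:
  assumes V: "periodic_extension v V" and \<psi>: "supervector_product V \<Phi> \<psi>"
  shows "\<psi> \<in> si_space s (entries \<Phi>)"
proof -
  obtain K where K: "V \<in> borel_measurable lebesgue" "periodic V" "\<And>\<omega>. norm (V \<omega>) \<le> K"
    using periodic_extensionD[OF V] by metis
  show ?thesis
  proof (rule superfunction_in_si_space[where J=UNIV and T="\<lambda>i. \<Phi> $ i" and m="\<lambda>i \<omega>. cnj (V \<omega> $ i)" and K=K])
    show "has_fourier \<psi> (\<lambda>\<omega>. \<Sum>i\<in>UNIV. cnj (V \<omega> $ i) * fhat (\<Phi> $ i) \<omega>)" "tempered \<psi>"
      using \<psi> unfolding supervector_product_def star_prod_fhat_vec by auto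
    show "(\<lambda>\<omega>. cnj (V \<omega> $ i)) \<in> borel_measurable lebesgue" for i by (intro measurable_cnj measurable_vec_nth K)
    show "periodic (\<lambda>\<omega>. cnj (V \<omega> $ i))" for i using K(2) unfolding periodic_def by simp
    show "norm (cnj (V \<omega> $ i)) \<le> K" for i \<omega>
      using Finite_Cartesian_Product.norm_nth_le[of "V \<omega>" i] K(3)[of \<omega>] by simp
  qed (auto simp: entries_def)
qed

text \<open>
  A single summand of the lattice tail is at most the whole tail, and the weight at \<open>\<omega> + \<alpha>\<close> is
  bounded away from zero for \<open>\<omega>\<close> near the origin.
\<close>
lemma supervector_strang_fix:
  fixes \<Phi> :: "'d::finite distr ^ 'r::finite"
  assumes V: "periodic_extension v V" and \<psi>: "supervector_product V \<Phi> \<psi>" and C: "C \<ge> 0"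
    and tail: "ae_near_origin (\<lambda>\<omega>. lattice_tail s (pairing (v \<omega>) \<Phi>) \<omega> \<le> ennreal (C * norm \<omega> powr (2 * k)))"
  shows "strang_fix k \<psi>"
  unfolding strang_fix_def
proof
  fix \<alpha> :: "real^'d" assume \<alpha>: "\<alpha> \<in> dual_lattice - {0}"
  obtain K where K: "periodic V" "ae_near_origin (\<lambda>\<omega>. V \<omega> = v \<omega>)"
    using periodic_extensionD[OF V] by metis
  obtain n where n: "lat n = \<alpha>" using lat_surj \<alpha> by blast
  have f: "AE \<omega> in lebesgue. fhat \<psi> (\<omega> + \<alpha>) = pairing (V (\<omega> + \<alpha>)) \<Phi> (\<omega> + \<alpha>)"
    using \<psi> unfolding supervector_product_def by (intro AE_lebesgue_translate[OF fhat_AE]) auto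
  define \<delta> where "\<delta> = min 1 ((1 + norm \<alpha>) powr (2 * s))"
  have \<delta>: "\<delta> > 0" unfolding \<delta>_def by (simp add: add_nonneg_eq_0_iff)
  have "ae_near_origin (\<lambda>\<omega>. norm (fhat \<psi> (\<omega> + \<alpha>)) \<le> sqrt (C / \<delta>) * norm \<omega> powr k)"
    using ae_near_origin_conj[OF ae_near_origin_conj[OF K(2) tail]
        ae_near_origin_conj[OF ae_near_origin_AE[OF f] ae_near_origin_ball[OF zero_less_one]]]
  proof (rule ae_near_origin_mono, elim conjE)
    fix \<omega>
    assume 1: "V \<omega> = v \<omega>" and 2: "lattice_tail s (pairing (v \<omega>) \<Phi>) \<omega> \<le> ennreal (C * norm \<omega> powr (2 * k))"
      and 3: "fhat \<psi> (\<omega> + \<alpha>) = pairing (V (\<omega> + \<alpha>)) \<Phi> (\<omega> + \<alpha>)" and 4: "norm \<omega> < 1"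
    let ?p = "norm (fhat \<psi> (\<omega> + \<alpha>))"
    have p: "?p = norm (pairing (v \<omega>) \<Phi> (\<omega> + lat n))"
      using 1 3 K(1) \<alpha> n unfolding periodic_def by simp
    have "2 * pi \<le> norm \<alpha>" using \<alpha> by (intro norm_dual_lattice_ge) auto
    moreover have "norm \<alpha> \<le> norm (\<omega> + \<alpha>) + norm \<omega>" using norm_triangle_ineq4[of "\<omega> + \<alpha>" \<omega>] by simp
    ultimately have lo: "1 \<le> norm (\<omega> + \<alpha>)" using 4 pi_ge_two by linarith
    have hi: "norm (\<omega> + \<alpha>) \<le> 1 + norm \<alpha>" using norm_triangle_ineq[of \<omega> \<alpha>] 4 by linarith
    have \<delta>le: "\<delta> \<le> norm (\<omega> + \<alpha>) powr (2 * s)"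
    proof (cases "s \<ge> 0")
      case True
      then have "1 \<le> norm (\<omega> + \<alpha>) powr (2 * s)" using lo by (intro ge_one_powr_ge_zero) auto
      then show ?thesis unfolding \<delta>_def by simp
    next
      case False
      then have "(1 + norm \<alpha>) powr (2 * s) \<le> norm (\<omega> + \<alpha>) powr (2 * s)"
        using lo hi by (intro powr_mono2') auto
      then show ?thesis unfolding \<delta>_def by simp
    qed
    let ?t = "\<lambda>n. ennreal (norm (\<omega> + lat n) powr (2 * s) * (norm (pairing (v \<omega>) \<Phi> (\<omega> + lat n)))\<^sup>2)"
    have "ennreal (norm (\<omega> + \<alpha>) powr (2 * s) * ?p\<^sup>2) = ?t n" unfolding p by (simp only: n)
    also have "\<dots> = sum ?t {n}" by simp
    also have "\<dots> \<le> (\<Sum>n. ?t n)" by (rule sum_le_suminf[OF summableI]) auto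
    also have "\<dots> \<le> ennreal (C * norm \<omega> powr (2 * k))" using 2 unfolding lattice_tail_def .
    finally have "norm (\<omega> + \<alpha>) powr (2 * s) * ?p\<^sup>2 \<le> C * norm \<omega> powr (2 * k)"
      using C by (simp add: ennreal_le_iff)
    moreover have "\<delta> * ?p\<^sup>2 \<le> norm (\<omega> + \<alpha>) powr (2 * s) * ?p\<^sup>2" by (intro mult_right_mono \<delta>le) auto
    ultimately have "\<delta> * ?p\<^sup>2 \<le> C * norm \<omega> powr (2 * k)" by linarith
    then have "?p\<^sup>2 \<le> C / \<delta> * norm \<omega> powr (2 * k)" using \<delta> by (simp add: field_simps)
    then have "?p \<le> sqrt (C / \<delta> * norm \<omega> powr (2 * k))" by (rule real_le_rsqrt)
    also have "norm \<omega> powr (2 * k) = (norm \<omega> powr k)\<^sup>2"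
      by (simp add: power2_eq_square powr_add[symmetric])
    finally show "?p \<le> sqrt (C / \<delta>) * norm \<omega> powr k"
      by (simp only: real_sqrt_mult real_sqrt_abs abs_of_nonneg powr_ge_zero)
  qed
  then show "\<exists>C. ae_near_origin (\<lambda>\<omega>. norm (fhat \<psi> (\<omega> + \<alpha>)) \<le> C * norm \<omega> powr k)" by blast
qed

text \<open>
  Near the origin the lattice tail is of order \<open>|\<omega>| powr (2 k)\<close> while \<open>v\<^sup>*\<Phi>\<close> stays away from zero,
  so \<open>\<psi>\<close> is a superfunction.
\<close>
lemma supervector_approximation_order:
  fixes \<Phi> :: "'d::finite distr ^ 'r::finite"
  assumes sk: "s < k" "0 \<le> k"
    and V: "periodic_extension v V" and \<psi>: "supervector_product V \<Phi> \<psi>" and C: "C \<ge> 0"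
    and tail: "ae_near_origin (\<lambda>\<omega>. lattice_tail s (pairing (v \<omega>) \<Phi>) \<omega> \<le> ennreal (C * norm \<omega> powr (2 * k)))"
    and c: "c > 0" "ae_near_origin (\<lambda>\<omega>. c \<le> norm (pairing (v \<omega>) \<Phi> \<omega>))"
    and A: "\<psi> \<in> si_space s A"
  shows "provides_approximation_order s k (si_space s A)"
proof (rule approximation_order_si_space[OF sk A])
  obtain K where K: "periodic V" "ae_near_origin (\<lambda>\<omega>. V \<omega> = v \<omega>)"
    using periodic_extensionD[OF V] by metis
  let ?\<Psi> = "\<lambda>\<omega>. pairing (V \<omega>) \<Phi> \<omega>"
  show "has_fourier \<psi> ?\<Psi>" using \<psi> unfolding supervector_product_def by blast
  show "ae_near_origin (\<lambda>\<omega>. ?\<Psi> \<omega> \<noteq> 0 \<and> lattice_tail s ?\<Psi> \<omega> \<le> ennreal (C / c\<^sup>2 * norm \<omega> powr (2 * k) * (norm (?\<Psi> \<omega>))\<^sup>2))"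
    using ae_near_origin_conj[OF K(2) ae_near_origin_conj[OF tail c(2)]]
  proof (rule ae_near_origin_mono, elim conjE)
    fix \<omega>
    assume 1: "V \<omega> = v \<omega>" and 2: "lattice_tail s (pairing (v \<omega>) \<Phi>) \<omega> \<le> ennreal (C * norm \<omega> powr (2 * k))"
      and 3: "c \<le> norm (pairing (v \<omega>) \<Phi> \<omega>)"
    have nz: "?\<Psi> \<omega> \<noteq> 0" using 1 3 c(1) by auto
    have "c\<^sup>2 \<le> (norm (?\<Psi> \<omega>))\<^sup>2" using 1 3 c(1) by (intro power_mono) auto
    then have "1 \<le> (norm (?\<Psi> \<omega>))\<^sup>2 / c\<^sup>2" using c(1) by simp
    then have "C * norm \<omega> powr (2 * k) * 1 \<le> C * norm \<omega> powr (2 * k) * ((norm (?\<Psi> \<omega>))\<^sup>2 / c\<^sup>2)"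
      using C by (intro mult_left_mono) auto
    then have "C * norm \<omega> powr (2 * k) \<le> C / c\<^sup>2 * norm \<omega> powr (2 * k) * (norm (?\<Psi> \<omega>))\<^sup>2"
      by (simp add: mult_ac)
    then have "lattice_tail s ?\<Psi> \<omega> \<le> ennreal (C / c\<^sup>2 * norm \<omega> powr (2 * k) * (norm (?\<Psi> \<omega>))\<^sup>2)"
      using 2 periodic_extension_lattice_tail[OF K(1) 1, of s \<Phi>] by (auto intro: order_trans ennreal_leI)
    with nz show "?\<Psi> \<omega> \<noteq> 0 \<and> lattice_tail s ?\<Psi> \<omega> \<le> ennreal (C / c\<^sup>2 * norm \<omega> powr (2 * k) * (norm (?\<Psi> \<omega>))\<^sup>2)" by blast
  qed
qed

lemma periodic_extension_exists:
  fixes v :: "real^'d::finite \<Rightarrow> complex^'r::finite"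
  assumes m: "open \<Omega>" "0 \<in> \<Omega>" "v \<in> borel_measurable (lebesgue_on \<Omega>)" and "bounded_near_origin v"
  shows "\<exists>V. periodic_extension v V"
proof -
  obtain K where K: "ae_near_origin (\<lambda>\<omega>. norm (v \<omega>) \<le> K)" using assms(4) unfolding bounded_near_origin_def by blast
  obtain \<delta> where \<delta>: "\<delta> > 0" "ball 0 \<delta> \<subseteq> \<Omega>" using m open_contains_ball by blast
  define \<rho> where "\<rho> = min \<delta> 1"
  have \<rho>: "0 < \<rho>" "\<rho> \<le> 1" "ball 0 \<rho> \<subseteq> \<Omega>" using \<delta> unfolding \<rho>_def by auto
  \<comment> \<open>bounded everywhere, whereas \<open>v\<close> obeys the bound only up to a null set\<close>
  define u where "u \<omega> = (if norm (v \<omega>) \<le> K then v \<omega> else 0)" for \<omega>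
  define V where "V = periodize \<rho> u"
  have "norm (u \<omega>) \<le> \<bar>K\<bar>" for \<omega> unfolding u_def using abs_ge_self[of K] by auto
  then have "norm (V \<omega>) \<le> \<bar>K\<bar>" for \<omega> unfolding V_def by (rule norm_periodize_le)
  then have "bounded (range V)" unfolding bounded_iff by blast
  moreover have "periodic V" unfolding V_def by (rule periodic_periodize[OF \<rho>(2)])
  moreover have "V \<in> borel_measurable lebesgue"
    unfolding V_def
  proof (rule borel_measurable_periodize[OF \<rho>(2)])
    have "\<Omega> \<in> sets lebesgue" using m(1) by simp
    then have [measurable]: "(\<lambda>\<omega>. if \<omega> \<in> \<Omega> then v \<omega> else 0) \<in> borel_measurable lebesgue"
      using m(3) by (simp add: borel_measurable_if)
    have [measurable]: "(\<lambda>\<omega>::real^'d. norm \<omega>) \<in> borel_measurable lebesgue"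
      by (intro borel_measurable_lebesgue_continuous continuous_intros)
    let ?w = "\<lambda>\<omega>. if \<omega> \<in> \<Omega> then v \<omega> else 0"
    have "(\<lambda>\<omega>. if norm \<omega> < \<rho> then (if norm (?w \<omega>) \<le> K then ?w \<omega> else 0) else 0) \<in> borel_measurable lebesgue"
      by measurable
    moreover have "(if norm \<omega> < \<rho> then (if norm (?w \<omega>) \<le> K then ?w \<omega> else 0) else 0) = (if norm \<omega> < \<rho> then u \<omega> else 0)" for \<omega>
      using \<rho>(3) unfolding u_def by auto
    ultimately show "(\<lambda>\<omega>. if norm \<omega> < \<rho> then u \<omega> else 0) \<in> borel_measurable lebesgue" by simp
  qed
  moreover have "ae_near_origin (\<lambda>\<omega>. V \<omega> = v \<omega>)"
    using ae_near_origin_conj[OF K ae_near_origin_ball[OF \<rho>(1)]]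
  proof (rule ae_near_origin_mono)
    fix \<omega> assume *: "norm (v \<omega>) \<le> K \<and> norm \<omega> < \<rho> \<and> \<omega> \<noteq> 0"
    then have "V \<omega> = u \<omega>" unfolding V_def using periodize_eq[of 0 \<omega> \<rho> u] \<rho>(2) by simp
    with * show "V \<omega> = v \<omega>" unfolding u_def by simp
  qed
  ultimately show ?thesis unfolding periodic_extension_def by blast
qed

theorem theorem46:
  fixes P :: "real^'d::finite \<Rightarrow> complex^'r^'r::finite"
    and B :: "('d distr ^ 'r) set"
    and s k :: real
  assumes "refinement_mask P"
    and "finite B"
    and "is_basis B (refinement_solutions P)"
    and "\<forall>\<Phi>\<in>refinement_solutions P. entries \<Phi> \<subseteq> sobolev s"
    and "s < k" and "0 \<le> k"
    and "coherent_approximation_order s k B"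
  shows "(let S_P = si_space s (\<Union>\<Phi>\<in>refinement_solutions P. entries \<Phi>)
          in FSI s S_P \<and> provides_approximation_order s k S_P) \<and>
    (\<forall>v. regular_universal_supervector s k B v \<and> bounded_near_origin v \<longrightarrow>
      (\<forall>\<Phi>\<in>refinement_solutions P.
        ((\<exists>C. ae_near_origin (\<lambda>\<omega>.
            \<bar>qform (truncated_gramian s \<Phi> \<omega>) (v \<omega>)\<bar> \<le> C * norm \<omega> powr (2 * k))) \<and>
         (\<forall>V. periodic_extension v V \<longrightarrow>
            (\<exists>!\<psi>. supervector_product V \<Phi> \<psi>) \<and>
            (\<forall>\<psi>. supervector_product V \<Phi> \<psi> \<longrightarrow> strang_fix k \<psi>))) \<and>
        ((\<exists>c>0. ae_near_origin (\<lambda>\<omega>. c \<le> norm (star_prod (v \<omega>) (fhat_vec \<Phi> \<omega>)))) \<longrightarrow>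
         provides_approximation_order s k (si_space s (entries \<Phi>)) \<and>
         (\<forall>V \<psi>. periodic_extension v V \<and> supervector_product V \<Phi> \<psi> \<longrightarrow>
            \<psi> \<in> si_space s (entries \<Phi>) \<and>
            provides_approximation_order s k (si_space s {\<psi>})))))"
proof -
  have span: "distr_vec.span B = refinement_solutions P" using assms(3) unfolding is_basis_def by blast
  have sob: "\<Phi> $ i \<in> sobolev s" if "\<Phi> \<in> distr_vec.span B" for \<Phi> :: "'d distr ^ 'r" and i
    using assms(4) that unfolding span entries_def by auto
  have B: "\<Phi> $ i \<in> sobolev s" if "\<Phi> \<in> B" for \<Phi> :: "'d distr ^ 'r" and i
    using sob distr_vec.span_base[OF that] .
  let ?A = "\<Union>\<Phi>\<in>B. entries \<Phi>"
  have S: "si_space s (\<Union>\<Phi>\<in>refinement_solutions P. entries \<Phi>) = si_space s ?A"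
    unfolding span[symmetric] by (rule si_space_span)
  have "finite ?A" using assms(2) by (auto simp: entries_def)
  moreover have "?A \<subseteq> sobolev s" using B by (auto simp: entries_def)
  ultimately have fsi: "FSI s (si_space s ?A)" unfolding FSI_def by blast
  have order: "provides_approximation_order s k (si_space s ?A)"
    by (rule coherent_approximation_order_si_space[OF assms(2) B assms(5,6,7)])
  have b: "((\<exists>C. ae_near_origin (\<lambda>\<omega>.
            \<bar>qform (truncated_gramian s \<Phi> \<omega>) (v \<omega>)\<bar> \<le> C * norm \<omega> powr (2 * k))) \<and>
         (\<forall>V. periodic_extension v V \<longrightarrow>
            (\<exists>!\<psi>. supervector_product V \<Phi> \<psi>) \<and>
            (\<forall>\<psi>. supervector_product V \<Phi> \<psi> \<longrightarrow> strang_fix k \<psi>))) \<and>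
        ((\<exists>c>0. ae_near_origin (\<lambda>\<omega>. c \<le> norm (pairing (v \<omega>) \<Phi> \<omega>))) \<longrightarrow>
         provides_approximation_order s k (si_space s (entries \<Phi>)) \<and>
         (\<forall>V \<psi>. periodic_extension v V \<and> supervector_product V \<Phi> \<psi> \<longrightarrow>
            \<psi> \<in> si_space s (entries \<Phi>) \<and>
            provides_approximation_order s k (si_space s {\<psi>})))"
    if v: "regular_universal_supervector s k B v" "bounded_near_origin v" and "\<Phi> \<in> refinement_solutions P" for v \<Phi>
  proof -
    have \<Phi>: "\<Phi> \<in> distr_vec.span B" using that(3) span by simp
    note \<Phi>s = sob[OF \<Phi>]
    obtain C where C: "C \<ge> 0" and tail: "ae_near_origin (\<lambda>\<omega>.
        lattice_tail s (pairing (v \<omega>) \<Phi>) \<omega> \<le> ennreal (C * norm \<omega> powr (2 * k)))"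
      using supervector_lattice_tail[OF assms(2) B \<Phi> \<Phi>s v] by blast
    have i: "ae_near_origin (\<lambda>\<omega>. \<bar>qform (truncated_gramian s \<Phi> \<omega>) (v \<omega>)\<bar> \<le> C * norm \<omega> powr (2 * k))"
      using ae_near_origin_conj[OF tail ae_near_originI[OF zero_less_one lattice_form_singleton[OF \<Phi>s]]]
    proof (rule ae_near_origin_mono, elim conjE)
      fix \<omega>
      let ?q = "\<lambda>v. qform (truncated_gramian s \<Phi> \<omega>) v"
      assume 1: "lattice_tail s (pairing (v \<omega>) \<Phi>) \<omega> \<le> ennreal (C * norm \<omega> powr (2 * k))"
        and 2: "lattice_form s {\<Phi>} \<omega>"
      note f = lattice_formD[OF 2, of "v \<omega>", unfolded combined_gramian_singleton sum_singleton]
      from 1 f(2) have "ennreal (?q (v \<omega>)) \<le> ennreal (C * norm \<omega> powr (2 * k))" by simp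
      then have "?q (v \<omega>) \<le> C * norm \<omega> powr (2 * k)" using C by (subst (asm) ennreal_le_iff) auto
      with f(1) show "\<bar>?q (v \<omega>)\<bar> \<le> C * norm \<omega> powr (2 * k)" by simp
    qed
    have ii: "provides_approximation_order s k (si_space s (entries \<Phi>)) \<and>
         (\<forall>V \<psi>. periodic_extension v V \<and> supervector_product V \<Phi> \<psi> \<longrightarrow>
            \<psi> \<in> si_space s (entries \<Phi>) \<and> provides_approximation_order s k (si_space s {\<psi>}))"
      if c: "c > 0" "ae_near_origin (\<lambda>\<omega>. c \<le> norm (pairing (v \<omega>) \<Phi> \<omega>))" for c
    proof (intro conjI allI impI)
      obtain \<Omega> where "open \<Omega>" "0 \<in> \<Omega>" "v \<in> borel_measurable (lebesgue_on \<Omega>)"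
        using v(1) unfolding regular_universal_supervector_def by blast
      from periodic_extension_exists[OF this v(2)] obtain V where V: "periodic_extension v V" by blast
      obtain \<psi> where \<psi>: "supervector_product V \<Phi> \<psi>" using supervector_product_unique[OF V \<Phi>s] by blast
      show "provides_approximation_order s k (si_space s (entries \<Phi>))"
        by (rule supervector_approximation_order[OF assms(5,6) V \<psi> C tail c supervector_product_in_si_space[OF V \<psi>]])
    next
      fix V \<psi> assume *: "periodic_extension v V \<and> supervector_product V \<Phi> \<psi>"
      show "\<psi> \<in> si_space s (entries \<Phi>)" using * by (intro supervector_product_in_si_space) auto
      show "provides_approximation_order s k (si_space s {\<psi>})"
        by (rule supervector_approximation_order[OF assms(5,6) conjunct1[OF *] conjunct2[OF *] C tail c])
          (rule si_space_base, simp)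
    qed
    show ?thesis
      using i ii supervector_product_unique[OF _ \<Phi>s] supervector_strang_fix[OF _ _ C tail] by blast
  qed
  show ?thesis unfolding Let_def S using fsi order b by blast
qed

end
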